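(* Let $\mathcal A=\{A(0),\dots,A(s-1)\}$ be a finite set of nonnegative $2\times 2$ matrices such that at least one of the $A(k)$ is not diagonal. Let $p_0,\dots,p_{s-1}>0$ with $\sum_k p_k=1$, let $\{0,\dots,s-1\}^{\mathbb N}$ be endowed with the corresponding product probability, and for $\omega=(\omega_n)\in\{0,\dots,s-1\}^{\mathbb N}$ let $P_n=P_n(\omega)=A(\omega_1)\cdots A(\omega_n)$. Let $\lambda_1(n)\ge\lambda_2(n)\ge 0$ be the singular values of $P_n$ (the nonnegative square roots of the eigenvalues of ${}^tP_nP_n$). Then: (i) The normalized columns of $P_n$ converge almost surely with an exponential rate of convergence if and only if almost surely $$\lim_{n\to\infty}(\lambda_1(n))^{1/n}\ne\lim_{n\to\infty}(\lambda_2(n))^{1/n}.\qquad( * )$$ (ii) If $( * )$ holds almost surely, then the limit points of the normalized matrix $\frac{P_n}{\Vert P_n\Vert}$ have almost surely rank $1$ and, given a nonnegative column vector $V$, the normalized column vector $\frac{P_nV}{\Vert P_nV\Vert}$ converges almost surely with an exponential rate of convergence. (iii) The normalized matrix $\frac{P_n}{\Vert P_n\Vert}$ diverges almost surely, except in the case where the matrices $A(0),\dots,A(s-1)$ have a common left eigenvector.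
   Context: For a column vector, $\Vert\cdot\Vert$ is the norm-1 (sum of absolute values of the entries); for a matrix it is the corresponding matrix norm (maximum of the norms-1 of the columns). The normalized columns of $P_n$ are the nonnull columns of $P_n$ divided by their norm-1; the normalized columns converge if, for each $j$, the $j$-th column of $P_n$ divided by its norm-1 (taken over those $n$ for which it is nonnull) converges in the usual sense. The rate of convergence is exponential if the absolute differences between the entries and their limits are less than $Cr^n$ for some $C>0$ and $0<r<1$. A sequence diverges if it does not converge. The limits $\lim_n \frac1n\log\lambda_i(n)\in[-\infty,\infty)$, hence the limits in $( * )$, exist almost surely. So that the normalized quantities are defined, it is assumed that $P_n\neq0$ for all $n$ almost surely, and statements about $\frac{P_nV}{\Vert P_nV\Vert}$ concern those $\omega$ for which $P_nV\ne0$ for all $n$. *)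

theory Defs
  imports "HOL-Probability.Probability"
begin

definition norm1 :: "real^'n \<Rightarrow> real" where
  "norm1 v = (\<Sum>i\<in>UNIV. \<bar>v $ i\<bar>)"

definition mat_norm1 :: "real^'n^'m \<Rightarrow> real" where
  "mat_norm1 M = Max (range (\<lambda>j. norm1 (column j M)))"

definition normalized_vec :: "real^'n \<Rightarrow> real^'n" where
  "normalized_vec v = v /\<^sub>R norm1 v"

definition normalized_mat :: "real^'n^'m \<Rightarrow> real^'n^'m" where
  "normalized_mat M = M /\<^sub>R mat_norm1 M"

definition eigenvals :: "real^'n^'n \<Rightarrow> real set" where
  "eigenvals M = {c. \<exists>v. v \<noteq> 0 \<and> M *v v = c *s v}"

text \<open>
  The symmetric \<open>2 \<times> 2\<close> matrix \<open>transpose M ** M\<close> has two real nonnegative eigenvalues counted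
  with multiplicity, so the larger is the maximum and the smaller the minimum of the set of its
  eigenvalues (they coincide when the eigenvalue is double).
\<close>

definition sing_val1 :: "real^2^2 \<Rightarrow> real" where
  "sing_val1 M = sqrt (Max (eigenvals (transpose M ** M)))"

definition sing_val2 :: "real^2^2 \<Rightarrow> real" where
  "sing_val2 M = sqrt (Min (eigenvals (transpose M ** M)))"

definition diagonal_mat :: "real^'n^'n \<Rightarrow> bool" where
  "diagonal_mat M \<longleftrightarrow> (\<forall>i j. i \<noteq> j \<longrightarrow> M $ i $ j = 0)"

definition common_left_eigenvector :: "nat \<Rightarrow> (nat \<Rightarrow> real^'n^'n) \<Rightarrow> bool" where
  "common_left_eigenvector s A \<longleftrightarrow> (\<exists>u. u \<noteq> 0 \<and> (\<forall>k<s. \<exists>c. u v* A k = c *s u))"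

text \<open>The product probability on the sequences with values in \<open>{0, \<dots>, s - 1}\<close>.\<close>

definition bernoulli_measure :: "nat \<Rightarrow> (nat \<Rightarrow> real) \<Rightarrow> (nat \<Rightarrow> nat) measure" where
  "bernoulli_measure s p = (\<Pi>\<^sub>M i\<in>UNIV. point_measure {..<s} (\<lambda>k. ennreal (p k)))"

text \<open>
  Sequences are indexed from \<open>0\<close>, so \<open>\<omega> n\<close> is the \<open>(n + 1)\<close>-st letter and
  \<open>rand_prod A \<omega> n = A (\<omega> 0) ** \<dots> ** A (\<omega> (n - 1))\<close> has \<open>n\<close> factors.
\<close>

primrec rand_prod :: "(nat \<Rightarrow> real^'n^'n) \<Rightarrow> (nat \<Rightarrow> nat) \<Rightarrow> nat \<Rightarrow> real^'n^'n" where
  "rand_prod A \<omega> 0 = mat 1"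
| "rand_prod A \<omega> (Suc n) = rand_prod A \<omega> n ** A (\<omega> n)"

text \<open>
  Convergence, with exponential rate, of \<open>X n\<close> as \<open>n\<close> runs through the set \<open>N\<close>; if \<open>N\<close> is finite
  this always holds.
\<close>

definition exp_convergent_along :: "nat set \<Rightarrow> (nat \<Rightarrow> real^'n) \<Rightarrow> bool" where
  "exp_convergent_along N X \<longleftrightarrow>
     (\<exists>L. (X \<longlongrightarrow> L) (inf sequentially (principal N)) \<and>
        (\<exists>C r. 0 < C \<and> 0 < r \<and> r < 1 \<and> (\<forall>n\<in>N. \<forall>i. \<bar>X n $ i - L $ i\<bar> < C * r ^ n)))"

definition normalized_columns_exp_convergent :: "(nat \<Rightarrow> real^'n^'m) \<Rightarrow> bool" where
  "normalized_columns_exp_convergent P \<longleftrightarrow>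
     (\<forall>j. exp_convergent_along {n. column j (P n) \<noteq> 0} (\<lambda>n. normalized_vec (column j (P n))))"

definition distinct_singular_growth :: "(nat \<Rightarrow> real^2^2) \<Rightarrow> bool" where
  "distinct_singular_growth P \<longleftrightarrow>
     (\<exists>l1 l2. (\<lambda>n. root n (sing_val1 (P n))) \<longlonglongrightarrow> l1 \<and>
              (\<lambda>n. root n (sing_val2 (P n))) \<longlonglongrightarrow> l2 \<and> l1 \<noteq> l2)"

definition seq_limit_point :: "(nat \<Rightarrow> 'a::topological_space) \<Rightarrow> 'a \<Rightarrow> bool" where
  "seq_limit_point X L \<longleftrightarrow> (\<exists>\<phi>. strict_mono \<phi> \<and> (X \<circ> \<phi>) \<longlonglongrightarrow> L)"

end

theory Submission
  imports Defs
begin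

text \<open>
  Write \<open>P\<^sub>n\<close> for the random product, \<open>\<parallel>P\<^sub>n\<parallel>\<close> for the sum of its entries, and
  \<open>\<lambda>\<^sub>1 \<ge> \<lambda>\<^sub>2\<close> for its singular values. Two facts reduce the theorem to a question about
  exponents. First, \<open>\<lambda>\<^sub>1\<close> is comparable with \<open>\<parallel>P\<^sub>n\<parallel>\<close>, whose logarithm is a subadditive cocycle
  over the Bernoulli shift; the subadditive ergodic theorem (\<open>subadditive_ergodic\<close>) therefore gives
  a constant \<open>\<gamma>\<close> with \<open>\<lambda>\<^sub>1\<^bsup>1/n\<^esup> \<rightarrow> exp \<gamma>\<close>. Secondly, \<open>\<lambda>\<^sub>1 \<lambda>\<^sub>2 = |det P\<^sub>n|\<close>, so
  for invertible letters the law of large numbers gives \<open>\<lambda>\<^sub>2\<^bsup>1/n\<^esup> \<rightarrow> exp (\<eta> - \<gamma>)\<close>, where \<open>\<eta>\<close> is the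
  mean of \<open>ln |det A(k)|\<close>. The two limits differ exactly when \<open>\<eta> \<noteq> 2 \<gamma>\<close>.

  Directions are controlled by the determinant too. For nonnegative \<open>V, W\<close> the normalized vectors
  of \<open>P\<^sub>n V\<close> and \<open>P\<^sub>n W\<close> differ by \<open>|det P\<^sub>n| |det (V, W)| / (\<parallel>P\<^sub>n V\<parallel> \<parallel>P\<^sub>n W\<parallel>)\<close>, which is at most
  \<open>|det P\<^sub>n| / (x\<^sub>n y\<^sub>n)\<close>, where \<open>x\<^sub>n\<close> and \<open>y\<^sub>n\<close> are the two column sums. If this last quantity decays
  exponentially (the predicate \<open>contracting\<close>), then all directions converge exponentially, because
  \<open>P\<^sub>m V = P\<^sub>n (Q V)\<close> with \<open>Q V\<close> nonnegative whenever \<open>m \<ge> n\<close>; and for invertible letters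
  \<open>\<eta> < 2 \<gamma>\<close>, because \<open>x\<^sub>n y\<^sub>n \<le> \<parallel>P\<^sub>n\<parallel>\<^sup>2\<close>.

  Equivalence (i) and the second half of (ii) follow from a dichotomy (\<open>dichotomy\<close>): almost surely
  either all directions converge exponentially and the rates differ, or neither the normalized
  columns converge exponentially nor do the rates differ. It is proved by cases on the letters.

  \<^item> Some letter is singular. Then \<open>det P\<^sub>n = 0\<close> from some time on.

  \<^item> All letters are invertible and some word has a positive product \<open>B\<close>. Reading that word multiplies
    \<open>|det P\<^sub>n| / (x\<^sub>n y\<^sub>n)\<close> by at most \<open>|det B| / per B < 1\<close> (with the permanent in the
    denominator), no word increases it, and the word occurs with positive frequency
    (\<open>positive_word_contracting\<close>).

  \<^item> All letters are triangular in the same way. The columns are described by a sum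
    \<open>\<beta>\<^sub>n = \<Sum>\<^sub>m\<^sub><\<^sub>n R\<^sub>m b\<^sub>m / d\<^sub>m\<close>, where \<open>R\<^sub>m\<close> is the ratio of the diagonal entries of \<open>P\<^sub>m\<close>, so
    that \<open>ln R\<^sub>m\<close> is a random walk, and \<open>b\<^sub>m, d\<^sub>m\<close> are entries of the letter at position \<open>m\<close>.
    Positive drift of the walk gives contraction; negative drift gives geometric convergence of \<open>\<beta>\<^sub>n\<close>; zero drift makes \<open>\<beta>\<^sub>n\<close> grow and move subexponentially, so that
    the rates coincide and the normalized column with two entries cannot converge exponentially.

  \<^item> All letters are monomial, and some letter is antidiagonal. The antidiagonal letters exchange the
    rows; a second moment estimate shows that the two nonzero entries of \<open>P\<^sub>n\<close> have the same rate, and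
    every antidiagonal letter moves the nonzero entry of the first column to the other row.

  By \<open>exists_positive_word\<close>, invertible letters that are neither all monomial nor all triangular in the
  same way admit a word as in the second case.

  The rank statement in (ii) holds since the determinant of \<open>P\<^sub>n / \<parallel>P\<^sub>n\<parallel>\<close> is of the order of at most
  \<open>\<lambda>\<^sub>2 / \<lambda>\<^sub>1\<close>. For (iii), a limit \<open>L\<close> of the normalized products satisfies \<open>L A(k) = c L\<close> with
  \<open>c\<close> depending on \<open>k\<close>, for every letter \<open>k\<close> that occurs infinitely often, so that the nonzero rows
  of \<open>L\<close> are common left eigenvectors.
\<close>

section \<open>A subadditive ergodic theorem for bounded cocycles\<close>

text \<open>
  Ergodicity is required of all events with \<open>T -` E \<subseteq> E\<close>. As \<open>T\<close> preserves the measure, such an event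
  is invariant up to a null set, and this is the form of invariance that subadditivity provides.
\<close>
locale ergodic_system = prob_space M for M :: "'a measure" +
  fixes T :: "'a \<Rightarrow> 'a"
  assumes measurable_T [measurable]: "T \<in> measurable M M"
    and distr_T: "distr M M T = M"
    and ergodic: "\<And>E. E \<in> sets M \<Longrightarrow> T -` E \<inter> space M \<subseteq> E \<Longrightarrow> prob E = 0 \<or> prob E = 1"
begin

lemma measurable_funpow_T [measurable]: "(T ^^ n) \<in> measurable M M"
  by (induction n) (auto simp: comp_def)

lemma funpow_T_space: "x \<in> space M \<Longrightarrow> (T ^^ n) x \<in> space M"
  using measurable_funpow_T[of n] by (rule measurable_space)

lemma distr_funpow_T: "distr M M (T ^^ n) = M"
proof (induction n)
  case (Suc n)
  have "distr M M (T \<circ> (T ^^ n)) = distr (distr M M (T ^^ n)) M T"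
    by (simp add: distr_distr)
  then show ?case using Suc distr_T by (simp add: comp_def)
qed (simp add: distr_id2 id_def)

lemma integral_funpow_T:
  fixes f :: "'a \<Rightarrow> real"
  assumes [measurable]: "f \<in> borel_measurable M"
  shows "(\<integral>x. f ((T ^^ n) x) \<partial>M) = (\<integral>x. f x \<partial>M)"
  using integral_distr[of "T ^^ n" M M f] distr_funpow_T[of n] by simp

lemma integrable_bounded:
  fixes f :: "'a \<Rightarrow> real"
  assumes "f \<in> borel_measurable M" "\<And>x. x \<in> space M \<Longrightarrow> \<bar>f x\<bar> \<le> B"
  shows "integrable M f"
  by (rule integrable_const_bound[of _ B]) (use assms in auto)

text \<open>
  The bound is affine in \<open>n\<close> rather than linear because \<open>g 0\<close> may be nonzero, as it is for the
  logarithm of the sum of the entries of a matrix product.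
\<close>
definition cocycle :: "real \<Rightarrow> (nat \<Rightarrow> 'a \<Rightarrow> real) \<Rightarrow> bool" where
  "cocycle C g \<longleftrightarrow> (\<forall>n. g n \<in> borel_measurable M) \<and>
     (\<forall>n. \<forall>x\<in>space M. \<bar>g n x\<bar> \<le> C * (real n + 1)) \<and>
     (\<forall>m n. \<forall>x\<in>space M. g (m + n) x \<le> g m x + g n ((T ^^ m) x))"

lemma cocycleD:
  assumes "cocycle C g"
  shows "g n \<in> borel_measurable M"
    and "x \<in> space M \<Longrightarrow> \<bar>g n x\<bar> \<le> C * (real n + 1)"
    and "x \<in> space M \<Longrightarrow> g (m + n) x \<le> g m x + g n ((T ^^ m) x)"
    and "integrable M (g n)"
  using assms by (auto simp: cocycle_def intro!: integrable_bounded[of "g n" "C * (real n + 1)"])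

lemma cocycle_const_nonneg:
  assumes "cocycle C g" shows "0 \<le> C"
proof -
  obtain x where "x \<in> space M" using not_empty by blast
  with cocycleD(2)[OF assms, of x 0] show ?thesis by simp
qed

text \<open>
  The orbit segment of length \<open>n\<close> is cut greedily (Katznelson and Weiss): a point outside \<open>B\<close> starts a
  block of length at most \<open>N\<close> on which \<open>g\<close> has slope below \<open>c\<close>, a point of \<open>B\<close> is passed in one step.
  Subadditivity adds up the pieces. The constant \<open>2 * C + \<bar>c\<bar>\<close> pays for each step at a point of \<open>B\<close>
  and, multiplied by \<open>N + 1\<close>, for the last piece, which may be too short to contain a block.
\<close>
lemma tiling_bound:
  assumes coc: "cocycle C g"
    and "x \<in> space M"
    and bad: "\<And>y. y \<in> space M \<Longrightarrow> y \<notin> B \<Longrightarrow> \<exists>m\<in>{1..N}. g m y < c * real m"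
  shows "g n x \<le> c * real n + (2 * C + \<bar>c\<bar>) *
           ((\<Sum>i<n. indicator B ((T ^^ i) x)) + real N + 1)"
  using \<open>x \<in> space M\<close>
proof (induction n arbitrary: x rule: less_induct)
  case (less n)
  note C = cocycle_const_nonneg[OF coc]
  define K where "K = 2 * C + \<bar>c\<bar>"
  have K: "K \<ge> 0" using C by (simp add: K_def)
  let ?b = "\<lambda>n x. \<Sum>i<n. indicator B ((T ^^ i) x) :: real"
  have nn: "?b n x \<ge> 0" for n x by (intro sum_nonneg) auto
  have split: "?b (m + k) x = ?b m x + ?b k ((T ^^ m) x)" for m k x
    by (induction k) (simp_all add: funpow_add add.commute)
  show ?case
  proof (cases "n \<le> N")
    case True
    have "g n x \<le> C * (real n + 1)" using cocycleD(2)[OF coc less.prems, of n] by simp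
    also have "\<dots> \<le> c * real n + (\<bar>c\<bar> + C) * (real n + 1)"
    proof -
      have "- c * real n \<le> \<bar>c\<bar> * (real n + 1)"
        using mult_right_mono[of "- c" "\<bar>c\<bar>" "real n", OF abs_ge_minus_self]
        by (simp add: algebra_simps add_increasing)
      then show ?thesis by (simp add: algebra_simps)
    qed
    also have "(\<bar>c\<bar> + C) * (real n + 1) \<le> K * (?b n x + real N + 1)"
      using True nn[of x n] C K by (intro mult_mono) (auto simp: K_def)
    finally show ?thesis by (simp add: K_def)
  next
    case False
    have step: "g n x \<le> c * real n + K * (?b n x + real N + 1)"
      if m: "1 \<le> m" "m \<le> n" and gm: "g m x \<le> c * real m + K * ?b m x" for m
    proof -
      have split_n: "?b (m + (n - m)) x = ?b m x + ?b (n - m) ((T ^^ m) x)" by (rule split)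
      have "g n x \<le> g m x + g (n - m) ((T ^^ m) x)"
        using cocycleD(3)[OF coc less.prems, of m "n - m"] m by simp
      also have "g (n - m) ((T ^^ m) x) \<le> c * real (n - m) +
          K * (?b (n - m) ((T ^^ m) x) + real N + 1)"
        using less.IH[of "n - m" "(T ^^ m) x"] m funpow_T_space[OF less.prems] by (simp add: K_def)
      also note gm
      also have "c * real m + K * ?b m x + (c * real (n - m) + K * (?b (n - m) ((T ^^ m) x) + real N + 1))
          = c * real n + K * (?b n x + real N + 1)"
        using split_n m by (simp add: algebra_simps of_nat_diff)
      finally show ?thesis by simp
    qed
    show ?thesis
    proof (cases "x \<in> B")
      case True
      have "g 1 x \<le> 2 * C" using cocycleD(2)[OF coc less.prems, of 1] by simp
      also have "\<dots> \<le> c * real 1 + K * ?b 1 x" using True by (simp add: K_def)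
      finally show ?thesis using step[of 1] False by (simp add: K_def)
    next
      case False
      then obtain m where m: "1 \<le> m" "m \<le> N" "g m x < c * real m"
        using bad[OF less.prems] by auto
      have "0 \<le> K * ?b m x" using K nn by simp
      then show ?thesis using step[of m] m \<open>\<not> n \<le> N\<close> by (simp add: K_def)
    qed
  qed
qed

lemma affine_le_imp_slope_le:
  fixes a b d :: real
  assumes "\<And>n::nat. n > 0 \<Longrightarrow> real n * a \<le> real n * b + d"
  shows "a \<le> b"
proof (rule ccontr)
  assume "\<not> a \<le> b"
  then obtain n :: nat where n: "d < real n * (a - b)"
    using reals_Archimedean3[of "a - b"] by (auto simp: mult.commute)
  have "real n * (a - b) \<le> real (Suc n) * (a - b)"
    using \<open>\<not> a \<le> b\<close> by (intro mult_right_mono) auto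
  then show False using n assms[of "Suc n"] by (simp add: algebra_simps)
qed

text \<open>
  The event \<open>E\<close> that \<open>g n - c * n\<close> is unbounded below is backward invariant, so it has probability 0
  or 1. If it had probability 1, almost every point would start a block of slope below \<open>c\<close>; for
  large \<open>N\<close> the points without such a block of length at most \<open>N\<close> have small probability, and
  integrating \<open>tiling_bound\<close> would give mean slope at most \<open>c\<close>.
\<close>
lemma subadditive_lower:
  assumes coc: "cocycle C g"
    and mean: "\<And>n. n > 0 \<Longrightarrow> real n * \<gamma> \<le> (\<integral>x. g n x \<partial>M)"
    and "c < \<gamma>"
  shows "AE x in M. \<exists>K::nat. \<forall>n. c * real n - real K \<le> g n x"
proof -
  note [measurable] = cocycleD(1)[OF coc]
  note C = cocycle_const_nonneg[OF coc]
  define K where "K = 2 * C + \<bar>c\<bar>"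
  have K: "K \<ge> 0" using C by (simp add: K_def)
  define E where "E = {x \<in> space M. \<forall>k::nat. \<exists>n. g n x < c * real n - real k}"
  have [measurable]: "E \<in> sets M" unfolding E_def by measurable
  have "T -` E \<inter> space M \<subseteq> E"
  proof
    fix x assume "x \<in> T -` E \<inter> space M"
    then have x: "x \<in> space M" "T x \<in> E" by auto
    have "\<exists>n. g n x < c * real n - real k" for k
    proof -
      obtain k' :: nat where k': "real k + K \<le> real k'" using real_arch_simple by blast
      obtain n where n: "g n (T x) < c * real n - real k'" using x by (auto simp: E_def)
      have "g (1 + n) x \<le> g 1 x + g n (T x)" using cocycleD(3)[OF coc x(1), of 1 n] by simp
      also have "g 1 x \<le> 2 * C" using cocycleD(2)[OF coc x(1), of 1] by simp
      finally have "g (1 + n) x < c * real (1 + n) - real k"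
        using n k' by (simp add: K_def algebra_simps)
      then show ?thesis by blast
    qed
    then show "x \<in> E" using x by (simp add: E_def)
  qed
  then consider "prob E = 0" | "prob E = 1" using ergodic[of E] by auto
  then have "prob E = 0"
  proof cases
    case 2
    define B where "B N = {x \<in> space M. \<forall>m\<in>{1..N}. c * real m \<le> g m x}" for N :: nat
    have [measurable]: "B N \<in> sets M" for N unfolding B_def by measurable
    have "decseq B" by (auto simp: decseq_def B_def)
    then have lim: "(\<lambda>N. prob (B N)) \<longlonglongrightarrow> prob (\<Inter>N. B N)"
      by (intro finite_Lim_measure_decseq) auto
    have "(\<Inter>N. B N) \<subseteq> space M - E"
    proof
      fix x assume x: "x \<in> (\<Inter>N. B N)"
      then have sp: "x \<in> space M" by (auto simp: B_def)
      obtain k :: nat where k: "C \<le> real k" using real_arch_simple by blast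
      have "c * real n - real k \<le> g n x" for n
      proof (cases "n = 0")
        case True
        then show ?thesis using cocycleD(2)[OF coc sp, of 0] k by simp
      next
        case False
        then have "x \<in> B n" "n \<in> {1..n}" using x by auto
        then have "c * real n \<le> g n x" unfolding B_def by blast
        then show ?thesis by simp
      qed
      then have "\<not> g n x < c * real n - real k" for n by (simp add: not_less)
      then show "x \<in> space M - E" using sp unfolding E_def by blast
    qed
    then have "prob (\<Inter>N. B N) \<le> prob (space M - E)" by (intro finite_measure_mono) auto
    also have "\<dots> = 0" using 2 prob_compl[of E] by simp
    finally have "prob (\<Inter>N. B N) = 0" using measure_nonneg[of M "\<Inter>N. B N"] by linarith
    with lim have lim0: "(\<lambda>N. prob (B N)) \<longlonglongrightarrow> 0" by simp
    have "\<gamma> \<le> c + K * prob (B N)" for N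
    proof (rule affine_le_imp_slope_le)
      fix n :: nat assume "n > 0"
      have int: "integrable M (\<lambda>x. indicator (B N) ((T ^^ i) x) :: real)" for i
        by (rule integrable_bounded[of _ 1]) (auto split: split_indicator)
      have "real n * \<gamma> \<le> (\<integral>x. g n x \<partial>M)" by (rule mean) fact
      also have "\<dots> \<le> (\<integral>x. c * real n + K * ((\<Sum>i<n. indicator (B N) ((T ^^ i) x)) + real N + 1) \<partial>M)"
      proof (intro integral_mono cocycleD(4)[OF coc])
        show "integrable M (\<lambda>x. c * real n + K * ((\<Sum>i<n. indicator (B N) ((T ^^ i) x)) + real N + 1))"
          using int by simp
        fix x assume x: "x \<in> space M"
        show "g n x \<le> c * real n + K * ((\<Sum>i<n. indicator (B N) ((T ^^ i) x)) + real N + 1)"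
          unfolding K_def
        proof (rule tiling_bound[OF coc x])
          fix y assume "y \<in> space M" "y \<notin> B N"
          then show "\<exists>m\<in>{1..N}. g m y < c * real m" by (auto simp: B_def not_le)
        qed
      qed
      also have "\<dots> = c * real n + K * ((\<Sum>i<n. (\<integral>x. indicator (B N) ((T ^^ i) x) \<partial>M)) + real N + 1)"
        using int by (simp add: prob_space)
      also have "(\<Sum>i<n. (\<integral>x. indicator (B N) ((T ^^ i) x) \<partial>M)) = (\<Sum>i<n. prob (B N))"
        by (subst integral_funpow_T) auto
      finally show "real n * \<gamma> \<le> real n * (c + K * prob (B N)) + K * (real N + 1)"
        by (simp add: algebra_simps)
    qed
    moreover have "(\<lambda>N. c + K * prob (B N)) \<longlonglongrightarrow> c + K * 0"
      by (intro tendsto_intros lim0)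
    ultimately have "\<gamma> \<le> c" by (auto dest: LIMSEQ_le_const)
    with \<open>c < \<gamma>\<close> show ?thesis by simp
  qed
  then have "AE x in M. x \<notin> E" by (subst AE_iff_measurable[of E]) (auto simp: emeasure_eq_measure E_def)
  then show ?thesis
    by (rule AE_mp) (rule AE_I2, auto simp: E_def not_less)
qed

lemma eventually_slope_less:
  fixes c c' K :: real
  assumes "c' < c"
  shows "eventually (\<lambda>n. c' * real n < c * real n - K) sequentially"
proof -
  obtain N :: nat where N: "K < real N * (c - c')"
    using reals_Archimedean3[of "c - c'"] assms by (auto simp: mult.commute)
  have "c' * real n < c * real n - K" if "n \<ge> N" for n
  proof -
    have "real N * (c - c') \<le> real n * (c - c')" using that assms by (intro mult_right_mono) auto
    then show ?thesis using N by (simp add: algebra_simps)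
  qed
  then show ?thesis by (auto simp: eventually_sequentially)
qed

lemma subadditive_liminf:
  assumes coc: "cocycle C g"
    and mean: "\<And>n. n > 0 \<Longrightarrow> real n * \<gamma> \<le> (\<integral>x. g n x \<partial>M)"
  shows "AE x in M. \<forall>c<\<gamma>. eventually (\<lambda>n. c * real n < g n x) sequentially"
proof -
  have "AE x in M. \<forall>j::nat. \<exists>K::nat. \<forall>n. (\<gamma> - 1 / real (Suc j)) * real n - real K \<le> g n x"
    unfolding AE_all_countable
    by (intro allI subadditive_lower[OF coc mean]) auto
  then show ?thesis
  proof eventually_elim
    case (elim x)
    show ?case
    proof (intro allI impI)
      fix c assume "c < \<gamma>"
      then obtain j :: nat where j: "1 / real (Suc j) < \<gamma> - c"
        using nat_approx_posE[of "\<gamma> - c"] by auto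
      then have lt: "c < \<gamma> - 1 / real (Suc j)" by simp
      obtain K :: nat where K: "\<And>n. (\<gamma> - 1 / real (Suc j)) * real n - real K \<le> g n x"
        using elim by blast
      show "eventually (\<lambda>n. c * real n < g n x) sequentially"
        using eventually_slope_less[OF lt, of "real K"]
        by eventually_elim (use K in \<open>auto intro: less_le_trans\<close>)
    qed
  qed
qed

lemma cocycle_birkhoff_sum:
  assumes [measurable]: "h \<in> borel_measurable M" and "\<And>x. x \<in> space M \<Longrightarrow> \<bar>h x\<bar> \<le> C"
  shows "cocycle C (\<lambda>n x. \<Sum>i<n. h ((T ^^ i) x))"
proof -
  have C: "0 \<le> C" using assms(2) not_empty by force
  have "\<bar>\<Sum>i<n. h ((T ^^ i) x)\<bar> \<le> C * (real n + 1)" if "x \<in> space M" for n x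
  proof -
    have "\<bar>\<Sum>i<n. h ((T ^^ i) x)\<bar> \<le> (\<Sum>i<n. C)"
      using assms(2) funpow_T_space[OF that] by (intro order_trans[OF sum_abs] sum_mono) auto
    then show ?thesis using C by (simp add: algebra_simps)
  qed
  moreover have "(\<Sum>i<m + n. h ((T ^^ i) x)) = (\<Sum>i<m. h ((T ^^ i) x)) + (\<Sum>i<n. h ((T ^^ i) ((T ^^ m) x)))" for m n x
    by (induction n) (simp_all add: funpow_add add.commute)
  ultimately show ?thesis by (simp add: cocycle_def)
qed

lemma tendsto_slopeI:
  fixes u :: "nat \<Rightarrow> real"
  assumes "\<forall>c<\<gamma>. eventually (\<lambda>n. c * real n < u n) sequentially"
    and "\<forall>c>\<gamma>. eventually (\<lambda>n. u n < c * real n) sequentially"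
  shows "(\<lambda>n. u n / real n) \<longlonglongrightarrow> \<gamma>"
proof (rule order_tendstoI)
  fix c assume "c < \<gamma>"
  with assms(1) have "eventually (\<lambda>n. c * real n < u n) sequentially" by blast
  then show "eventually (\<lambda>n. c < u n / real n) sequentially"
    using eventually_gt_at_top[of 0] by eventually_elim (auto simp: field_simps)
next
  fix c assume "\<gamma> < c"
  with assms(2) have "eventually (\<lambda>n. u n < c * real n) sequentially" by blast
  then show "eventually (\<lambda>n. u n / real n < c) sequentially"
    using eventually_gt_at_top[of 0] by eventually_elim (auto simp: field_simps)
qed

text \<open>Birkhoff sums are cocycles for \<open>h\<close> and for \<open>- h\<close>, so the lower bound yields both halves.\<close>
theorem birkhoff_bounded:
  assumes [measurable]: "h \<in> borel_measurable M" and bound: "\<And>x. x \<in> space M \<Longrightarrow> \<bar>h x\<bar> \<le> C"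
  shows "AE x in M. (\<lambda>n. (\<Sum>i<n. h ((T ^^ i) x)) / real n) \<longlonglongrightarrow> (\<integral>x. h x \<partial>M)"
proof -
  have int: "integrable M (\<lambda>x. h ((T ^^ i) x))" for i
    using bound funpow_T_space by (intro integrable_bounded[of _ C]) auto
  have mean: "(\<integral>x. (\<Sum>i<n. h ((T ^^ i) x)) \<partial>M) = real n * (\<integral>x. h x \<partial>M)" for n
    using int integral_funpow_T[of h] by simp
  have "AE x in M. \<forall>c<(\<integral>x. h x \<partial>M). eventually (\<lambda>n. c * real n < (\<Sum>i<n. h ((T ^^ i) x))) sequentially"
    by (rule subadditive_liminf[OF cocycle_birkhoff_sum[OF assms]]) (auto simp: mean)
  moreover have "AE x in M. \<forall>c<(\<integral>x. - h x \<partial>M). eventually (\<lambda>n. c * real n < (\<Sum>i<n. - h ((T ^^ i) x))) sequentially"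
    using bound by (intro subadditive_liminf[OF cocycle_birkhoff_sum[of "\<lambda>x. - h x" C]])
      (auto simp: mean sum_negf)
  ultimately show ?thesis
  proof eventually_elim
    case (elim x)
    show ?case
    proof (rule tendsto_slopeI)
      show "\<forall>c>\<integral>x. h x \<partial>M. eventually (\<lambda>n. (\<Sum>i<n. h ((T ^^ i) x)) < c * real n) sequentially"
      proof (intro allI impI)
        fix c assume "c > (\<integral>x. h x \<partial>M)"
        then have "eventually (\<lambda>n. - c * real n < (\<Sum>i<n. - h ((T ^^ i) x))) sequentially"
          using elim(2)[rule_format, of "- c"] by simp
        then show "eventually (\<lambda>n. (\<Sum>i<n. h ((T ^^ i) x)) < c * real n) sequentially"
          by eventually_elim (simp add: sum_negf)
      qed
    qed (rule elim(1))
  qed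
qed

text \<open>
  For each offset \<open>r < m\<close> the segment can be cut into blocks of length \<open>m\<close> starting at \<open>r\<close>; averaging
  over \<open>r\<close> turns the sum over blocks into a Birkhoff sum of \<open>g m\<close>. The sums \<open>H\<close> in the proof
  perform this for all offsets at once: \<open>H\<close> loses exactly one block when the orbit moves by one step.
\<close>
lemma cocycle_block_bound:
  assumes coc: "cocycle C g" and x: "x \<in> space M"
  shows "real m * g (n + m) x \<le> 2 * real m * C * (real m + 1) + (\<Sum>i<n. g m ((T ^^ i) x))"
proof -
  note C = cocycle_const_nonneg[OF coc]
  define H where "H n x = (\<Sum>r<m. g (n + m - r) ((T ^^ r) x))" for n x
  have H_step: "H (Suc n) x \<le> H n (T x) + g m x" if x: "x \<in> space M" for n x
  proof -
    have "H (Suc n) x + g (n + 1) ((T ^^ m) x) = (\<Sum>r<Suc m. g (Suc n + m - r) ((T ^^ r) x))"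
      by (simp add: H_def)
    also have "\<dots> = g (Suc n + m) x + (\<Sum>r<m. g (Suc n + m - Suc r) ((T ^^ Suc r) x))"
      by (subst sum.lessThan_Suc_shift) simp
    also have "(\<Sum>r<m. g (Suc n + m - Suc r) ((T ^^ Suc r) x)) = H n (T x)"
      unfolding H_def by (intro sum.cong) (auto simp: funpow_swap1)
    also have "g (Suc n + m) x \<le> g m x + g (n + 1) ((T ^^ m) x)"
      using cocycleD(3)[OF coc x, of m "n + 1"] by (simp add: add.commute)
    finally show ?thesis by simp
  qed
  have H_bound: "H n x \<le> real m * C * (real m + 1) + (\<Sum>i<n. g m ((T ^^ i) x))" if "x \<in> space M" for n x
    using that
  proof (induction n arbitrary: x)
    case 0
    have "H 0 x \<le> (\<Sum>r<m. C * (real m + 1))"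
      unfolding H_def
    proof (rule sum_mono)
      fix r assume "r \<in> {..<m}"
      have "g (0 + m - r) ((T ^^ r) x) \<le> C * (real (m - r) + 1)"
        using cocycleD(2)[OF coc funpow_T_space[OF 0], of "m - r" r] by simp
      also have "\<dots> \<le> C * (real m + 1)" using C by (intro mult_left_mono) auto
      finally show "g (0 + m - r) ((T ^^ r) x) \<le> C * (real m + 1)" .
    qed
    then show ?case by simp
  next
    case (Suc n)
    have "T x \<in> space M" using funpow_T_space[OF Suc.prems, of 1] by simp
    from Suc.IH[OF this] H_step[OF Suc.prems, of n] show ?case
      by (subst sum.lessThan_Suc_shift) (simp add: funpow_swap1)
  qed
  have "real m * g (n + m) x = (\<Sum>r<m. g (n + m) x)" by simp
  also have "\<dots> \<le> (\<Sum>r<m. C * (real m + 1) + g (n + m - r) ((T ^^ r) x))"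
  proof (rule sum_mono)
    fix r assume r: "r \<in> {..<m}"
    have "g (n + m) x \<le> g r x + g (n + m - r) ((T ^^ r) x)"
      using cocycleD(3)[OF coc x, of r "n + m - r"] r by simp
    moreover have "g r x \<le> C * (real r + 1)" using cocycleD(2)[OF coc x, of r] by simp
    moreover have "C * (real r + 1) \<le> C * (real m + 1)" using C r by (intro mult_left_mono) auto
    ultimately show "g (n + m) x \<le> C * (real m + 1) + g (n + m - r) ((T ^^ r) x)" by simp
  qed
  also have "\<dots> = real m * C * (real m + 1) + H n x" by (simp add: sum.distrib H_def)
  finally show ?thesis using H_bound[OF x, of n] by (simp add: algebra_simps)
qed

text \<open>
  The limit is the infimum of the mean slopes. The lower bound is \<open>subadditive_liminf\<close>; the upper
  bound compares \<open>g\<close> with the Birkhoff averages of \<open>g m\<close>, for an \<open>m\<close> whose mean slope nearly attains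
  the infimum. The summand \<open>C\<close> covers \<open>n = 0\<close>, where \<open>g 0\<close> may be negative.
\<close>
theorem subadditive_ergodic:
  assumes coc: "cocycle C g"
  shows "\<exists>\<gamma>. (\<forall>n. real n * \<gamma> \<le> (\<integral>x. g n x \<partial>M) + C) \<and> (AE x in M. (\<lambda>n. g n x / real n) \<longlonglongrightarrow> \<gamma>)"
proof -
  note [measurable] = cocycleD(1)[OF coc]
  note C = cocycle_const_nonneg[OF coc]
  define e where "e n = (\<integral>x. g n x \<partial>M)" for n
  define \<gamma> where "\<gamma> = (INF n\<in>{1..}. e n / real n)"
  have e_lower: "- (C * (real n + 1)) \<le> e n" for n
  proof -
    have "(\<integral>x. - (C * (real n + 1)) \<partial>M) \<le> e n"
      unfolding e_def
        using cocycleD(2)[OF coc, of _ n]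
      by (intro integral_mono cocycleD(4)[OF coc]) (auto simp: abs_le_iff minus_le_iff simp del: minus_mult_left)
    then show ?thesis by (simp add: prob_space)
  qed
  have bdd: "bdd_below ((\<lambda>n. e n / real n) ` {1..})"
  proof (rule bdd_belowI2)
    fix n :: nat assume "n \<in> {1..}"
    then have n: "real n \<ge> 1" by simp
    have "- (2 * C) * real n \<le> - (C * (real n + 1))"
      using n mult_left_mono[OF n C] by (simp add: algebra_simps)
    then show "- (2 * C) \<le> e n / real n" using e_lower[of n] n by (simp add: field_simps)
  qed
  have mean: "real n * \<gamma> \<le> e n" if "n > 0" for n
  proof -
    have "\<gamma> \<le> e n / real n" unfolding \<gamma>_def by (rule cINF_lower[OF bdd]) (use that in auto)
    then show ?thesis using that by (simp add: field_simps)
  qed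
  have low: "AE x in M. \<forall>c<\<gamma>. eventually (\<lambda>n. c * real n < g n x) sequentially"
    by (rule subadditive_liminf[OF coc]) (use mean in \<open>auto simp: e_def\<close>)
  have "AE x in M. \<forall>m. (\<lambda>n. (\<Sum>i<n. g m ((T ^^ i) x)) / real n) \<longlonglongrightarrow> e m"
    unfolding AE_all_countable e_def
    using birkhoff_bounded[OF cocycleD(1)[OF coc] cocycleD(2)[OF coc]] by blast
  with low AE_space have "AE x in M. (\<lambda>n. g n x / real n) \<longlonglongrightarrow> \<gamma>"
  proof eventually_elim
    case (elim x)
    have x: "x \<in> space M" by fact
    show ?case
    proof (rule tendsto_slopeI)
      show "\<forall>c>\<gamma>. eventually (\<lambda>n. g n x < c * real n) sequentially"
      proof (intro allI impI)
        fix c assume "\<gamma> < c"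
        then obtain m where m: "m \<ge> 1" "e m / real m < c"
          unfolding \<gamma>_def using cINF_less_iff[OF _ bdd, of c] by auto
        define K where "K = 2 * real m * C * (real m + 1)"
        have em: "e m < c * real m" using m by (simp add: field_simps)
        then obtain d where d: "e m < d" "d < c * real m" using dense by blast
        from elim(3) have "(\<lambda>n. (\<Sum>i<n. g m ((T ^^ i) x)) / real n) \<longlonglongrightarrow> e m" by blast
        then have "eventually (\<lambda>n. (\<Sum>i<n. g m ((T ^^ i) x)) / real n < d) sequentially"
          using d by (auto dest: order_tendstoD)
        then have "eventually (\<lambda>n. g (n + m) x < c * real (n + m)) sequentially"
          using eventually_slope_less[OF d(2), of "K - c * real m * real m"] eventually_gt_at_top[of 0]
        proof eventually_elim
          case (elim n)
          have "real m * g (n + m) x \<le> K + (\<Sum>i<n. g m ((T ^^ i) x))"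
            unfolding K_def by (rule cocycle_block_bound[OF coc x])
          also have "(\<Sum>i<n. g m ((T ^^ i) x)) < d * real n" using elim by (simp add: field_simps)
          finally have "real m * g (n + m) x < real m * (c * real (n + m))"
            using elim by (simp add: algebra_simps)
          then show ?case using m by simp
        qed
        then show "eventually (\<lambda>n. g n x < c * real n) sequentially"
          by (rule eventually_sequentially_seg[THEN iffD1])
      qed
    qed fact
  qed
  moreover have "real n * \<gamma> \<le> e n + C" for n
    using mean[of n] C e_lower[of 0] by (cases "n = 0") auto
  ultimately show ?thesis by (auto simp: e_def)
qed

end

section \<open>Ergodicity of the Bernoulli shift\<close>

definition shift :: "(nat \<Rightarrow> 'a) \<Rightarrow> nat \<Rightarrow> 'a" where
  "shift \<omega> = (\<lambda>n. \<omega> (Suc n))"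

lemma funpow_shift: "(shift ^^ n) \<omega> = (\<lambda>i. \<omega> (i + n))"
  by (induction n) (auto simp: shift_def)

context sequence_space
begin

lemma measurable_shift [measurable]: "shift \<in> measurable S S"
  unfolding shift_def by (rule measurable_PiM_single') (auto simp: space_PiM PiE_iff)

lemma distr_shift: "distr S S shift = S"
proof -
  have "distr S S shift = distr (M \<Otimes>\<^sub>M S) S (shift \<circ> (\<lambda>(s, \<omega>). case_nat s \<omega>))"
    by (subst PiM_iter[symmetric], subst distr_distr) auto
  also have "shift \<circ> (\<lambda>(s, \<omega>). case_nat s \<omega>) = (snd :: 'a \<times> (nat \<Rightarrow> 'a) \<Rightarrow> _)"
    by (auto simp: shift_def fun_eq_iff)
  also have "distr (M \<Otimes>\<^sub>M S) S snd = S"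
  proof (intro measure_eqI)
    fix A assume "A \<in> sets (distr (M \<Otimes>\<^sub>M S) S snd)"
    then have A: "A \<in> sets S" by simp
    then have "emeasure (distr (M \<Otimes>\<^sub>M S) S snd) A = emeasure (M \<Otimes>\<^sub>M S) (space M \<times> A)"
      by (auto simp: emeasure_distr space_pair_measure dest: sets.sets_into_space
               intro!: arg_cong2[where f = emeasure])
    with A show "emeasure (distr (M \<Otimes>\<^sub>M S) S snd) A = emeasure S A"
      by (simp add: P.emeasure_pair_measure_Times M.emeasure_space_1)
  qed simp
  finally show ?thesis .
qed

text \<open>
  A product sequence may be sampled by concatenating the first \<open>n\<close> terms of one sequence with a
  second, independent one; \<open>F\<close> sees only the first, \<open>(shift ^^ n) -` E\<close> only the second.
\<close>
lemma cylinder_indep: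
  assumes E: "E \<in> sets S" and F: "F \<in> sets S"
    and dep: "\<And>\<omega> \<omega>'. \<omega> \<in> space S \<Longrightarrow> \<omega>' \<in> space S \<Longrightarrow> comb_seq n \<omega> \<omega>' \<in> F \<longleftrightarrow> \<omega> \<in> F"
  shows "emeasure S ((shift ^^ n) -` E \<inter> F) = emeasure S E * emeasure S F"
proof -
  note [measurable] = E F
  have [measurable]: "(shift ^^ n) \<in> measurable S S"
    by (induction n) (auto simp: comp_def)
  have sub: "F \<subseteq> space S" "E \<subseteq> space S" using sets.sets_into_space[OF F] sets.sets_into_space[OF E] by blast+
  have A: "(shift ^^ n) -` E \<inter> F \<in> sets S"
  proof -
    have "((shift ^^ n) -` E \<inter> space S) \<inter> F \<in> sets S" by measurable
    moreover have "((shift ^^ n) -` E \<inter> space S) \<inter> F = (shift ^^ n) -` E \<inter> F" using sub by auto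
    ultimately show ?thesis by simp
  qed
  have funpow_comb: "(shift ^^ n) (comb_seq n \<omega> \<omega>') = \<omega>'" for \<omega> \<omega>' :: "nat \<Rightarrow> 'a"
    by (simp add: funpow_shift comb_seq_add)
  have "emeasure S ((shift ^^ n) -` E \<inter> F)
      = emeasure (S \<Otimes>\<^sub>M S) ((\<lambda>(\<omega>, \<omega>'). comb_seq n \<omega> \<omega>') -` ((shift ^^ n) -` E \<inter> F) \<inter> space (S \<Otimes>\<^sub>M S))"
    by (subst PiM_comb_seq[symmetric, of n], subst emeasure_distr[OF measurable_comb_seq])
       (use A in auto)
  also have "(\<lambda>(\<omega>, \<omega>'). comb_seq n \<omega> \<omega>') -` ((shift ^^ n) -` E \<inter> F) \<inter> space (S \<Otimes>\<^sub>M S) = F \<times> E"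
    using subsetD[OF sub(1)] subsetD[OF sub(2)] dep
    by (force simp: space_pair_measure funpow_comb)
  also have "emeasure (S \<Otimes>\<^sub>M S) (F \<times> E) = emeasure S E * emeasure S F"
    using E F by (subst P.emeasure_pair_measure_Times) (auto simp: mult.commute)
  finally show ?thesis .
qed

text \<open>
  A backward invariant event \<open>E\<close> agrees, up to a null set, with \<open>(shift ^^ n) -` E\<close> for every \<open>n\<close> and so is
  independent of all cylinders. If \<open>E\<close> has positive probability, conditioning on \<open>E\<close> therefore does
  not change the probability of any cylinder; the conditioned measure is the product measure itself,
  and \<open>E\<close> has probability 1.
\<close>
lemma ergodic_shift: "ergodic_system S shift"
proof
  show "shift \<in> measurable S S" by simp
  show "distr S S shift = S" by (rule distr_shift)
  fix E assume E [measurable]: "E \<in> sets S" and inv: "shift -` E \<inter> space S \<subseteq> E"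
  have sub: "E \<subseteq> space S" using sets.sets_into_space[OF E] .
  have funpow_meas [measurable]: "(shift ^^ n) \<in> measurable S S" for n
    by (induction n) (auto simp: comp_def)
  have inv_n: "(shift ^^ n) -` E \<inter> space S \<subseteq> E" for n
  proof (induction n)
    case (Suc n)
    show ?case
    proof
      fix \<omega> assume \<omega>: "\<omega> \<in> (shift ^^ Suc n) -` E \<inter> space S"
      then have "(shift ^^ n) \<omega> \<in> shift -` E \<inter> space S"
        using measurable_space[OF funpow_meas] by auto
      then show "\<omega> \<in> E" using inv Suc \<omega> by blast
    qed
  qed simp
  have same: "emeasure S ((shift ^^ n) -` E \<inter> space S) = emeasure S E" for n
    using cylinder_indep[OF E sets.top, of n] P.emeasure_space_1
    by (auto simp: space_PiM PiE_iff split: split_comb_seq)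
  have meet: "emeasure S (E \<inter> F) = emeasure S E * emeasure S F"
    if F [measurable]: "F \<in> sets S"
      and dep: "\<And>\<omega> \<omega>'. \<omega> \<in> space S \<Longrightarrow> \<omega>' \<in> space S \<Longrightarrow> comb_seq n \<omega> \<omega>' \<in> F \<longleftrightarrow> \<omega> \<in> F" for n F
  proof -
    have Fs: "F \<subseteq> space S" using sets.sets_into_space[OF F] .
    let ?E = "(shift ^^ n) -` E \<inter> space S"
    have "emeasure S (E - ?E) = emeasure S E - emeasure S ?E"
      using inv_n by (intro emeasure_Diff) (auto simp: P.emeasure_eq_measure)
    then have null: "emeasure S (E - ?E) = 0" by (simp add: same)
    have "emeasure S (E \<inter> F) = emeasure S (?E \<inter> F \<union> (E - ?E) \<inter> F)"
      using inv_n[of n] Fs by (intro arg_cong[where f = "emeasure S"]) auto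
    also have "\<dots> = emeasure S (?E \<inter> F)"
    proof (rule emeasure_Un_null_set)
      have "(E - ?E) \<inter> F \<subseteq> E - ?E" by auto
      then have "emeasure S ((E - ?E) \<inter> F) \<le> emeasure S (E - ?E)"
        by (intro emeasure_mono) auto
      then show "(E - ?E) \<inter> F \<in> null_sets S" using null by (auto intro!: null_setsI)
    qed simp
    also have "?E \<inter> F = (shift ^^ n) -` E \<inter> F" using Fs by auto
    finally show ?thesis using cylinder_indep[OF E F dep] by simp
  qed
  show "P.prob E = 0 \<or> P.prob E = 1"
  proof (rule disjCI)
    assume "P.prob E \<noteq> 1"
    show "P.prob E = 0"
    proof (rule ccontr)
      assume pos: "P.prob E \<noteq> 0"
      define c where "c = ennreal (1 / P.prob E)"
      define D where "D = density S (\<lambda>\<omega>. c * indicator E \<omega>)"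
      have D: "emeasure D F = c * emeasure S (E \<inter> F)" if "F \<in> sets S" for F
      proof -
        have "emeasure D F = (\<integral>\<^sup>+ \<omega>. c * indicator E \<omega> * indicator F \<omega> \<partial>S)"
          using that unfolding D_def by (subst emeasure_density) auto
        also have "\<dots> = (\<integral>\<^sup>+ \<omega>. c * indicator (E \<inter> F) \<omega> \<partial>S)"
          by (intro nn_integral_cong) (auto split: split_indicator)
        finally show ?thesis using that by (simp add: nn_integral_cmult_indicator)
      qed
      have cE: "c * emeasure S E = 1"
        using pos by (simp add: c_def P.emeasure_eq_measure flip: ennreal_mult)
      have "D = S"
      proof (rule PiM_eq)
        fix J :: "nat set" and F
        assume J: "finite J" "\<And>j. j \<in> J \<Longrightarrow> F j \<in> sets M"
        let ?F = "prod_emb UNIV (\<lambda>_. M) J (\<Pi>\<^sub>E j\<in>J. F j)"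
        obtain n where n: "J \<subseteq> {..<n}" using finite_nat_iff_bounded J(1) by blast
        have F: "?F \<in> sets S" using J by (intro sets_PiM_I) auto
        have "emeasure D ?F = c * (emeasure S E * emeasure S ?F)"
        proof (subst D[OF F], subst meet[OF F, of n])
          fix \<omega> \<omega>' :: "nat \<Rightarrow> 'a"
          assume sp: "\<omega> \<in> space S" "\<omega>' \<in> space S"
          have "comb_seq n \<omega> \<omega>' j = \<omega> j" if "j \<in> J" for j
            using that n by (intro comb_seq_less) auto
          then have "restrict (comb_seq n \<omega> \<omega>') J = restrict \<omega> J" by (auto simp: restrict_def)
          moreover have "comb_seq n \<omega> \<omega>' \<in> space S"
            using sp by (auto simp: space_PiM PiE_iff split: split_comb_seq)
          ultimately show "comb_seq n \<omega> \<omega>' \<in> ?F \<longleftrightarrow> \<omega> \<in> ?F"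
            using sp by (simp add: prod_emb_def space_PiM)
        qed simp
        also have "\<dots> = emeasure S ?F" using cE by (simp flip: mult.assoc)
        also have "\<dots> = (\<Prod>j\<in>J. emeasure M (F j))"
          using J by (intro emeasure_PiM_emb) auto
        finally show "emeasure D ?F = (\<Prod>j\<in>J. emeasure M (F j))" .
      qed (simp add: D_def)
      moreover have "emeasure D (space S - E) = 0" by (subst D) auto
      ultimately have "P.prob (space S - E) = 0" by (simp add: P.emeasure_eq_measure)
      then show False using P.prob_compl[of E] \<open>P.prob E \<noteq> 1\<close> by simp
    qed
  qed
qed

end

locale bernoulli =
  fixes s :: nat and p :: "nat \<Rightarrow> real"
  assumes p_pos: "\<And>k. k < s \<Longrightarrow> 0 < p k"
    and p_sum: "(\<Sum>k<s. p k) = 1"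
begin

abbreviation "\<B> \<equiv> bernoulli_measure s p"

abbreviation mean :: "(nat \<Rightarrow> real) \<Rightarrow> real" where
  "mean h \<equiv> (\<Sum>k<s. p k * h k)"

sublocale letters: sequence_space "point_measure {..<s} (\<lambda>k. ennreal (p k))"
proof -
  interpret prob_space "point_measure {..<s} (\<lambda>k. ennreal (p k))"
  proof (rule prob_space_point_measure)
    have "(\<Sum>k<s. ennreal (p k)) = ennreal (\<Sum>k<s. p k)"
      using p_pos by (intro sum_ennreal) (auto intro: less_imp_le)
    then show "(\<Sum>k<s. ennreal (p k)) = 1" by (simp add: p_sum)
  qed auto
  show "sequence_space (point_measure {..<s} (\<lambda>k. ennreal (p k)))" by unfold_locales
qed

sublocale ergodic_system \<B> shift
  using letters.ergodic_shift by (simp add: bernoulli_measure_def)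

lemma space_bernoulli: "space \<B> = UNIV \<rightarrow>\<^sub>E {..<s}"
  by (simp add: bernoulli_measure_def space_PiM space_point_measure)

lemma letter_less: "\<omega> \<in> space \<B> \<Longrightarrow> \<omega> i < s"
  by (auto simp: space_bernoulli PiE_iff)

lemma measurable_letter [measurable]: "(\<lambda>\<omega>. \<omega> i) \<in> measurable \<B> (count_space UNIV)"
proof -
  have "(\<lambda>\<omega>. \<omega> i) \<in> measurable \<B> (point_measure {..<s} (\<lambda>k. ennreal (p k)))"
    unfolding bernoulli_measure_def by (rule measurable_component_singleton) simp
  then have "(\<lambda>\<omega>. \<omega> i) \<in> measurable \<B> (count_space {..<s})"
    using measurable_cong_sets[OF refl sets_point_measure_count_space] by blast
  then show ?thesis by (rule measurable_compose) simp
qed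

text \<open>The alphabet is countable, so a function of finitely many letters needs no regularity.\<close>
lemma measurable_finite_coordinates:
  fixes f :: "(nat \<Rightarrow> nat) \<Rightarrow> 'b"
  assumes "\<And>\<omega> \<omega>'. (\<And>i. i < n \<Longrightarrow> \<omega> i = \<omega>' i) \<Longrightarrow> f \<omega> = f \<omega>'" and "range f \<subseteq> space N"
  shows "f \<in> measurable \<B> N"
proof -
  have prefix: "(\<lambda>\<omega>. map \<omega> [0..<n]) \<in> measurable \<B> (count_space UNIV)"
  proof (induction n)
    case (Suc n)
    have "(\<lambda>\<omega>. (\<lambda>l. map \<omega> [0..<n] @ [l]) (\<omega> n)) \<in> measurable \<B> (count_space UNIV)"
      by (rule measurable_compose_countable[OF _ measurable_letter])
         (rule measurable_compose[OF Suc], simp)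
    then show ?case by simp
  qed simp
  have "f = (\<lambda>\<omega>. (\<lambda>w. f (\<lambda>i. w ! i)) (map \<omega> [0..<n]))"
    by (intro ext assms(1)) simp
  also have "\<dots> \<in> measurable \<B> N"
    by (rule measurable_compose[OF prefix]) (use assms(2) in auto)
  finally show ?thesis .
qed

lemma integral_first_letter:
  fixes G :: "(nat \<Rightarrow> nat) \<Rightarrow> real"
  assumes [measurable]: "G \<in> borel_measurable \<B>" and bound: "\<And>\<omega>. \<omega> \<in> space \<B> \<Longrightarrow> \<bar>G \<omega>\<bar> \<le> C"
  shows "(\<integral>\<omega>. G \<omega> \<partial>\<B>) = mean (\<lambda>k. \<integral>\<omega>. G (case_nat k \<omega>) \<partial>\<B>)"
proof -
  let ?M = "point_measure {..<s} (\<lambda>k. ennreal (p k))"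
  interpret pair: pair_prob_space ?M \<B>
    by unfold_locales
  have iter: "distr (?M \<Otimes>\<^sub>M \<B>) \<B> (\<lambda>(k, \<omega>). case_nat k \<omega>) = \<B>"
    using letters.PiM_iter by (simp add: bernoulli_measure_def)
  have meas: "(\<lambda>(k, \<omega>). case_nat k \<omega>) \<in> measurable (?M \<Otimes>\<^sub>M \<B>) \<B>"
    unfolding bernoulli_measure_def by measurable
  then have meas2: "(\<lambda>x. G (case_nat (fst x) (snd x))) \<in> borel_measurable (?M \<Otimes>\<^sub>M \<B>)"
    using measurable_compose[OF meas assms(1)] by (simp add: split_beta')
  have "(\<integral>\<omega>. G \<omega> \<partial>\<B>) = (\<integral>x. G (case_nat (fst x) (snd x)) \<partial>(?M \<Otimes>\<^sub>M \<B>))"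
    by (subst iter[symmetric], subst integral_distr[OF meas]) (auto simp: split_beta')
  also have "\<dots> = (\<integral>k. (\<integral>\<omega>. G (case_nat k \<omega>) \<partial>\<B>) \<partial>?M)"
  proof (subst pair.integral_fst'[symmetric])
    show "integrable (?M \<Otimes>\<^sub>M \<B>) (\<lambda>x. G (case_nat (fst x) (snd x)))"
      using meas2 bound measurable_space[OF meas]
      by (intro pair.P.integrable_const_bound[of _ C]) (auto simp: split_beta')
  qed simp
  also have "\<dots> = mean (\<lambda>k. \<integral>\<omega>. G (case_nat k \<omega>) \<partial>\<B>)"
    using p_pos by (subst lebesgue_integral_point_measure_finite) (auto intro: less_imp_le)
  finally show ?thesis .
qed

lemma borel_letter: "(\<lambda>\<omega>. h (\<omega> i) :: real) \<in> borel_measurable \<B>"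
  by (rule measurable_compose[OF measurable_letter]) simp

lemma letter_bound:
  fixes h :: "nat \<Rightarrow> real"
  assumes "\<omega> \<in> space \<B>" shows "\<bar>h (\<omega> i)\<bar> \<le> (\<Sum>k<s. \<bar>h k\<bar>)"
  using letter_less[OF assms, of i] by (intro member_le_sum) auto

lemma expectation_letter: "(\<integral>\<omega>. h (\<omega> i) \<partial>\<B>) = mean h"
proof -
  have "(\<integral>\<omega>. h (\<omega> i) \<partial>\<B>) = (\<integral>\<omega>. h (\<omega> 0) \<partial>\<B>)"
    using integral_funpow_T[OF borel_letter[of h 0], of i] by (simp add: funpow_shift)
  also have "\<dots> = mean h"
    using integral_first_letter[where C = "\<Sum>k<s. \<bar>h k\<bar>", OF borel_letter[of h 0]] letter_bound
    by (simp add: prob_space)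
  finally show ?thesis .
qed

theorem law_of_large_numbers:
  "AE \<omega> in \<B>. (\<lambda>n. (\<Sum>i<n. h (\<omega> i)) / real n) \<longlonglongrightarrow> mean h"
  using birkhoff_bounded[where C = "\<Sum>k<s. \<bar>h k\<bar>", OF borel_letter[of h 0]] letter_bound
  by (simp add: funpow_shift expectation_letter)

definition starts_with :: "nat list \<Rightarrow> (nat \<Rightarrow> nat) \<Rightarrow> bool" where
  "starts_with w \<omega> \<longleftrightarrow> (\<forall>i<length w. \<omega> i = w ! i)"

lemma starts_with_Cons: "starts_with (k # w) (case_nat j \<omega>) \<longleftrightarrow> j = k \<and> starts_with w \<omega>"
  by (auto simp: starts_with_def nth_Cons less_Suc_eq_0_disj split: nat.splits)

lemma measurable_starts_with:
  "(\<lambda>\<omega>. of_bool (starts_with w \<omega>) :: real) \<in> borel_measurable \<B>"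
  by (rule measurable_finite_coordinates[of "length w"]) (auto simp: starts_with_def)

lemma word_probability:
  assumes "set w \<subseteq> {..<s}"
  shows "(\<integral>\<omega>. of_bool (starts_with w \<omega>) \<partial>\<B>) = (\<Prod>k\<leftarrow>w. p k)"
  using assms
proof (induction w)
  case Nil
  then show ?case by (simp add: starts_with_def prob_space)
next
  case (Cons k w)
  have "(\<integral>\<omega>. of_bool (starts_with (k # w) \<omega>) \<partial>\<B>)
      = mean (\<lambda>j. \<integral>\<omega>. of_bool (starts_with (k # w) (case_nat j \<omega>)) \<partial>\<B>)"
    by (rule integral_first_letter[OF measurable_starts_with, of _ 1]) simp
  also have "\<dots> = mean (\<lambda>j. if j = k then (\<integral>\<omega>. of_bool (starts_with w \<omega>) \<partial>\<B>) else 0)"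
    by (intro sum.cong) (auto simp: starts_with_Cons)
  also have "\<dots> = p k * (\<integral>\<omega>. of_bool (starts_with w \<omega>) \<partial>\<B>)"
    using Cons.prems by (simp add: if_distrib[of "\<lambda>x. _ * x"] cong: if_cong)
  finally show ?case using Cons by simp
qed

lemma word_probability_pos:
  assumes "set w \<subseteq> {..<s}" shows "0 < (\<Prod>k\<leftarrow>w. p k)"
  using assms by (induction w) (auto intro: p_pos mult_pos_pos)

lemma word_frequency:
  assumes "set w \<subseteq> {..<s}"
  shows "AE \<omega> in \<B>. (\<lambda>n. (\<Sum>i<n. of_bool (starts_with w (\<lambda>j. \<omega> (j + i)))) / real n)
           \<longlonglongrightarrow> (\<Prod>k\<leftarrow>w. p k)"
  using birkhoff_bounded[OF measurable_starts_with[of w], of 1]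
  by (simp add: funpow_shift word_probability[OF assms])

lemma letter_frequency:
  assumes "k < s"
  shows "AE \<omega> in \<B>. (\<lambda>n. (\<Sum>i<n. of_bool (\<omega> i = k)) / real n) \<longlonglongrightarrow> p k"
  using word_frequency[of "[k]"] assms by (simp add: starts_with_def)

text \<open>
  Each finite word has positive probability, so an almost sure property is satisfied by some
  sequence with any prescribed beginning. This makes almost sure statements about finite products sure.
\<close>
lemma AE_prefix:
  assumes "AE \<omega> in \<B>. Q \<omega>" and "\<omega>0 \<in> space \<B>"
  shows "\<exists>\<omega>. Q \<omega> \<and> (\<forall>i<n. \<omega> i = \<omega>0 i)"
proof (rule ccontr)
  assume none: "\<not> ?thesis"
  define w where "w = map \<omega>0 [0..<n]"
  have w: "set w \<subseteq> {..<s}" using letter_less[OF assms(2)] by (auto simp: w_def)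
  from assms(1) have "AE \<omega> in \<B>. of_bool (starts_with w \<omega>) = (0::real)"
  proof eventually_elim
    case (elim \<omega>)
    then show ?case using none by (auto simp: starts_with_def w_def)
  qed
  then have "(\<integral>\<omega>. of_bool (starts_with w \<omega>) \<partial>\<B>) = (\<integral>\<omega>. 0 \<partial>\<B> :: real)"
    using measurable_starts_with[of w] by (intro integral_cong_AE) auto
  then show False using word_probability[OF w] word_probability_pos[OF w] by simp
qed

end

section \<open>Singular values and norms of two-by-two matrices\<close>

definition nonneg_vec :: "real^'n \<Rightarrow> bool" where
  "nonneg_vec v \<longleftrightarrow> (\<forall>i. 0 \<le> v $ i)"

definition nonneg_mat :: "real^'n^'m \<Rightarrow> bool" where
  "nonneg_mat M \<longleftrightarrow> (\<forall>i j. 0 \<le> M $ i $ j)"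

definition col_sum :: "real^'n^'m \<Rightarrow> 'n \<Rightarrow> real" where
  "col_sum M j = (\<Sum>i\<in>UNIV. M $ i $ j)"

text \<open>On nonnegative matrices this is a submultiplicative norm.\<close>
definition entry_sum :: "real^'n^'m \<Rightarrow> real" where
  "entry_sum M = (\<Sum>j\<in>UNIV. col_sum M j)"

lemma eigenvals_2:
  fixes N :: "real^2^2"
  shows "eigenvals N = {c. (N$1$1 - c) * (N$2$2 - c) - N$1$2 * N$2$1 = 0}"
proof -
  have "c \<in> eigenvals N \<longleftrightarrow> det (N - mat c) = 0" for c
  proof -
    have "c \<in> eigenvals N \<longleftrightarrow> (\<exists>v. v \<noteq> 0 \<and> (N - mat c) *v v = 0)"
      by (simp add: eigenvals_def vec_eq_iff matrix_vector_mult_def sum_2 forall_2 mat_def algebra_simps)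
    also have "\<dots> \<longleftrightarrow> rank (N - mat c) \<noteq> CARD(2)"
      by (rule matrix_nonfull_linear_equations_eq)
    also have "\<dots> \<longleftrightarrow> det (N - mat c) = 0"
      using rank_bound[of "N - mat c"] by (auto simp: det_eq_0_rank)
    finally show ?thesis .
  qed
  then show ?thesis by (auto simp: det_2 mat_def)
qed

text \<open>
  The squares of the singular values are the two roots of \<open>x\<^sup>2 - t x + (det M)\<^sup>2\<close>, where \<open>t\<close>, the trace
  of \<open>transpose M ** M\<close>, is the sum of the squares of the entries of \<open>M\<close>.
\<close>
lemma singular_values_2:
  fixes M :: "real^2^2"
  shows sing_val2_nonneg: "0 \<le> sing_val2 M"
    and sing_val2_le_sing_val1: "sing_val2 M \<le> sing_val1 M"
    and sing_val_sum_squares: "(sing_val1 M)\<^sup>2 + (sing_val2 M)\<^sup>2 = (\<Sum>i\<in>UNIV. \<Sum>j\<in>UNIV. (M $ i $ j)\<^sup>2)"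
    and sing_val_prod: "sing_val1 M * sing_val2 M = \<bar>det M\<bar>"
proof -
  define N where "N = transpose M ** M"
  define t where "t = N$1$1 + N$2$2"
  define \<Delta> where "\<Delta> = (N$1$1 - N$2$2)\<^sup>2 + 4 * (N$1$2)\<^sup>2"
  have sym: "N$2$1 = N$1$2"
    by (simp add: N_def matrix_matrix_mult_def transpose_def sum_2)
  have t: "t = (\<Sum>i\<in>UNIV. \<Sum>j\<in>UNIV. (M $ i $ j)\<^sup>2)"
    by (simp add: t_def N_def matrix_matrix_mult_def transpose_def sum_2 power2_eq_square)
  have det_N: "N$1$1 * N$2$2 - N$1$2 * N$1$2 = (det M)\<^sup>2"
    by (simp add: N_def matrix_matrix_mult_def transpose_def sum_2 det_2 power2_eq_square algebra_simps)
  have \<Delta>: "0 \<le> \<Delta>" by (simp add: \<Delta>_def)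
  have \<Delta>_t: "\<Delta> = t\<^sup>2 - 4 * (det M)\<^sup>2"
    unfolding det_N[symmetric] by (simp add: \<Delta>_def t_def power2_eq_square algebra_simps)
  define r1 r2 where "r1 = (t + sqrt \<Delta>) / 2" and "r2 = (t - sqrt \<Delta>) / 2"
  have r: "r2 \<le> r1" "r1 + r2 = t" using \<Delta> by (auto simp: r1_def r2_def field_simps)
  have r_prod: "r1 * r2 = (det M)\<^sup>2"
  proof -
    have "r1 * r2 = (t\<^sup>2 - (sqrt \<Delta>)\<^sup>2) / 4" by (simp add: r1_def r2_def power2_eq_square algebra_simps)
    then show ?thesis using \<Delta> \<Delta>_t by simp
  qed
  have "eigenvals N = {r1, r2}"
  proof -
    have "(N$1$1 - c) * (N$2$2 - c) - N$1$2 * N$2$1 = (c - r1) * (c - r2)" for c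
    proof -
      have "(N$1$1 - c) * (N$2$2 - c) - N$1$2 * N$2$1 = c * c - c * t + (det M)\<^sup>2"
        unfolding det_N[symmetric] sym t_def by (simp add: algebra_simps)
      also have "\<dots> = (c - r1) * (c - r2)"
        unfolding r_prod[symmetric] r(2)[symmetric] by (simp add: algebra_simps)
      finally show ?thesis .
    qed
    then show ?thesis by (auto simp: eigenvals_2)
  qed
  then have s: "sing_val1 M = sqrt r1" "sing_val2 M = sqrt r2"
    using r by (auto simp: sing_val1_def sing_val2_def N_def max_def min_def)
  have "0 \<le> t" by (simp add: t sum_nonneg)
  moreover have "sqrt \<Delta> \<le> t"
    using \<open>0 \<le> t\<close> by (intro real_le_lsqrt) (auto simp: \<Delta>_t)
  ultimately have r2: "0 \<le> r2" and r1: "0 \<le> r1" using \<Delta> by (auto simp: r2_def r1_def)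
  show "0 \<le> sing_val2 M" "sing_val2 M \<le> sing_val1 M" using r r2 by (auto simp: s)
  show "(sing_val1 M)\<^sup>2 + (sing_val2 M)\<^sup>2 = (\<Sum>i\<in>UNIV. \<Sum>j\<in>UNIV. (M $ i $ j)\<^sup>2)"
    using r r1 r2 t by (simp add: s)
  show "sing_val1 M * sing_val2 M = \<bar>det M\<bar>"
    by (simp add: s r_prod flip: real_sqrt_mult)
qed

lemma nonneg_mat_mult: "nonneg_mat M \<Longrightarrow> nonneg_mat N \<Longrightarrow> nonneg_mat (M ** N)"
  by (auto simp: nonneg_mat_def matrix_matrix_mult_def intro!: sum_nonneg)

lemma nonneg_mat_vec: "nonneg_mat M \<Longrightarrow> nonneg_vec v \<Longrightarrow> nonneg_vec (M *v v)"
  by (auto simp: nonneg_mat_def nonneg_vec_def matrix_vector_mult_def intro!: sum_nonneg)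

lemma col_sum_nonneg: "nonneg_mat M \<Longrightarrow> 0 \<le> col_sum M j"
  by (auto simp: nonneg_mat_def col_sum_def intro: sum_nonneg)

lemma entry_sum_nonneg: "nonneg_mat M \<Longrightarrow> 0 \<le> entry_sum M"
  by (auto simp: entry_sum_def intro: sum_nonneg col_sum_nonneg)

lemma col_sum_le_entry_sum: "nonneg_mat M \<Longrightarrow> col_sum M j \<le> entry_sum M"
  unfolding entry_sum_def by (rule member_le_sum) (auto simp: col_sum_nonneg)

lemma entry_le_entry_sum:
  assumes "nonneg_mat M" shows "M $ i $ j \<le> entry_sum M"
proof -
  have "M $ i $ j \<le> col_sum M j"
    unfolding col_sum_def by (rule member_le_sum) (use assms in \<open>auto simp: nonneg_mat_def\<close>)
  with col_sum_le_entry_sum[OF assms, of j] show ?thesis by simp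
qed

lemma entry_sum_pos:
  assumes "nonneg_mat M" "M \<noteq> 0" shows "0 < entry_sum M"
proof -
  obtain i j where "M $ i $ j \<noteq> 0" using assms(2) by (auto simp: vec_eq_iff)
  with assms(1) have "0 < M $ i $ j" by (auto simp: nonneg_mat_def less_le)
  with entry_le_entry_sum[OF assms(1), of i j] show ?thesis by simp
qed

lemma col_sum_mult: "col_sum (M ** N) j = (\<Sum>k\<in>UNIV. col_sum M k * N $ k $ j)"
  unfolding col_sum_def matrix_matrix_mult_def
  by (simp add: sum_distrib_right) (rule sum.swap)

lemma entry_sum_mult_le:
  assumes "nonneg_mat M" "nonneg_mat N"
  shows "entry_sum (M ** N) \<le> entry_sum M * entry_sum N"
proof -
  have "entry_sum (M ** N) \<le> (\<Sum>j\<in>UNIV. \<Sum>k\<in>UNIV. entry_sum M * N $ k $ j)"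
    unfolding entry_sum_def[of "M ** N"] col_sum_mult
    using assms by (intro sum_mono mult_right_mono col_sum_le_entry_sum) (auto simp: nonneg_mat_def)
  also have "\<dots> = entry_sum M * entry_sum N"
    by (simp add: entry_sum_def col_sum_def sum_distrib_left)
  finally show ?thesis .
qed

lemma norm1_mat_vec:
  assumes "nonneg_mat M" "nonneg_vec v"
  shows "norm1 (M *v v) = (\<Sum>j\<in>UNIV. col_sum M j * v $ j)"
proof -
  have "norm1 (M *v v) = (\<Sum>i\<in>UNIV. \<Sum>j\<in>UNIV. M $ i $ j * v $ j)"
    using nonneg_mat_vec[OF assms] by (simp add: norm1_def nonneg_vec_def matrix_vector_mult_def)
  also have "\<dots> = (\<Sum>j\<in>UNIV. col_sum M j * v $ j)"
    by (subst sum.swap) (simp add: col_sum_def sum_distrib_right)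
  finally show ?thesis .
qed

lemma norm1_pos: "v \<noteq> 0 \<Longrightarrow> 0 < norm1 v"
proof -
  assume "v \<noteq> 0"
  then obtain i where "v $ i \<noteq> 0" by (auto simp: vec_eq_iff)
  moreover have "\<bar>v $ i\<bar> \<le> norm1 v" unfolding norm1_def by (rule member_le_sum) auto
  ultimately show ?thesis by linarith
qed

text \<open>
  Both singular values and the sum of the entries are compared with the sum of the squares of the
  entries. The constant 3 is a convenient bound for \<open>2 * sqrt 2\<close>.
\<close>
lemma entry_sum_sing_val1:
  fixes M :: "real^2^2"
  assumes "nonneg_mat M"
  shows "entry_sum M \<le> 3 * sing_val1 M" and "sing_val1 M \<le> entry_sum M"
proof -
  let ?F = "\<Sum>i\<in>UNIV. \<Sum>j\<in>UNIV. (M $ i $ j)\<^sup>2"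
  let ?a = "M$1$1" and ?b = "M$1$2" and ?c = "M$2$1" and ?d = "M$2$2"
  have F: "?F = ?a\<^sup>2 + ?b\<^sup>2 + ?c\<^sup>2 + ?d\<^sup>2" by (simp add: sum_2)
  have E: "entry_sum M = ?a + ?b + ?c + ?d" by (simp add: entry_sum_def col_sum_def sum_2)
  have nn: "0 \<le> ?a" "0 \<le> ?b" "0 \<le> ?c" "0 \<le> ?d" using assms by (auto simp: nonneg_mat_def)
  have s: "0 \<le> sing_val1 M" "(sing_val2 M)\<^sup>2 \<le> (sing_val1 M)\<^sup>2"
    using sing_val2_nonneg[of M] sing_val2_le_sing_val1[of M] by (auto intro: power_mono)
  have "?F \<le> (entry_sum M)\<^sup>2"
  proof -
    define Q where "Q = ?a * ?b + ?a * ?c + ?a * ?d + ?b * ?c + ?b * ?d + ?c * ?d"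
    have "(entry_sum M)\<^sup>2 = ?F + 2 * Q"
      unfolding F E Q_def by (simp add: power2_eq_square algebra_simps)
    moreover have "0 \<le> Q" using nn by (simp add: Q_def)
    ultimately show ?thesis by simp
  qed
  then have "(sing_val1 M)\<^sup>2 \<le> (entry_sum M)\<^sup>2"
    using sing_val_sum_squares[of M] zero_le_power2[of "sing_val2 M"] by linarith
  then show "sing_val1 M \<le> entry_sum M"
    using entry_sum_nonneg[OF assms] power2_le_imp_le by blast
  have "(entry_sum M)\<^sup>2 \<le> 4 * ?F"
  proof -
    have "4 * ?F - (entry_sum M)\<^sup>2 = (?a - ?b)\<^sup>2 + (?a - ?c)\<^sup>2 + (?a - ?d)\<^sup>2 + (?b - ?c)\<^sup>2 + (?b - ?d)\<^sup>2 + (?c - ?d)\<^sup>2"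
      unfolding F E by (simp add: power2_eq_square algebra_simps)
    moreover have "0 \<le> (?a - ?b)\<^sup>2 + (?a - ?c)\<^sup>2 + (?a - ?d)\<^sup>2 + (?b - ?c)\<^sup>2 + (?b - ?d)\<^sup>2 + (?c - ?d)\<^sup>2" by simp
    ultimately show ?thesis by linarith
  qed
  also have "4 * ?F \<le> 9 * (sing_val1 M)\<^sup>2"
    using sing_val_sum_squares[of M] s zero_le_power2[of "sing_val1 M"] by linarith
  finally have "(entry_sum M)\<^sup>2 \<le> (3 * sing_val1 M)\<^sup>2" by (simp add: power_mult_distrib)
  then show "entry_sum M \<le> 3 * sing_val1 M" using s by (auto intro: power2_le_imp_le)
qed

lemma mat_norm1_2:
  fixes M :: "real^2^'m"
  shows "mat_norm1 M = max (norm1 (column 1 M)) (norm1 (column 2 M))"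
proof -
  have "range (\<lambda>j. norm1 (column j M)) = {norm1 (column 1 M), norm1 (column 2 M)}"
    unfolding UNIV_2 by auto
  then show ?thesis by (simp add: mat_norm1_def)
qed

lemma mat_norm1_pos:
  fixes M :: "real^2^2"
  assumes "M \<noteq> 0" shows "0 < mat_norm1 M"
proof -
  have "column 1 M \<noteq> 0 \<or> column 2 M \<noteq> 0"
    using assms by (auto simp: column_def vec_eq_iff forall_2)
  then show ?thesis by (auto simp: mat_norm1_2 less_max_iff_disj norm1_pos)
qed

lemma mat_norm1_scaleR: "mat_norm1 (c *\<^sub>R M) = \<bar>c\<bar> * mat_norm1 (M :: real^2^2)"
proof -
  have "norm1 (column j (c *\<^sub>R M)) = \<bar>c\<bar> * norm1 (column j M)" for j
    by (simp add: norm1_def column_def abs_mult sum_distrib_left)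
  then show ?thesis by (simp add: mat_norm1_2 max_mult_distrib_left)
qed

lemma mat_norm1_normalized: "M \<noteq> 0 \<Longrightarrow> mat_norm1 (normalized_mat (M :: real^2^2)) = 1"
  using mat_norm1_pos[of M] by (simp add: normalized_mat_def mat_norm1_scaleR)

lemma tendsto_mat_norm1 [tendsto_intros]:
  fixes L :: "real^2^2"
  assumes "(X \<longlongrightarrow> L) F"
  shows "((\<lambda>n. mat_norm1 (X n)) \<longlongrightarrow> mat_norm1 L) F"
  unfolding mat_norm1_2 norm1_def column_def
  by (simp, intro tendsto_intros assms)

lemma matrix_scaleR_mult: "(c *\<^sub>R M) ** N = c *\<^sub>R (M ** N)"
  for M :: "real^'n^'m"
  by (simp add: matrix_matrix_mult_def vec_eq_iff sum_distrib_left mult.assoc)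

lemma tendsto_matrix_mult:
  fixes X :: "'a \<Rightarrow> real^'n^'m" and B :: "real^'k^'n"
  assumes "(X \<longlongrightarrow> L) F"
  shows "((\<lambda>n. X n ** B) \<longlongrightarrow> L ** B) F"
  unfolding matrix_matrix_mult_def
  by (intro vec_tendstoI) (simp, intro tendsto_intros assms)

lemma entry_sum_le_mat_norm1:
  fixes M :: "real^2^2"
  assumes "nonneg_mat M" shows "entry_sum M \<le> 2 * mat_norm1 M"
proof -
  have "norm1 (column j M) = col_sum M j" for j
    using assms by (simp add: norm1_def column_def col_sum_def nonneg_mat_def)
  then show ?thesis by (simp add: mat_norm1_2 entry_sum_def sum_2)
qed

lemma rank_1I:
  fixes L :: "real^2^2"
  assumes "L \<noteq> 0" "det L = 0" shows "rank L = 1"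
  using assms rank_eq_0[of L] by (auto simp: det_eq_0_rank)

lemma distinct_singular_growth_ratio:
  fixes P :: "nat \<Rightarrow> real^2^2"
  assumes "distinct_singular_growth P" and nz: "\<And>n. P n \<noteq> 0" and nn: "\<And>n. nonneg_mat (P n)"
  shows "(\<lambda>n. sing_val2 (P n) / sing_val1 (P n)) \<longlonglongrightarrow> 0"
proof -
  obtain l1 l2 where l1: "(\<lambda>n. root n (sing_val1 (P n))) \<longlonglongrightarrow> l1"
    and l2: "(\<lambda>n. root n (sing_val2 (P n))) \<longlonglongrightarrow> l2" and "l1 \<noteq> l2"
    using assms(1) by (auto simp: distinct_singular_growth_def)
  have pos: "0 < sing_val1 (P n)" for n
    using entry_sum_pos[OF nn nz, of n] entry_sum_sing_val1[OF nn, of n] by linarith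
  have "l2 \<le> l1"
    by (rule LIMSEQ_le[OF l2 l1])
       (intro exI[of _ 1] allI impI real_root_le_mono, auto simp: sing_val2_le_sing_val1)
  moreover have "0 \<le> l2"
    by (rule LIMSEQ_le_const[OF l2]) (auto intro!: exI[of _ 1] real_root_ge_zero sing_val2_nonneg)
  ultimately obtain a where a: "l2 < a" "a < l1" using dense[of l2 l1] \<open>l1 \<noteq> l2\<close> by auto
  then obtain b where b: "a < b" "b < l1" using dense by blast
  have a0: "0 < a" using a \<open>0 \<le> l2\<close> by simp
  have upper: "eventually (\<lambda>n. sing_val2 (P n) / sing_val1 (P n) \<le> (a / b) ^ n) sequentially"
    using order_tendstoD(2)[OF l2 a(1)] order_tendstoD(1)[OF l1 b(2)] eventually_gt_at_top[of 0]
  proof eventually_elim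
    case (elim n)
    have "sing_val2 (P n) = root n (sing_val2 (P n)) ^ n"
      using elim sing_val2_nonneg by simp
    also have "\<dots> \<le> a ^ n"
      using elim by (intro power_mono) (auto intro: real_root_ge_zero sing_val2_nonneg)
    finally have u: "sing_val2 (P n) \<le> a ^ n" .
    have "b ^ n \<le> root n (sing_val1 (P n)) ^ n"
      using elim a0 b by (intro power_mono) auto
    also have "\<dots> = sing_val1 (P n)" using elim pos[of n] by simp
    finally have v: "b ^ n \<le> sing_val1 (P n)" .
    have "sing_val2 (P n) / sing_val1 (P n) \<le> a ^ n / b ^ n"
      using u v a0 b by (intro frac_le) auto
    then show ?case by (simp add: power_divide)
  qed
  have geometric: "(\<lambda>n. (a / b) ^ n) \<longlonglongrightarrow> 0"
    using a0 b by (intro LIMSEQ_realpow_zero) auto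
  have lower: "eventually (\<lambda>n. 0 \<le> sing_val2 (P n) / sing_val1 (P n)) sequentially"
    by (intro always_eventually allI divide_nonneg_pos pos sing_val2_nonneg)
  show ?thesis by (rule real_tendsto_sandwich[OF lower upper tendsto_const geometric])
qed

text \<open>
  The determinant of the normalized matrix is, up to sign, the product of the singular values divided
  by the square of the norm, hence at most a multiple of \<open>sing_val2 / sing_val1\<close>, which tends to 0. A
  limit point has norm 1, so it is nonzero, and its determinant vanishes.
\<close>
lemma limit_points_rank_1:
  fixes P :: "nat \<Rightarrow> real^2^2"
  assumes "distinct_singular_growth P" and nz: "\<And>n. P n \<noteq> 0" and nn: "\<And>n. nonneg_mat (P n)"
    and "seq_limit_point (\<lambda>n. normalized_mat (P n)) L"
  shows "rank L = 1"
proof -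
  obtain \<phi> where \<phi>: "strict_mono \<phi>" "(\<lambda>k. normalized_mat (P (\<phi> k))) \<longlonglongrightarrow> L"
    using assms(4) by (auto simp: seq_limit_point_def comp_def)
  have "(\<lambda>k. mat_norm1 (normalized_mat (P (\<phi> k)))) \<longlonglongrightarrow> mat_norm1 L"
    by (intro tendsto_intros \<phi>)
  then have "mat_norm1 L = 1" using nz by (simp add: mat_norm1_normalized LIMSEQ_const_iff)
  then have "L \<noteq> 0" by (auto simp: mat_norm1_2 norm1_def column_def)
  have "(\<lambda>k. det (normalized_mat (P (\<phi> k)))) \<longlonglongrightarrow> det L"
    unfolding det_2 by (intro tendsto_intros \<phi>)
  moreover have "(\<lambda>k. det (normalized_mat (P (\<phi> k)))) \<longlonglongrightarrow> 0"
  proof (rule Lim_null_comparison)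
    have "norm (det (normalized_mat (P n))) \<le> 4 * (sing_val2 (P n) / sing_val1 (P n))" for n
    proof -
      note N = mat_norm1_pos[OF nz, of n]
      have s: "0 < sing_val1 (P n)"
        using entry_sum_pos[OF nn nz, of n] entry_sum_sing_val1[OF nn, of n] by linarith
      have "sing_val1 (P n) \<le> 2 * mat_norm1 (P n)"
        using entry_sum_le_mat_norm1[OF nn, of n] entry_sum_sing_val1[OF nn, of n] by linarith
      then have sq: "(sing_val1 (P n))\<^sup>2 \<le> (2 * mat_norm1 (P n))\<^sup>2" using s by (intro power_mono) auto
      have "det (c *\<^sub>R P n) = c\<^sup>2 * det (P n)" for c
        by (simp add: det_2 power2_eq_square algebra_simps)
      then have "det (normalized_mat (P n)) = det (P n) / (mat_norm1 (P n))\<^sup>2"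
        by (simp add: normalized_mat_def power_inverse divide_inverse)
      then have "norm (det (normalized_mat (P n))) = sing_val1 (P n) * sing_val2 (P n) / (mat_norm1 (P n))\<^sup>2"
        by (simp add: sing_val_prod)
      also have "\<dots> \<le> sing_val1 (P n) * sing_val2 (P n) / ((sing_val1 (P n))\<^sup>2 / 4)"
        using sq s N sing_val2_nonneg[of "P n"] by (intro divide_left_mono) (auto simp: power_mult_distrib)
      also have "\<dots> = 4 * (sing_val2 (P n) / sing_val1 (P n))"
        using s by (simp add: power2_eq_square)
      finally show ?thesis .
    qed
    then show "eventually (\<lambda>k. norm (det (normalized_mat (P (\<phi> k)))) \<le> 4 * (sing_val2 (P (\<phi> k)) / sing_val1 (P (\<phi> k)))) sequentially"
      by (intro always_eventually allI)
    have "(\<lambda>n. 4 * (sing_val2 (P n) / sing_val1 (P n))) \<longlonglongrightarrow> 4 * 0"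
      by (intro tendsto_intros distinct_singular_growth_ratio assms)
    from LIMSEQ_subseq_LIMSEQ[OF this \<phi>(1)]
    show "(\<lambda>k. 4 * (sing_val2 (P (\<phi> k)) / sing_val1 (P (\<phi> k)))) \<longlonglongrightarrow> 0" by (simp add: comp_def)
  qed
  ultimately have "det L = 0" using LIMSEQ_unique by blast
  then show ?thesis using \<open>L \<noteq> 0\<close> by (rule rank_1I[rotated])
qed

lemma rand_prod_add:
  "rand_prod A \<omega> (m + n) = rand_prod A \<omega> m ** rand_prod A (\<lambda>i. \<omega> (i + m)) n"
  by (induction n) (simp_all add: matrix_mul_assoc add.commute)

lemma rand_prod_nonneg:
  assumes "\<And>i. nonneg_mat (A (\<omega> i))"
  shows "nonneg_mat (rand_prod A \<omega> n)"
proof (induction n)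
  case 0
  show ?case by (simp add: nonneg_mat_def mat_def)
qed (simp add: nonneg_mat_mult assms)

text \<open>
  Let \<open>L\<close> be the limit of the normalized products \<open>X n\<close>. One has \<open>X n ** A (\<omega> n) = \<rho> n *\<^sub>R X (Suc n)\<close>,
  where \<open>\<rho> n\<close> is the norm of the left-hand side. Along the times \<open>n\<close> with \<open>\<omega> n = k\<close> this becomes in
  the limit \<open>L ** A k = c *\<^sub>R L\<close>, and every nonzero row of \<open>L\<close> is a left eigenvector of \<open>A k\<close>.
\<close>
lemma convergent_normalized_imp_eigenvector:
  fixes A :: "nat \<Rightarrow> real^2^2"
  assumes nz: "\<And>n. rand_prod A \<omega> n \<noteq> 0"
    and io: "\<And>k. k < s \<Longrightarrow> \<exists>\<^sub>F n in sequentially. \<omega> n = k"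
    and conv: "convergent (\<lambda>n. normalized_mat (rand_prod A \<omega> n))"
  shows "common_left_eigenvector s A"
proof -
  define X where "X n = normalized_mat (rand_prod A \<omega> n)" for n
  define \<rho> where "\<rho> n = mat_norm1 (rand_prod A \<omega> (Suc n)) / mat_norm1 (rand_prod A \<omega> n)" for n
  obtain L where L: "X \<longlonglongrightarrow> L" using conv unfolding convergent_def X_def by blast
  have "(\<lambda>n. mat_norm1 (X n)) \<longlonglongrightarrow> mat_norm1 L" by (intro tendsto_intros L)
  then have "mat_norm1 L = 1" using nz by (simp add: X_def mat_norm1_normalized LIMSEQ_const_iff)
  then have "L \<noteq> 0" by (auto simp: mat_norm1_2 norm1_def column_def)
  then obtain i where i: "L $ i \<noteq> 0" by (auto simp: vec_eq_iff)
  have step: "X n ** A (\<omega> n) = \<rho> n *\<^sub>R X (Suc n)" for n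
  proof -
    have "0 < mat_norm1 (rand_prod A \<omega> n)" "0 < mat_norm1 (rand_prod A \<omega> (Suc n))"
      using nz mat_norm1_pos by blast+
    then show ?thesis
      by (simp add: X_def \<rho>_def normalized_mat_def matrix_scaleR_mult divide_simps)
  qed
  have \<rho>: "\<rho> n = mat_norm1 (X n ** A (\<omega> n))" for n
  proof -
    have "0 \<le> \<rho> n" using nz mat_norm1_pos unfolding \<rho>_def by (metis divide_nonneg_nonneg less_imp_le)
    moreover have "mat_norm1 (X (Suc n)) = 1" using nz unfolding X_def by (rule mat_norm1_normalized)
    ultimately show ?thesis by (simp add: step mat_norm1_scaleR)
  qed
  have "\<exists>c. L $ i v* A k = c *s (L $ i)" if "k < s" for k
  proof -
    define F where "F = inf sequentially (principal {n. \<omega> n = k})"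
    have F: "F \<noteq> bot"
      using io[OF that] by (auto simp: F_def trivial_limit_def eventually_inf_principal frequently_def)
    have le: "F \<le> sequentially" by (simp add: F_def)
    have ev: "eventually (\<lambda>n. \<omega> n = k) F" by (simp add: F_def eventually_inf_principal)
    have lim: "((\<lambda>n. X n ** A k) \<longlongrightarrow> L ** A k) F"
      by (intro tendsto_matrix_mult tendsto_mono[OF le L])
    have "((\<lambda>n. \<rho> n *\<^sub>R X (Suc n)) \<longlongrightarrow> mat_norm1 (L ** A k) *\<^sub>R L) F"
    proof (rule tendsto_scaleR)
      have "((\<lambda>n. mat_norm1 (X n ** A k)) \<longlongrightarrow> mat_norm1 (L ** A k)) F"
        by (intro tendsto_intros lim)
      then show "(\<rho> \<longlongrightarrow> mat_norm1 (L ** A k)) F"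
        by (rule tendsto_cong[THEN iffD1, rotated]) (use ev in eventually_elim, simp add: \<rho>)
      show "((\<lambda>n. X (Suc n)) \<longlongrightarrow> L) F"
        by (rule tendsto_mono[OF le]) (rule LIMSEQ_Suc[OF L])
    qed
    moreover have "((\<lambda>n. \<rho> n *\<^sub>R X (Suc n)) \<longlongrightarrow> L ** A k) F"
      using lim by (rule tendsto_cong[THEN iffD1, rotated]) (use ev in eventually_elim, simp flip: step)
    ultimately have "L ** A k = mat_norm1 (L ** A k) *\<^sub>R L" using tendsto_unique[OF F] by blast
    then have "(L ** A k) $ i = mat_norm1 (L ** A k) *s (L $ i)"
      by (metis scalar_mult_eq_scaleR vector_scaleR_component)
    moreover have "(L ** A k) $ i = L $ i v* A k"
      by (simp add: vec_eq_iff matrix_matrix_mult_def vector_matrix_mult_def mult.commute)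
    ultimately show ?thesis by auto
  qed
  with i show ?thesis by (auto simp: common_left_eigenvector_def)
qed

section \<open>Exponential convergence of directions\<close>

text \<open>The finitely many terms before \<open>m\<close> are absorbed by enlarging the constant.\<close>
lemma exp_convergent_alongI:
  fixes X :: "nat \<Rightarrow> real^'n"
  assumes r: "0 < r" "r < 1"
    and bound: "\<And>n i. n \<in> N \<Longrightarrow> m \<le> n \<Longrightarrow> \<bar>X n $ i - L $ i\<bar> \<le> C * r ^ n"
  shows "exp_convergent_along N X"
proof -
  define D where "D = \<bar>C\<bar> + (\<Sum>n<m. \<Sum>i\<in>UNIV. \<bar>X n $ i - L $ i\<bar> / r ^ n) + 1"
  have D_sum: "0 \<le> (\<Sum>n<m. \<Sum>i\<in>UNIV. \<bar>X n $ i - L $ i\<bar> / r ^ n)"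
    using r by (intro sum_nonneg) auto
  have D: "\<bar>X n $ i - L $ i\<bar> < D * r ^ n" if "n \<in> N" for n i
  proof (cases "m \<le> n")
    case True
    have "\<bar>X n $ i - L $ i\<bar> \<le> C * r ^ n" by (rule bound[OF that True])
    also have "\<dots> < D * r ^ n" using r D_sum by (intro mult_strict_right_mono) (auto simp: D_def)
    finally show ?thesis .
  next
    case False
    have "\<bar>X n $ i - L $ i\<bar> / r ^ n \<le> (\<Sum>i\<in>UNIV. \<bar>X n $ i - L $ i\<bar> / r ^ n)"
      using r by (intro member_le_sum) auto
    also have "\<dots> \<le> (\<Sum>n<m. \<Sum>i\<in>UNIV. \<bar>X n $ i - L $ i\<bar> / r ^ n)"
      using False r by (intro member_le_sum[of n]) (auto intro!: sum_nonneg)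
    also have "\<dots> < D" by (simp add: D_def)
    finally show ?thesis using r by (simp add: field_simps)
  qed
  have "(X \<longlongrightarrow> L) (inf sequentially (principal N))"
  proof (rule vec_tendstoI)
    fix i
    have "(\<lambda>n. D * r ^ n) \<longlonglongrightarrow> D * 0" using r by (intro tendsto_intros LIMSEQ_realpow_zero) auto
    then have "((\<lambda>n. D * r ^ n) \<longlongrightarrow> 0) (inf sequentially (principal N))"
      using tendsto_mono[of "inf sequentially (principal N)" sequentially] by simp
    moreover have "eventually (\<lambda>n. norm (X n $ i - L $ i) \<le> D * r ^ n) (inf sequentially (principal N))"
      using D by (auto simp: eventually_inf_principal intro!: always_eventually less_imp_le)
    ultimately have "((\<lambda>n. X n $ i - L $ i) \<longlongrightarrow> 0) (inf sequentially (principal N))"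
      by (rule Lim_null_comparison[rotated])
    then show "((\<lambda>n. X n $ i) \<longlongrightarrow> L $ i) (inf sequentially (principal N))"
      by (rule LIM_zero_cancel)
  qed
  moreover have "0 < D" using D_sum by (simp add: D_def)
  ultimately show ?thesis using D r unfolding exp_convergent_along_def by blast
qed

text \<open>
  Coordinate vectors \<open>V\<close> give the normalized columns. As for these, only the times at which \<open>P n *v V\<close>
  can be normalized count.
\<close>
definition directions_converge :: "(nat \<Rightarrow> real^2^2) \<Rightarrow> bool" where
  "directions_converge P \<longleftrightarrow> (\<forall>V. nonneg_vec V \<longrightarrow>
     exp_convergent_along {n. P n *v V \<noteq> 0} (\<lambda>n. normalized_vec (P n *v V)))"

text \<open>
  The quotient of \<open>\<bar>det (P n)\<bar>\<close> by the product of the column sums is the distance of the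
  two normalized columns. It is multiplied out because a column may vanish.
\<close>
definition contracting :: "(nat \<Rightarrow> real^2^2) \<Rightarrow> bool" where
  "contracting P \<longleftrightarrow> (\<exists>C r N. 0 < r \<and> r < 1 \<and>
     (\<forall>n\<ge>N. \<bar>det (P n)\<bar> \<le> C * r ^ n * (col_sum (P n) 1 * col_sum (P n) 2)))"

lemma directions_converge_imp_columns:
  assumes "directions_converge P"
  shows "normalized_columns_exp_convergent P"
  unfolding normalized_columns_exp_convergent_def
proof
  fix j
  have "nonneg_vec (axis j 1 :: real^2)" by (simp add: nonneg_vec_def axis_def)
  with assms show "exp_convergent_along {n. column j (P n) \<noteq> 0} (\<lambda>n. normalized_vec (column j (P n)))"
    unfolding directions_converge_def by (metis (no_types, lifting) matrix_vector_mult_basis Collect_cong ext)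
qed

lemma normalized_vec_diff:
  fixes x y :: "real^2"
  assumes "nonneg_vec x" "nonneg_vec y" "x \<noteq> 0" "y \<noteq> 0"
  shows "\<bar>normalized_vec x $ i - normalized_vec y $ i\<bar> = \<bar>x$1 * y$2 - x$2 * y$1\<bar> / (norm1 x * norm1 y)"
proof -
  have n: "norm1 x = x$1 + x$2" "norm1 y = y$1 + y$2"
    using assms by (auto simp: norm1_def sum_2 nonneg_vec_def)
  have pos: "0 < norm1 x" "0 < norm1 y" using assms norm1_pos by auto
  have diff: "normalized_vec x $ i - normalized_vec y $ i = (x$i * norm1 y - y$i * norm1 x) / (norm1 x * norm1 y)"
    using pos by (simp add: normalized_vec_def field_simps)
  have "\<bar>x$i * norm1 y - y$i * norm1 x\<bar> = \<bar>x$1 * y$2 - x$2 * y$1\<bar>"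
  proof (cases "i = 1")
    case True
    then show ?thesis by (simp add: n algebra_simps)
  next
    case False
    then have "i = 2" using exhaust_2 by blast
    then have "x$i * norm1 y - y$i * norm1 x = - (x$1 * y$2 - x$2 * y$1)" by (simp add: n algebra_simps)
    then show ?thesis by (simp only: abs_minus_cancel)
  qed
  then show ?thesis using pos by (simp add: diff abs_mult)
qed

text \<open>
  The gap equals \<open>\<bar>det M\<bar> * \<bar>det (V, W)\<bar>\<close> divided by the product of the norms of \<open>M *v V\<close> and \<open>M *v W\<close>. With
  the column sums \<open>x, y\<close> the norms are \<open>x * V$1 + y * V$2\<close> and \<open>x * W$1 + y * W$2\<close>, whose product is
  at least \<open>x * y * (V$1 * W$2 + V$2 * W$1)\<close>.
\<close>
lemma direction_gap_le:
  fixes M :: "real^2^2"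
  assumes M: "nonneg_mat M" and V: "nonneg_vec V" "M *v V \<noteq> 0" and W: "nonneg_vec W" "M *v W \<noteq> 0"
    and det: "\<bar>det M\<bar> \<le> \<epsilon> * (col_sum M 1 * col_sum M 2)" and \<epsilon>: "0 \<le> \<epsilon>"
  shows "\<bar>normalized_vec (M *v V) $ i - normalized_vec (M *v W) $ i\<bar> \<le> \<epsilon>"
proof -
  define x y where "x = col_sum M 1" and "y = col_sum M 2"
  have nn: "0 \<le> x" "0 \<le> y" "0 \<le> V$1" "0 \<le> V$2" "0 \<le> W$1" "0 \<le> W$2"
    using M V W by (auto simp: x_def y_def col_sum_nonneg nonneg_vec_def)
  have norms: "norm1 (M *v V) = x * V$1 + y * V$2" "norm1 (M *v W) = x * W$1 + y * W$2"
    using norm1_mat_vec[OF M V(1)] norm1_mat_vec[OF M W(1)] by (auto simp: x_def y_def sum_2)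
  have pos: "0 < norm1 (M *v V)" "0 < norm1 (M *v W)" using V W norm1_pos by auto
  have "(M *v V)$1 * (M *v W)$2 - (M *v V)$2 * (M *v W)$1 = det M * (V$1 * W$2 - V$2 * W$1)"
    by (simp add: matrix_vector_mult_def sum_2 det_2 algebra_simps)
  then have "\<bar>(M *v V)$1 * (M *v W)$2 - (M *v V)$2 * (M *v W)$1\<bar> = \<bar>det M\<bar> * \<bar>V$1 * W$2 - V$2 * W$1\<bar>"
    by (simp add: abs_mult)
  also have "\<dots> \<le> (\<epsilon> * (x * y)) * (V$1 * W$2 + V$2 * W$1)"
  proof (intro mult_mono)
    have "0 \<le> V$1 * W$2" "0 \<le> V$2 * W$1" using nn by auto
    then show "\<bar>V$1 * W$2 - V$2 * W$1\<bar> \<le> V$1 * W$2 + V$2 * W$1" by linarith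
  qed (use det nn \<epsilon> in \<open>auto simp: x_def y_def\<close>)
  also have "\<dots> \<le> \<epsilon> * (norm1 (M *v V) * norm1 (M *v W))"
  proof -
    have "norm1 (M *v V) * norm1 (M *v W) = x * y * (V$1 * W$2 + V$2 * W$1) + (x * x * (V$1 * W$1) + y * y * (V$2 * W$2))"
      by (simp add: norms algebra_simps)
    moreover have "0 \<le> x * x * (V$1 * W$1) + y * y * (V$2 * W$2)" using nn by simp
    ultimately have "x * y * (V$1 * W$2 + V$2 * W$1) \<le> norm1 (M *v V) * norm1 (M *v W)" by linarith
    from mult_left_mono[OF this \<epsilon>] show ?thesis by (simp add: mult.assoc)
  qed
  finally show ?thesis
    unfolding normalized_vec_diff[OF nonneg_mat_vec[OF M V(1)] nonneg_mat_vec[OF M W(1)] V(2) W(2)]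
    using pos by (simp add: divide_le_eq)
qed

lemma exp_cauchy_along_imp_convergent:
  fixes X :: "nat \<Rightarrow> real^'n"
  assumes r: "0 < r" "r < 1"
    and gap: "\<And>m n i. m \<in> N \<Longrightarrow> n \<in> N \<Longrightarrow> n0 \<le> n \<Longrightarrow> n \<le> m \<Longrightarrow> \<bar>X n $ i - X m $ i\<bar> \<le> C * r ^ n"
  shows "exp_convergent_along N X"
proof (cases "finite N")
  case True
  then obtain b where b: "\<forall>n\<in>N. n < b" using finite_nat_set_iff_bounded by blast
  show ?thesis by (rule exp_convergent_alongI[OF r, of N b _ 0 0]) (use b in force)
next
  case inf: False
  define e where "e = enumerate N"
  have e: "e k \<in> N" "k \<le> e k" for k
    using inf by (auto simp: e_def enumerate_in_set le_enumerate)
  have e_mono: "e k \<le> e l" if "k \<le> l" for k l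
    using inf that by (simp add: e_def enumerate_mono_le_iff)
  have "\<exists>l. (\<lambda>k. X (e k) $ i) \<longlonglongrightarrow> l" for i
  proof -
    have pw: "(\<lambda>n. \<bar>C\<bar> * r ^ n) \<longlonglongrightarrow> \<bar>C\<bar> * 0" using r by (intro tendsto_intros LIMSEQ_realpow_zero) auto
    have "Cauchy (\<lambda>k. X (e k) $ i)"
    proof (rule CauchyI')
      fix \<epsilon> :: real assume "0 < \<epsilon>"
      then have "eventually (\<lambda>n. \<bar>C\<bar> * r ^ n < \<epsilon>) sequentially"
        using order_tendstoD(2)[OF pw, of \<epsilon>] by simp
      then obtain K where K: "\<And>n. n \<ge> K \<Longrightarrow> \<bar>C\<bar> * r ^ n < \<epsilon>" by (auto simp: eventually_sequentially)
      have "norm (X (e k) $ i - X (e l) $ i) < \<epsilon>" if "max K n0 \<le> k" "k < l" for k l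
      proof -
        have "\<bar>X (e k) $ i - X (e l) $ i\<bar> \<le> C * r ^ e k"
          using that e[of k] by (intro gap e e_mono) auto
        also have "\<dots> \<le> \<bar>C\<bar> * r ^ e k" using r by (intro mult_right_mono) auto
        also have "\<dots> < \<epsilon>" using e(2)[of k] that by (intro K) auto
        finally show ?thesis by simp
      qed
      then show "\<exists>M. \<forall>m\<ge>M. \<forall>n>m. dist (X (e m) $ i) (X (e n) $ i) < \<epsilon>"
        by (intro exI[of _ "max K n0"]) (auto simp: dist_norm)
    qed
    then show ?thesis using Cauchy_convergent convergent_def by blast
  qed
  then obtain l where l: "\<And>i. (\<lambda>k. X (e k) $ i) \<longlonglongrightarrow> l i" by metis
  show ?thesis
  proof (rule exp_convergent_alongI[OF r, of N n0 _ "\<chi> i. l i" C])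
    fix n i assume n: "n \<in> N" "n0 \<le> n"
    have "(\<lambda>k. \<bar>X n $ i - X (e k) $ i\<bar>) \<longlonglongrightarrow> \<bar>X n $ i - l i\<bar>"
      by (intro tendsto_intros l)
    moreover have "\<bar>X n $ i - X (e k) $ i\<bar> \<le> C * r ^ n" if "k \<ge> n" for k
      using that e[of k] n by (intro gap) auto
    ultimately show "\<bar>X n $ i - (\<chi> i. l i) $ i\<bar> \<le> C * r ^ n"
      by (auto intro: LIMSEQ_le_const2)
  qed
qed

text \<open>
  At a later time \<open>m\<close> the vector \<open>P m *v V\<close> is \<open>P n\<close> applied to the nonnegative vector \<open>Q *v V\<close>, so its
  direction is as close to that of \<open>P n *v V\<close> as \<open>direction_gap_le\<close> says for the matrix \<open>P n\<close>.
\<close>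
lemma contracting_imp_directions_converge:
  assumes nn: "\<And>n. nonneg_mat (P n)"
    and factor: "\<And>m n. m \<le> n \<Longrightarrow> \<exists>Q. nonneg_mat Q \<and> P n = P m ** Q"
    and "contracting P"
  shows "directions_converge P"
proof -
  obtain C r n0 where r: "0 < r" "r < 1"
    and C: "\<And>n. n \<ge> n0 \<Longrightarrow> \<bar>det (P n)\<bar> \<le> C * r ^ n * (col_sum (P n) 1 * col_sum (P n) 2)"
    using assms(3) by (auto simp: contracting_def)
  show ?thesis
    unfolding directions_converge_def
  proof (intro allI impI)
    fix V :: "real^2" assume V: "nonneg_vec V"
    show "exp_convergent_along {n. P n *v V \<noteq> 0} (\<lambda>n. normalized_vec (P n *v V))"
    proof (rule exp_cauchy_along_imp_convergent[OF r, of _ n0 _ "\<bar>C\<bar>"])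
      fix m n i assume mn: "m \<in> {n. P n *v V \<noteq> 0}" "n \<in> {n. P n *v V \<noteq> 0}" "n0 \<le> n" "n \<le> m"
      obtain Q where Q: "nonneg_mat Q" "P m = P n ** Q" using factor[OF mn(4)] by blast
      then have PQ: "P m *v V = P n *v (Q *v V)" by (simp add: matrix_vector_mul_assoc)
      have "\<bar>det (P n)\<bar> \<le> \<bar>C\<bar> * r ^ n * (col_sum (P n) 1 * col_sum (P n) 2)"
        using r by (intro order_trans[OF C[OF mn(3)]] mult_right_mono mult_nonneg_nonneg col_sum_nonneg nn) auto
      then show "\<bar>normalized_vec (P n *v V) $ i - normalized_vec (P m *v V) $ i\<bar> \<le> \<bar>C\<bar> * r ^ n"
        unfolding PQ using mn r by (intro direction_gap_le nn V nonneg_mat_vec Q) (auto simp: PQ)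
    qed
  qed
qed

lemma root_tendsto_exp:
  fixes u :: "nat \<Rightarrow> real"
  assumes "\<And>n. 0 < u n" and "(\<lambda>n. ln (u n) / real n) \<longlonglongrightarrow> \<gamma>"
  shows "(\<lambda>n. root n (u n)) \<longlonglongrightarrow> exp \<gamma>"
proof -
  have "(\<lambda>n. exp (ln (u n) / real n)) \<longlonglongrightarrow> exp \<gamma>" by (intro tendsto_intros assms)
  then show ?thesis
  proof (rule Lim_transform_eventually)
    show "eventually (\<lambda>n. exp (ln (u n) / real n) = root n (u n)) sequentially"
      using eventually_gt_at_top[of 0]
    proof eventually_elim
      case (elim n)
      show ?case using elim assms(1)[of n]
        by (simp add: root_powr_inverse powr_def field_simps)
    qed
  qed
qed

lemma ln_rate_cong:
  fixes u v :: "nat \<Rightarrow> real"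
  assumes "\<And>n. \<bar>ln (u n) - ln (v n)\<bar> \<le> K" and "(\<lambda>n. ln (v n) / real n) \<longlonglongrightarrow> \<gamma>"
  shows "(\<lambda>n. ln (u n) / real n) \<longlonglongrightarrow> \<gamma>"
proof -
  have "(\<lambda>n. (ln (u n) - ln (v n)) / real n) \<longlonglongrightarrow> 0"
  proof (rule Lim_null_comparison)
    show "eventually (\<lambda>n. norm ((ln (u n) - ln (v n)) / real n) \<le> K / real n) sequentially"
      using assms(1) by (intro always_eventually allI) (simp add: divide_right_mono)
    show "(\<lambda>n. K / real n) \<longlonglongrightarrow> 0" by (rule lim_const_over_n)
  qed
  from tendsto_add[OF this assms(2)] show ?thesis by (simp add: diff_divide_distrib)
qed

section \<open>Growth rates of random products\<close>

locale random_matrix_product = bernoulli s p for s :: nat and p :: "nat \<Rightarrow> real" +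
  fixes A :: "nat \<Rightarrow> real^2^2"
  assumes nonneg: "\<And>k i j. k < s \<Longrightarrow> 0 \<le> A k $ i $ j"
    and nonzero: "AE \<omega> in bernoulli_measure s p. \<forall>n. rand_prod A \<omega> n \<noteq> 0"
begin

abbreviation "P \<equiv> rand_prod A"

lemma rand_prod_prefix: "(\<And>i. i < n \<Longrightarrow> \<omega> i = \<omega>' i) \<Longrightarrow> P \<omega> n = P \<omega>' n"
  by (induction n) auto

lemma A_nonneg: "k < s \<Longrightarrow> nonneg_mat (A k)"
  using nonneg by (simp add: nonneg_mat_def)

lemma P_nonneg: "\<omega> \<in> space \<B> \<Longrightarrow> nonneg_mat (P \<omega> n)"
  by (intro rand_prod_nonneg A_nonneg letter_less)

lemma P_nonzero:
  assumes "\<omega> \<in> space \<B>" shows "P \<omega> n \<noteq> 0"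
proof -
  obtain \<omega>' where "\<forall>n. P \<omega>' n \<noteq> 0" "\<forall>i<n. \<omega>' i = \<omega> i"
    using AE_prefix[OF nonzero assms, of n] by blast
  then show ?thesis using rand_prod_prefix[of n \<omega>' \<omega>] by metis
qed

lemma P_entry_sum_pos: "\<omega> \<in> space \<B> \<Longrightarrow> 0 < entry_sum (P \<omega> n)"
  by (intro entry_sum_pos P_nonneg P_nonzero)

lemma P_sing_val1_pos: "\<omega> \<in> space \<B> \<Longrightarrow> 0 < sing_val1 (P \<omega> n)"
  using P_entry_sum_pos[of \<omega> n] entry_sum_sing_val1(1)[OF P_nonneg, of \<omega> n] by linarith

lemma P_factor:
  assumes "\<omega> \<in> space \<B>" "m \<le> n"
  shows "\<exists>Q. nonneg_mat Q \<and> P \<omega> n = P \<omega> m ** Q"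
proof (intro exI conjI)
  show "P \<omega> n = P \<omega> m ** P (\<lambda>i. \<omega> (i + m)) (n - m)"
    using rand_prod_add[of A \<omega> m "n - m"] assms(2) by simp
  show "nonneg_mat (P (\<lambda>i. \<omega> (i + m)) (n - m))"
    by (intro rand_prod_nonneg A_nonneg letter_less assms)
qed

lemma P_directions:
  "\<omega> \<in> space \<B> \<Longrightarrow> contracting (P \<omega>) \<Longrightarrow> directions_converge (P \<omega>)"
  by (intro contracting_imp_directions_converge P_nonneg P_factor)

lemma shift_space: "\<omega> \<in> space \<B> \<Longrightarrow> (\<lambda>i. \<omega> (i + m)) \<in> space \<B>"
  using funpow_T_space[of \<omega> m] by (simp add: funpow_shift)

lemma borel_P:
  "(\<lambda>\<omega>. f (P \<omega> n) :: real) \<in> borel_measurable \<B>"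
  by (rule measurable_finite_coordinates[of n]) (simp_all, metis rand_prod_prefix)

lemma positive_entries_bound:
  obtains a where "0 < a" "a \<le> 1"
    and "\<And>k i j. k < s \<Longrightarrow> 0 < A k $ i $ j \<Longrightarrow> a \<le> A k $ i $ j"
proof
  define E where "E = {A k $ i $ j | k i j. k < s \<and> 0 < A k $ i $ j}"
  have "E \<subseteq> (\<Union>k<s. \<Union>i. range (\<lambda>j. A k $ i $ j))" by (auto simp: E_def)
  then have fin: "finite (insert 1 E)" using finite_subset by fastforce
  show "0 < Min (insert 1 E)" "Min (insert 1 E) \<le> 1" using fin by (auto simp: E_def)
  show "Min (insert 1 E) \<le> A k $ i $ j" if "k < s" "0 < A k $ i $ j" for k i j
    using fin that by (intro Min_le) (auto simp: E_def)
qed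

text \<open>
  A nonzero entry of a product of \<open>n\<close> letters is at least one of its summands, that is, a product of \<open>n\<close>
  positive entries of the letters. Hence the norm decays at most exponentially, with no exceptional set.
\<close>
lemma P_growth_bounds:
  obtains a K where "0 < a" "a \<le> 1" "1 \<le> K"
    and "\<And>\<omega> n. \<omega> \<in> space \<B> \<Longrightarrow> a ^ n \<le> entry_sum (P \<omega> n)"
    and "\<And>\<omega> n. \<omega> \<in> space \<B> \<Longrightarrow> entry_sum (P \<omega> n) \<le> 2 * K ^ n"
proof -
  obtain a where a: "0 < a" "a \<le> 1"
    and entry: "\<And>k i j. k < s \<Longrightarrow> 0 < A k $ i $ j \<Longrightarrow> a \<le> A k $ i $ j"
    using positive_entries_bound by blast
  define K where "K = 1 + (\<Sum>k<s. entry_sum (A k))"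
  have K: "1 \<le> K" "entry_sum (A k) \<le> K" if "k < s" for k
  proof -
    have "entry_sum (A k) \<le> (\<Sum>k<s. entry_sum (A k))"
      using that by (intro member_le_sum) (auto intro: entry_sum_nonneg A_nonneg)
    then show "1 \<le> K" "entry_sum (A k) \<le> K"
      using entry_sum_nonneg[OF A_nonneg[OF that]] by (auto simp: K_def)
  qed
  have K1: "1 \<le> K" unfolding K_def by (auto intro!: sum_nonneg entry_sum_nonneg A_nonneg)
  have low: "P \<omega> n $ i $ j = 0 \<or> a ^ n \<le> P \<omega> n $ i $ j" if "\<omega> \<in> space \<B>" for \<omega> n i j
  proof (induction n arbitrary: j)
    case 0
    then show ?case by (simp add: mat_def)
  next
    case (Suc n)
    note less = letter_less[OF that, of n]
    have nn: "0 \<le> P \<omega> n $ i $ k * A (\<omega> n) $ k $ j" for k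
      using P_nonneg[OF that] nonneg[OF less] by (simp add: nonneg_mat_def)
    have eq: "P \<omega> (Suc n) $ i $ j = (\<Sum>k\<in>UNIV. P \<omega> n $ i $ k * A (\<omega> n) $ k $ j)"
      by (simp add: matrix_matrix_mult_def)
    show ?case
    proof (cases "\<exists>k. P \<omega> n $ i $ k * A (\<omega> n) $ k $ j \<noteq> 0")
      case True
      then obtain k where k: "P \<omega> n $ i $ k \<noteq> 0" "A (\<omega> n) $ k $ j \<noteq> 0" by auto
      have "a ^ Suc n \<le> P \<omega> n $ i $ k * A (\<omega> n) $ k $ j"
        using mult_mono[of "a ^ n" "P \<omega> n $ i $ k" a "A (\<omega> n) $ k $ j"]
          Suc[of k] k entry[OF less, of k j] nonneg[OF less, of k j] a P_nonneg[OF that]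
        by (simp add: less_le mult.commute nonneg_mat_def)
      also have "\<dots> \<le> P \<omega> (Suc n) $ i $ j" unfolding eq by (rule member_le_sum) (use nn in auto)
      finally show ?thesis by simp
    next
      case False
      then show ?thesis unfolding eq by (auto intro!: sum.neutral)
    qed
  qed
  have lower: "a ^ n \<le> entry_sum (P \<omega> n)" if \<omega>: "\<omega> \<in> space \<B>" for \<omega> n
  proof -
    obtain i j where "P \<omega> n $ i $ j \<noteq> 0" using P_nonzero[OF \<omega>, of n] by (auto simp: vec_eq_iff)
    then have "a ^ n \<le> P \<omega> n $ i $ j" using low[OF \<omega>, of n i j] by simp
    then show ?thesis using entry_le_entry_sum[OF P_nonneg[OF \<omega>], of n i j] by linarith
  qed
  have upper: "entry_sum (P \<omega> n) \<le> 2 * K ^ n" if \<omega>: "\<omega> \<in> space \<B>" for \<omega> n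
  proof (induction n)
    case 0
    then show ?case by (simp add: entry_sum_def col_sum_def mat_def)
  next
    case (Suc n)
    note less = letter_less[OF \<omega>, of n]
    have "entry_sum (P \<omega> (Suc n)) \<le> entry_sum (P \<omega> n) * entry_sum (A (\<omega> n))"
      by (simp add: entry_sum_mult_le P_nonneg \<omega> A_nonneg less)
    also have "\<dots> \<le> (2 * K ^ n) * K"
      using Suc K1 by (intro mult_mono K(2) less) (auto intro: entry_sum_nonneg A_nonneg less)
    finally show ?case by (simp add: mult_ac)
  qed
  show ?thesis using that[OF a K1 lower upper] by blast
qed

lemma ln_entry_sum_cocycle: "\<exists>C. cocycle C (\<lambda>n \<omega>. ln (entry_sum (P \<omega> n)))"
proof -
  obtain a K where a: "0 < a" "a \<le> 1" and K: "1 \<le> K"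
    and low: "\<And>\<omega> n. \<omega> \<in> space \<B> \<Longrightarrow> a ^ n \<le> entry_sum (P \<omega> n)"
    and up: "\<And>\<omega> n. \<omega> \<in> space \<B> \<Longrightarrow> entry_sum (P \<omega> n) \<le> 2 * K ^ n"
    using P_growth_bounds by blast
  define C where "C = ln 2 + ln K - ln a"
  have la: "ln a \<le> 0" and lK: "0 \<le> ln K" and l2: "0 < ln (2 :: real)" using a K by auto
  have "cocycle C (\<lambda>n \<omega>. ln (entry_sum (P \<omega> n)))"
    unfolding cocycle_def
  proof (intro conjI allI ballI)
    show "(\<lambda>\<omega>. ln (entry_sum (P \<omega> n))) \<in> borel_measurable \<B>" for n
      by (rule borel_P[of "\<lambda>M. ln (entry_sum M)"])
  next
    fix n \<omega> assume \<omega>: "\<omega> \<in> space \<B>"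
    have "real n * ln a = ln (a ^ n)" using a by (simp add: ln_realpow)
    also have "\<dots> \<le> ln (entry_sum (P \<omega> n))" using a low[OF \<omega>, of n] P_entry_sum_pos[OF \<omega>, of n] by simp
    finally have l: "real n * ln a \<le> ln (entry_sum (P \<omega> n))" .
    have "ln (entry_sum (P \<omega> n)) \<le> ln (2 * K ^ n)" using K up[OF \<omega>, of n] P_entry_sum_pos[OF \<omega>, of n] by simp
    also have "\<dots> = ln 2 + real n * ln K" using K by (simp add: ln_mult ln_realpow)
    finally have u: "ln (entry_sum (P \<omega> n)) \<le> ln 2 + real n * ln K" .
    have "C * (real n + 1) = real n * ln 2 + real n * ln K - real n * ln a + C"
      by (simp add: C_def algebra_simps)
    moreover have "0 \<le> real n * ln 2" "0 \<le> real n * ln K" "real n * ln a \<le> 0"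
      using la lK by (auto simp: mult_nonneg_nonpos)
    moreover have "ln 2 \<le> C" "0 \<le> C" using la lK l2 unfolding C_def by linarith+
    ultimately show "\<bar>ln (entry_sum (P \<omega> n))\<bar> \<le> C * (real n + 1)" using l u by linarith
  next
    fix m n \<omega> assume \<omega>: "\<omega> \<in> space \<B>"
    note \<omega>' = shift_space[OF \<omega>, of m]
    have "entry_sum (P \<omega> (m + n)) \<le> entry_sum (P \<omega> m) * entry_sum (P (\<lambda>i. \<omega> (i + m)) n)"
      unfolding rand_prod_add by (intro entry_sum_mult_le P_nonneg \<omega> \<omega>')
    then have "ln (entry_sum (P \<omega> (m + n))) \<le> ln (entry_sum (P \<omega> m) * entry_sum (P (\<lambda>i. \<omega> (i + m)) n))"
      using P_entry_sum_pos[OF \<omega>] P_entry_sum_pos[OF \<omega>'] by simp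
    then show "ln (entry_sum (P \<omega> (m + n))) \<le> ln (entry_sum (P \<omega> m)) + ln (entry_sum (P ((shift ^^ m) \<omega>) n))"
      using P_entry_sum_pos[OF \<omega>, of m] P_entry_sum_pos[OF \<omega>', of n] by (simp add: ln_mult funpow_shift)
  qed
  then show ?thesis by blast
qed

lemma top_exponent_exists:
  "\<exists>\<gamma> C. (\<forall>n. real n * \<gamma> \<le> (\<integral>\<omega>. ln (entry_sum (P \<omega> n)) \<partial>\<B>) + C) \<and>
        (AE \<omega> in \<B>. (\<lambda>n. ln (entry_sum (P \<omega> n)) / real n) \<longlonglongrightarrow> \<gamma>)"
  using ln_entry_sum_cocycle subadditive_ergodic by blast

text \<open>
  The limit is determined by the second property. The first one, that the limit is also a lower
  bound for the mean growth, serves to bound the limit from above by estimating expectations.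
\<close>
definition top_exponent :: real where
  "top_exponent = (SOME \<gamma>. \<exists>C. (\<forall>n. real n * \<gamma> \<le> (\<integral>\<omega>. ln (entry_sum (P \<omega> n)) \<partial>\<B>) + C) \<and>
        (AE \<omega> in \<B>. (\<lambda>n. ln (entry_sum (P \<omega> n)) / real n) \<longlonglongrightarrow> \<gamma>))"

lemma top_exponent_le_mean:
    "\<exists>C. \<forall>n. real n * top_exponent \<le> (\<integral>\<omega>. ln (entry_sum (P \<omega> n)) \<partial>\<B>) + C"
  and top_exponent_limit:
    "AE \<omega> in \<B>. (\<lambda>n. ln (entry_sum (P \<omega> n)) / real n) \<longlonglongrightarrow> top_exponent"
proof -
  have "\<exists>C. (\<forall>n. real n * top_exponent \<le> (\<integral>\<omega>. ln (entry_sum (P \<omega> n)) \<partial>\<B>) + C) \<and>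
        (AE \<omega> in \<B>. (\<lambda>n. ln (entry_sum (P \<omega> n)) / real n) \<longlonglongrightarrow> top_exponent)"
    unfolding top_exponent_def by (rule someI_ex) (rule top_exponent_exists)
  then show "\<exists>C. \<forall>n. real n * top_exponent \<le> (\<integral>\<omega>. ln (entry_sum (P \<omega> n)) \<partial>\<B>) + C"
    "AE \<omega> in \<B>. (\<lambda>n. ln (entry_sum (P \<omega> n)) / real n) \<longlonglongrightarrow> top_exponent" by auto
qed

lemma sing_val1_rate:
  "AE \<omega> in \<B>. (\<lambda>n. root n (sing_val1 (P \<omega> n))) \<longlonglongrightarrow> exp top_exponent"
  using top_exponent_limit AE_space
proof eventually_elim
  case (elim \<omega>)
  note pos = P_sing_val1_pos[OF elim(2)] P_entry_sum_pos[OF elim(2)]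
  have ln_diff: "\<bar>ln (sing_val1 (P \<omega> n)) - ln (entry_sum (P \<omega> n))\<bar> \<le> ln 3" for n
  proof -
    have "ln (entry_sum (P \<omega> n)) \<le> ln (3 * sing_val1 (P \<omega> n))"
      using entry_sum_sing_val1(1)[OF P_nonneg[OF elim(2)], of n] pos[of n] by simp
    moreover have "ln (sing_val1 (P \<omega> n)) \<le> ln (entry_sum (P \<omega> n))"
      using entry_sum_sing_val1(2)[OF P_nonneg[OF elim(2)], of n] pos[of n] by simp
    ultimately show ?thesis using pos[of n] by (simp add: ln_mult)
  qed
  show ?case by (rule root_tendsto_exp[OF pos(1) ln_rate_cong[OF ln_diff elim(1)]])
qed

lemma letters_infinitely_often:
  "AE \<omega> in \<B>. \<forall>k<s. \<exists>\<^sub>F n in sequentially. \<omega> n = k"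
proof -
  have "AE \<omega> in \<B>. k < s \<longrightarrow> (\<exists>\<^sub>F n in sequentially. \<omega> n = k)" for k
  proof (cases "k < s")
    case True
    show ?thesis
      using letter_frequency[OF True]
    proof eventually_elim
      case (elim \<omega>)
      show ?case
      proof (rule impI, rule ccontr)
        assume "\<not> (\<exists>\<^sub>F n in sequentially. \<omega> n = k)"
        then obtain N where N: "\<And>n. n \<ge> N \<Longrightarrow> \<omega> n \<noteq> k"
          by (auto simp: frequently_def eventually_sequentially)
        have "(\<Sum>i<n. of_bool (\<omega> i = k)) \<le> real N" for n
        proof -
          have "(\<Sum>i<n. of_bool (\<omega> i = k) :: real) \<le> (\<Sum>i<n. of_bool (i < N))"
            by (intro sum_mono) (use N in \<open>auto simp: not_less[symmetric]\<close>)
          also have "\<dots> = real (card ({..<n} \<inter> {i. i < N}))" by simp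
          also have "\<dots> \<le> real (card {..<N})"
            by (intro of_nat_mono card_mono) auto
          finally show ?thesis by simp
        qed
        then have "(\<lambda>n. (\<Sum>i<n. of_bool (\<omega> i = k)) / real n) \<longlonglongrightarrow> 0"
          by (intro Lim_null_comparison[OF _ lim_const_over_n[of "real N"]])
             (auto intro!: always_eventually divide_right_mono simp: abs_of_nonneg sum_nonneg)
        then show False using elim p_pos[OF True] LIMSEQ_unique by fastforce
      qed
    qed
  qed simp
  then show ?thesis by (simp add: AE_all_countable)
qed

theorem normalized_diverges:
  assumes "\<not> common_left_eigenvector s A"
  shows "AE \<omega> in \<B>. \<not> convergent (\<lambda>n. normalized_mat (P \<omega> n))"
  using letters_infinitely_often AE_space
  by eventually_elim (use assms convergent_normalized_imp_eigenvector P_nonzero in blast)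

text \<open>
  Once a singular letter has occurred, the determinant and the smaller singular value stay 0, whereas
  the larger one has the positive rate \<open>exp top_exponent\<close>.
\<close>
lemma singular_letter:
  assumes "k < s" "det (A k) = 0"
  shows "AE \<omega> in \<B>. directions_converge (P \<omega>) \<and> distinct_singular_growth (P \<omega>)"
  using letters_infinitely_often sing_val1_rate AE_space
proof eventually_elim
  case (elim \<omega>)
  obtain N where N: "\<omega> N = k" using elim(1) assms(1) by (meson frequently_ex)
  have det0: "det (P \<omega> n) = 0" if n: "n > N" for n
  proof -
    obtain Q where "P \<omega> n = P \<omega> (Suc N) ** Q" using P_factor[OF elim(3) Suc_leI[OF n]] by blast
    then show ?thesis using N assms(2) by (simp add: det_mul)
  qed
  have "contracting (P \<omega>)"
    unfolding contracting_def
    by (rule exI[of _ 0], rule exI[of _ "1/2"], rule exI[of _ "Suc N"]) (auto simp: det0)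
  moreover have "(\<lambda>n. root n (sing_val2 (P \<omega> n))) \<longlonglongrightarrow> 0"
  proof (rule Lim_transform_eventually[OF tendsto_const])
    show "eventually (\<lambda>n. 0 = root n (sing_val2 (P \<omega> n))) sequentially"
      using eventually_gt_at_top[of N]
    proof eventually_elim
      case (elim n)
      then show ?case using sing_val_prod[of "P \<omega> n"] det0[of n] P_sing_val1_pos[OF \<open>\<omega> \<in> space \<B>\<close>, of n] by simp
    qed
  qed
  ultimately show ?case
    using P_directions[OF elim(3)] elim(2) unfolding distinct_singular_growth_def
    by (metis exp_not_eq_zero)
qed

end

locale invertible_matrix_product = random_matrix_product +
  assumes det_nonzero: "\<And>k. k < s \<Longrightarrow> det (A k) \<noteq> 0"
begin

definition det_exponent :: real where
  "det_exponent = mean (\<lambda>k. ln \<bar>det (A k)\<bar>)"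

lemma P_det_nonzero:
  assumes "\<omega> \<in> space \<B>" shows "det (P \<omega> n) \<noteq> 0"
  by (induction n) (auto simp: det_mul det_nonzero letter_less[OF assms])

lemma ln_det_P:
  assumes "\<omega> \<in> space \<B>"
  shows "ln \<bar>det (P \<omega> n)\<bar> = (\<Sum>i<n. ln \<bar>det (A (\<omega> i))\<bar>)"
proof (induction n)
  case (Suc n)
  then show ?case using P_det_nonzero[OF assms, of n] det_nonzero[OF letter_less[OF assms, of n]]
    by (simp add: det_mul abs_mult ln_mult)
qed simp

lemma det_rate:
  "AE \<omega> in \<B>. (\<lambda>n. ln \<bar>det (P \<omega> n)\<bar> / real n) \<longlonglongrightarrow> det_exponent"
  using law_of_large_numbers[of "\<lambda>k. ln \<bar>det (A k)\<bar>"] AE_space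
  by eventually_elim (simp add: ln_det_P det_exponent_def)

lemma sing_val2_rate:
  "AE \<omega> in \<B>. (\<lambda>n. root n (sing_val2 (P \<omega> n))) \<longlonglongrightarrow> exp (det_exponent - top_exponent)"
  using sing_val1_rate det_rate AE_space
proof eventually_elim
  case (elim \<omega>)
  have eq: "sing_val2 (P \<omega> n) = \<bar>det (P \<omega> n)\<bar> / sing_val1 (P \<omega> n)" for n
    using sing_val_prod[of "P \<omega> n"] P_sing_val1_pos[OF elim(3), of n] by (simp add: field_simps)
  have "(\<lambda>n. root n \<bar>det (P \<omega> n)\<bar>) \<longlonglongrightarrow> exp det_exponent"
    using elim P_det_nonzero[OF elim(3)] by (intro root_tendsto_exp) auto
  from tendsto_divide[OF this elim(1)] have "(\<lambda>n. root n \<bar>det (P \<omega> n)\<bar> / root n (sing_val1 (P \<omega> n))) \<longlonglongrightarrow> exp (det_exponent - top_exponent)"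
    by (simp add: exp_diff)
  then show ?case
    by (rule Lim_transform_eventually)
       (use eventually_gt_at_top[of 0] in eventually_elim, simp add: eq real_root_divide)
qed

lemma distinct_iff:
  "AE \<omega> in \<B>. distinct_singular_growth (P \<omega>) \<longleftrightarrow> det_exponent \<noteq> 2 * top_exponent"
  using sing_val1_rate sing_val2_rate
proof eventually_elim
  case (elim \<omega>)
  have "distinct_singular_growth (P \<omega>) \<longleftrightarrow> exp top_exponent \<noteq> exp (det_exponent - top_exponent)"
    unfolding distinct_singular_growth_def
    using elim LIMSEQ_unique[OF elim(1)] LIMSEQ_unique[OF elim(2)] by blast
  then show ?case by auto
qed

lemma det_exponent_le: "det_exponent \<le> 2 * top_exponent"
proof -
  have "AE \<omega> in \<B>. exp (det_exponent - top_exponent) \<le> exp top_exponent"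
    using sing_val1_rate sing_val2_rate
  proof eventually_elim
    case (elim \<omega>)
    show ?case
      by (rule LIMSEQ_le[OF elim(2,1)])
         (intro exI[of _ 1] allI impI real_root_le_mono, auto simp: sing_val2_le_sing_val1)
  qed
  then show ?thesis by simp
qed

text \<open>Contraction bounds \<open>\<bar>det (P \<omega> n)\<bar>\<close> by \<open>C * r ^ n\<close> times the square of the norm; compare the rates.\<close>
lemma contracting_strict:
  assumes "AE \<omega> in \<B>. contracting (P \<omega>)"
  shows "det_exponent < 2 * top_exponent"
proof -
  have "AE \<omega> in \<B>. det_exponent < 2 * top_exponent"
    using assms det_rate top_exponent_limit AE_space
  proof eventually_elim
    case (elim \<omega>)
    obtain C r N where r: "0 < r" "r < 1"
      and C: "\<And>n. n \<ge> N \<Longrightarrow> \<bar>det (P \<omega> n)\<bar> \<le> C * r ^ n * (col_sum (P \<omega> n) 1 * col_sum (P \<omega> n) 2)"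
      using elim(1) by (auto simp: contracting_def)
    \<comment> \<open>positive, so that its logarithm is meaningful\<close>
    define C' where "C' = \<bar>C\<bar> + 1"
    have bound: "ln \<bar>det (P \<omega> n)\<bar> / real n \<le> ln C' / real n + ln r + 2 * (ln (entry_sum (P \<omega> n)) / real n)" if n: "n \<ge> Suc N" for n
    proof -
      note nn = P_nonneg[OF elim(4), of n] and pos = P_entry_sum_pos[OF elim(4), of n]
      have "\<bar>det (P \<omega> n)\<bar> \<le> C * r ^ n * (col_sum (P \<omega> n) 1 * col_sum (P \<omega> n) 2)" using C n by simp
      also have "\<dots> \<le> C' * r ^ n * (entry_sum (P \<omega> n) * entry_sum (P \<omega> n))"
        using r pos by (intro mult_mono col_sum_le_entry_sum nn mult_nonneg_nonneg col_sum_nonneg) (auto simp: C'_def)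
      finally have "ln \<bar>det (P \<omega> n)\<bar> \<le> ln (C' * r ^ n * (entry_sum (P \<omega> n) * entry_sum (P \<omega> n)))"
        using P_det_nonzero[OF elim(4), of n] by (intro ln_mono) auto
      also have "\<dots> = ln C' + real n * ln r + 2 * ln (entry_sum (P \<omega> n))"
        using r pos by (subst ln_mult, simp add: C'_def, simp, subst ln_mult) (auto simp: C'_def ln_mult ln_realpow)
      finally have "ln \<bar>det (P \<omega> n)\<bar> / real n \<le> (ln C' + real n * ln r + 2 * ln (entry_sum (P \<omega> n))) / real n"
        by (rule divide_right_mono) simp
      then show ?thesis using n by (simp add: add_divide_distrib)
    qed
    have "(\<lambda>n. ln C' / real n + ln r + 2 * (ln (entry_sum (P \<omega> n)) / real n)) \<longlonglongrightarrow> 0 + ln r + 2 * top_exponent"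
      by (intro tendsto_intros elim lim_const_over_n)
    then have "det_exponent \<le> 0 + ln r + 2 * top_exponent"
      using bound by (intro LIMSEQ_le[OF elim(2)]) auto
    then show ?case using ln_less_zero[OF r] by simp
  qed
  then show ?thesis by simp
qed

lemma contracting_strong:
  assumes "AE \<omega> in \<B>. contracting (P \<omega>)"
  shows "AE \<omega> in \<B>. directions_converge (P \<omega>) \<and> distinct_singular_growth (P \<omega>)"
  using assms distinct_iff AE_space
  by eventually_elim (use P_directions contracting_strict[OF assms] in auto)

end

section \<open>A strictly positive word forces contraction\<close>

text \<open>The permanent of a two-by-two matrix.\<close>
definition perm2 :: "real^2^2 \<Rightarrow> real" where
  "perm2 M = M$1$1 * M$2$2 + M$1$2 * M$2$1"

definition shrink :: "real^2^2 \<Rightarrow> real" where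
  "shrink M = \<bar>det M\<bar> / perm2 M"

definition column_gap :: "real^2^2 \<Rightarrow> real" where
  "column_gap M = \<bar>det M\<bar> / (col_sum M 1 * col_sum M 2)"

lemma perm2_pos:
  assumes "nonneg_mat M" "det M \<noteq> 0" shows "0 < perm2 M" and "\<bar>det M\<bar> \<le> perm2 M"
proof -
  have "0 \<le> M$1$1 * M$2$2" "0 \<le> M$1$2 * M$2$1" using assms(1) by (auto simp: nonneg_mat_def)
  then show "\<bar>det M\<bar> \<le> perm2 M" unfolding perm2_def det_2 by linarith
  then show "0 < perm2 M" using assms(2) by linarith
qed

lemma shrink_bounds:
  assumes "nonneg_mat M" "det M \<noteq> 0" shows "0 < shrink M" "shrink M \<le> 1"
  using perm2_pos[OF assms] assms(2) by (auto simp: shrink_def)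

lemma shrink_less_1:
  assumes "\<And>i j. 0 < M$i$j" shows "shrink M < 1"
proof -
  have "0 < M$1$1 * M$2$2" "0 < M$1$2 * M$2$1" using assms by auto
  then have "\<bar>det M\<bar> < perm2 M" "0 < perm2 M" unfolding perm2_def det_2 by linarith+
  then show ?thesis by (simp add: shrink_def)
qed

lemma col_sum_pos:
  fixes M :: "real^2^2"
  assumes "nonneg_mat M" "det M \<noteq> 0" shows "0 < col_sum M j"
proof (rule ccontr)
  assume "\<not> ?thesis"
  then have "M$1$j + M$2$j = 0" using col_sum_nonneg[OF assms(1), of j] by (simp add: col_sum_def sum_2)
  moreover have "0 \<le> M$1$j" "0 \<le> M$2$j" using assms(1) by (auto simp: nonneg_mat_def)
  ultimately have "M$1$j = 0" "M$2$j = 0" by auto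
  then show False using assms(2) exhaust_2[of j] by (auto simp: det_2)
qed

lemma column_gap_pos: "nonneg_mat M \<Longrightarrow> det M \<noteq> 0 \<Longrightarrow> 0 < column_gap M"
  by (simp add: column_gap_def col_sum_pos)

text \<open>
  With the column sums \<open>x, y\<close> of \<open>M\<close>, the product of the column sums of \<open>M ** N\<close> is \<open>x * y * perm2 N\<close> plus
  nonnegative terms. So a letter never increases the gap, and a positive one decreases it by a factor.
\<close>
lemma column_gap_mult:
  assumes M: "nonneg_mat M" "det M \<noteq> 0" and N: "nonneg_mat N" "det N \<noteq> 0"
  shows "column_gap (M ** N) \<le> column_gap M * shrink N"
proof -
  let ?x = "col_sum M 1" and ?y = "col_sum M 2"
  note xy = col_sum_pos[OF M, of 1] col_sum_pos[OF M, of 2]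
  have nn: "0 \<le> N$i$j" for i j using N(1) by (simp add: nonneg_mat_def)
  have "col_sum (M ** N) 1 * col_sum (M ** N) 2
      = ?x * ?y * perm2 N + (?x * ?x * (N$1$1 * N$1$2) + ?y * ?y * (N$2$1 * N$2$2))"
    by (simp add: col_sum_mult sum_2 perm2_def algebra_simps)
  moreover have "0 \<le> ?x * ?x * (N$1$1 * N$1$2) + ?y * ?y * (N$2$1 * N$2$2)"
    using nn xy by simp
  ultimately have "?x * ?y * perm2 N \<le> col_sum (M ** N) 1 * col_sum (M ** N) 2" by linarith
  then have "\<bar>det M\<bar> * \<bar>det N\<bar> / (col_sum (M ** N) 1 * col_sum (M ** N) 2) \<le> \<bar>det M\<bar> * \<bar>det N\<bar> / (?x * ?y * perm2 N)"
    using xy perm2_pos[OF N] by (intro divide_left_mono) (auto intro!: mult_pos_pos col_sum_pos nonneg_mat_mult M N simp: det_mul M N)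
  then show ?thesis by (simp add: column_gap_def shrink_def det_mul abs_mult)
qed

lemma sum_lag:
  fixes u :: "nat \<Rightarrow> real"
  shows "(\<Sum>i<n. u (i + l) - u i) = (\<Sum>j<l. u (n + j)) - (\<Sum>j<l. u j)"
proof (induction n)
  case (Suc n)
  have "(\<Sum>j<l. u (Suc n + j)) + u n = (\<Sum>j<Suc l. u (n + j))"
    by (subst sum.lessThan_Suc_shift) simp
  then show ?case using Suc by (simp add: add.commute)
qed simp

lemma exp_convergent_columnD:
  assumes "normalized_columns_exp_convergent P" "\<And>n. column j (P n) \<noteq> 0"
  shows "exp_convergent_along UNIV (\<lambda>n. normalized_vec (column j (P n)))"
proof -
  have "exp_convergent_along {n. column j (P n) \<noteq> 0} (\<lambda>n. normalized_vec (column j (P n)))"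
    using assms(1) unfolding normalized_columns_exp_convergent_def by (rule spec)
  moreover have "{n. column j (P n) \<noteq> 0} = UNIV" using assms(2) by auto
  ultimately show ?thesis by simp
qed

context invertible_matrix_product
begin

text \<open>
  The logarithm \<open>u\<close> of the column gap never increases, and drops by at least \<open>\<beta>\<close> between \<open>i\<close> and \<open>i + l\<close>
  whenever the word, of length \<open>l\<close>, is read at position \<open>i\<close>. Occurrences may overlap; summing the
  differences \<open>u (i + l) - u i\<close> over all \<open>i < n\<close> counts each drop at most \<open>l\<close> times. As the occurrences have a
  positive frequency, \<open>u\<close> decreases linearly.
\<close>
lemma positive_word_contracting:
  assumes w: "set w \<subseteq> {..<s}" and pos: "\<And>i j. 0 < P (\<lambda>i. w ! i) (length w) $ i $ j"
  shows "AE \<omega> in \<B>. contracting (P \<omega>)"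
  using word_frequency[OF w] AE_space
proof eventually_elim
  case (elim \<omega>)
  note \<omega> = elim(2)
  define l where "l = length w"
  define B where "B = P (\<lambda>i. w ! i) l"
  define q where "q = (\<Prod>k\<leftarrow>w. p k)"
  define \<beta> where "\<beta> = - ln (shrink B)"
  define occ where "occ n = (\<Sum>i<n. of_bool (starts_with w (\<lambda>j. \<omega> (j + i))) :: real)" for n
  define u where "u n = ln (column_gap (P \<omega> n))" for n
  have l: "0 < l"
  proof (rule ccontr)
    assume "\<not> 0 < l"
    then show False using pos[of 1 2] by (simp add: l_def mat_def)
  qed
  have q: "0 < q" unfolding q_def by (rule word_probability_pos[OF w])
  note nn = P_nonneg[OF \<omega>] and det = P_det_nonzero[OF \<omega>]
  note nn' = P_nonneg[OF shift_space[OF \<omega>]] and det' = P_det_nonzero[OF shift_space[OF \<omega>]]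
  have u_step: "u (i + m) \<le> u i + ln (shrink (P (\<lambda>j. \<omega> (j + i)) m))" for i m
  proof -
    have "column_gap (P \<omega> (i + m)) \<le> column_gap (P \<omega> i) * shrink (P (\<lambda>j. \<omega> (j + i)) m)"
      unfolding rand_prod_add by (intro column_gap_mult nn nn' det det')
    then have "u (i + m) \<le> ln (column_gap (P \<omega> i) * shrink (P (\<lambda>j. \<omega> (j + i)) m))"
      unfolding u_def by (intro ln_mono column_gap_pos nn det)
    also have "\<dots> = u i + ln (shrink (P (\<lambda>j. \<omega> (j + i)) m))"
      unfolding u_def
      by (intro ln_mult_pos column_gap_pos shrink_bounds nn nn' det det')
    finally show ?thesis .
  qed
  have u_antimono: "u (i + m) \<le> u i" for i m
    using u_step[of i m] shrink_bounds[OF nn' det', of i m] by (simp add: ln_le_zero_iff order_trans)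
  have u_occ: "u (i + l) - u i \<le> - \<beta> * of_bool (starts_with w (\<lambda>j. \<omega> (j + i)))" for i
  proof (cases "starts_with w (\<lambda>j. \<omega> (j + i))")
    case True
    then have "P (\<lambda>j. \<omega> (j + i)) l = B"
      unfolding B_def by (intro rand_prod_prefix) (auto simp: starts_with_def l_def)
    then show ?thesis using u_step[of i l] True by (simp add: \<beta>_def)
  next
    case False
    then show ?thesis using u_antimono[of i l] by simp
  qed
  have \<beta>: "0 < \<beta>"
  proof -
    have "det B \<noteq> 0"
    proof -
      have "det (P (\<lambda>i. w ! i) n) \<noteq> 0" if "n \<le> length w" for n
        using that
      proof (induction n)
        case (Suc n)
        then have "w ! n < s" using w nth_mem[of n w] by force
        then show ?case using Suc by (simp add: det_mul det_nonzero)
      qed simp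
      then show ?thesis by (simp add: B_def l_def)
    qed
    moreover have "nonneg_mat B" unfolding B_def l_def nonneg_mat_def using pos less_imp_le by blast
    ultimately have "0 < shrink B" by (intro shrink_bounds)
    moreover have "shrink B < 1" unfolding B_def l_def by (rule shrink_less_1) (rule pos)
    ultimately show ?thesis by (simp add: \<beta>_def ln_less_zero)
  qed
  have u_bound: "real l * u (n + l) \<le> real l * u 0 - \<beta> * occ n" for n
  proof -
    have "(\<Sum>i<n. u (i + l) - u i) \<le> (\<Sum>i<n. - \<beta> * of_bool (starts_with w (\<lambda>j. \<omega> (j + i))))"
      by (intro sum_mono u_occ)
    also have "\<dots> = - \<beta> * occ n" by (simp only: occ_def sum_distrib_left)
    finally have "(\<Sum>j<l. u (n + j)) - (\<Sum>j<l. u j) \<le> - \<beta> * occ n" by (simp only: sum_lag)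
    moreover have "(\<Sum>j<l. u (n + l)) \<le> (\<Sum>j<l. u (n + j))"
      using u_antimono[of "n + j" "l - j" for j] by (intro sum_mono) (metis add_diff_inverse_nat add.assoc lessThan_iff not_less_iff_gr_or_eq)
    moreover have "(\<Sum>j<l. u j) \<le> (\<Sum>j<l. u 0)"
      using u_antimono[of 0] by (intro sum_mono) simp
    ultimately show ?thesis by simp
  qed
  define c where "c = \<beta> * q / (2 * real l)"
  have c: "0 < c" using \<beta> q l by (simp add: c_def)
  have "(\<lambda>n. occ n / real n) \<longlonglongrightarrow> q" using elim(1) by (simp add: occ_def q_def)
  then have "eventually (\<lambda>n. q / 2 < occ n / real n) sequentially"
    by (rule order_tendstoD(1)) (use q in simp)
  then obtain N where N: "\<And>n. n \<ge> N \<Longrightarrow> q / 2 < occ n / real n" by (auto simp: eventually_sequentially)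
  have gap: "column_gap (P \<omega> n) \<le> exp (u 0 + c * real l) * exp (- c) ^ n" if n: "n \<ge> Suc N + l" for n
  proof -
    define m where "m = n - l"
    have m: "m \<ge> N" "0 < m" "n = m + l" using n by (auto simp: m_def)
    have "q / 2 * real m \<le> occ m" using N[OF m(1)] m(2) by (simp add: field_simps)
    then have "\<beta> * (q / 2 * real m) \<le> \<beta> * occ m" using \<beta> by (intro mult_left_mono) auto
    moreover have "real l * (c * real m) = \<beta> * (q / 2 * real m)" using l by (simp add: c_def)
    ultimately have "real l * u n \<le> real l * (u 0 - c * real m)"
      using u_bound[of m] unfolding m(3) right_diff_distrib by linarith
    then have "u n \<le> u 0 - c * real m" using l by simp
    then have "u n \<le> (u 0 + c * real l) + real n * (- c)" by (simp add: m(3) algebra_simps)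
    then have "exp (u n) \<le> exp (u 0 + c * real l) * exp (- c) ^ n"
      by (simp flip: exp_add exp_of_nat_mult)
    then show ?thesis using column_gap_pos[OF nn det, of n] by (simp add: u_def)
  qed
  show ?case
    unfolding contracting_def
  proof (intro exI conjI allI impI)
    fix n assume "Suc N + l \<le> n"
    from gap[OF this] show "\<bar>det (P \<omega> n)\<bar> \<le> exp (u 0 + c * real l) * exp (- c) ^ n * (col_sum (P \<omega> n) 1 * col_sum (P \<omega> n) 2)"
      using col_sum_pos[OF nn det, of n 1] col_sum_pos[OF nn det, of n 2]
      by (simp add: column_gap_def divide_le_eq)
  qed (use c in auto)
qed

lemma expectation_ln_det: "(\<integral>\<omega>. ln \<bar>det (P \<omega> n)\<bar> \<partial>\<B>) = real n * det_exponent"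
proof -
  have int: "integrable \<B> (\<lambda>\<omega>. ln \<bar>det (A (\<omega> i))\<bar>)" for i
    by (rule integrable_bounded[OF borel_letter letter_bound[of _ "\<lambda>k. ln \<bar>det (A k)\<bar>"]])
  have "(\<integral>\<omega>. ln \<bar>det (P \<omega> n)\<bar> \<partial>\<B>) = (\<integral>\<omega>. (\<Sum>i<n. ln \<bar>det (A (\<omega> i))\<bar>) \<partial>\<B>)"
    by (intro Bochner_Integration.integral_cong) (auto simp: ln_det_P)
  also have "\<dots> = real n * det_exponent"
    using int expectation_letter[of "\<lambda>k. ln \<bar>det (A k)\<bar>"] by (simp add: det_exponent_def)
  finally show ?thesis .
qed

end

section \<open>Monomial matrices\<close>

locale monomial_matrix_product = invertible_matrix_product +
  assumes monomial: "\<And>k. k < s \<Longrightarrow> diagonal_mat (A k) \<or> (\<forall>i. A k $ i $ i = 0)"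
    and antidiagonal: "\<exists>k<s. \<not> diagonal_mat (A k)"
begin

text \<open>
  Prepending the letter \<open>k\<close> to a sequence turns the logarithm \<open>z\<close> of the ratio of the two row sums of
  the product (each row has one nonzero entry) into \<open>increment k + sign k * z\<close>. Prepending, rather than
  appending, makes \<open>z\<close> independent of the new letter.
\<close>
definition sign :: "nat \<Rightarrow> real" where
  "sign k = (if diagonal_mat (A k) then 1 else - 1)"

definition increment :: "nat \<Rightarrow> real" where
  "increment k = (if diagonal_mat (A k) then ln (A k $ 1 $ 1) - ln (A k $ 2 $ 2)
                  else ln (A k $ 1 $ 2) - ln (A k $ 2 $ 1))"

definition row_sum :: "(nat \<Rightarrow> nat) \<Rightarrow> nat \<Rightarrow> 2 \<Rightarrow> real" where
  "row_sum \<omega> n i = P \<omega> n $ i $ 1 + P \<omega> n $ i $ 2"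

definition log_ratio :: "nat \<Rightarrow> (nat \<Rightarrow> nat) \<Rightarrow> real" where
  "log_ratio n \<omega> = ln (row_sum \<omega> n 1) - ln (row_sum \<omega> n 2)"

lemma sign_square: "(sign k)\<^sup>2 = 1"
  by (simp add: sign_def)

lemma letter_cases:
  assumes "k < s"
  obtains (diag) "diagonal_mat (A k)" "A k $ 1 $ 2 = 0" "A k $ 2 $ 1 = 0" "0 < A k $ 1 $ 1" "0 < A k $ 2 $ 2"
  | (anti) "\<not> diagonal_mat (A k)" "A k $ 1 $ 1 = 0" "A k $ 2 $ 2 = 0" "0 < A k $ 1 $ 2" "0 < A k $ 2 $ 1"
proof (cases "diagonal_mat (A k)")
  case True
  then have z: "A k $ 1 $ 2 = 0" "A k $ 2 $ 1 = 0" by (auto simp: diagonal_mat_def)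
  then have "A k $ 1 $ 1 \<noteq> 0" "A k $ 2 $ 2 \<noteq> 0" using det_nonzero[OF assms] by (auto simp: det_2)
  then show ?thesis using diag[OF True z] nonneg[OF assms] by (simp add: less_le)
next
  case False
  then have z: "A k $ 1 $ 1 = 0" "A k $ 2 $ 2 = 0" using monomial[OF assms] by auto
  then have "A k $ 1 $ 2 \<noteq> 0" "A k $ 2 $ 1 \<noteq> 0" using det_nonzero[OF assms] by (auto simp: det_2)
  then show ?thesis using anti[OF False z] nonneg[OF assms] by (simp add: less_le)
qed

lemma P_Suc_front: "P \<omega> (Suc n) = A (\<omega> 0) ** P (\<lambda>i. \<omega> (Suc i)) n"
  using rand_prod_add[of A \<omega> "Suc 0" n] by simp

lemma row_sum_0: "row_sum \<omega> 0 i = 1"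
  using exhaust_2[of i] by (auto simp: row_sum_def mat_def)

lemma row_sum_Suc:
  "row_sum \<omega> (Suc n) i = A (\<omega> 0) $ i $ 1 * row_sum (\<lambda>i. \<omega> (Suc i)) n 1 + A (\<omega> 0) $ i $ 2 * row_sum (\<lambda>i. \<omega> (Suc i)) n 2"
  unfolding row_sum_def P_Suc_front
  by (simp add: matrix_matrix_mult_def sum_2 algebra_simps)

lemma row_sum_pos_prod:
  assumes "\<omega> \<in> space \<B>"
  shows "0 < row_sum \<omega> n 1 \<and> 0 < row_sum \<omega> n 2 \<and> row_sum \<omega> n 1 * row_sum \<omega> n 2 = \<bar>det (P \<omega> n)\<bar>"
  using assms
proof (induction n arbitrary: \<omega>)
  case 0
  then show ?case by (simp add: row_sum_0)
next
  case (Suc n)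
  have \<omega>': "(\<lambda>i. \<omega> (Suc i)) \<in> space \<B>" using shift_space[OF Suc.prems, of 1] by simp
  note IH = Suc.IH[OF this]
  have det: "det (P \<omega> (Suc n)) = det (A (\<omega> 0)) * det (P (\<lambda>i. \<omega> (Suc i)) n)"
    unfolding P_Suc_front by (rule det_mul)
  show ?case
    using letter_less[OF Suc.prems, of 0]
  proof (cases rule: letter_cases)
    case diag
    then show ?thesis using IH unfolding det by (simp add: row_sum_Suc det_2 abs_mult mult_ac)
  next
    case anti
    then show ?thesis using IH unfolding det by (simp add: row_sum_Suc det_2[of "A (\<omega> 0)"] abs_mult mult_ac)
  qed
qed

lemma log_ratio_Suc:
  assumes "k < s" "\<omega> \<in> space \<B>"
  shows "log_ratio (Suc n) (case_nat k \<omega>) = increment k + sign k * log_ratio n \<omega>"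
proof -
  note pos = row_sum_pos_prod[OF assms(2), of n]
  show ?thesis
    using assms(1)
  proof (cases rule: letter_cases)
    case diag
    then show ?thesis using pos by (simp add: log_ratio_def increment_def sign_def row_sum_Suc ln_mult)
  next
    case anti
    then show ?thesis using pos by (simp add: log_ratio_def increment_def sign_def row_sum_Suc ln_mult)
  qed
qed

lemma case_nat_shift: "case_nat (\<omega> 0) (\<lambda>i. \<omega> (Suc i)) = \<omega>"
  by (auto simp: fun_eq_iff split: nat.splits)

lemma log_ratio_bound:
  assumes "\<omega> \<in> space \<B>" shows "\<bar>log_ratio n \<omega>\<bar> \<le> real n * (\<Sum>k<s. \<bar>increment k\<bar>)"
  using assms
proof (induction n arbitrary: \<omega>)
  case 0
  then show ?case by (simp add: log_ratio_def row_sum_0)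
next
  case (Suc n)
  have \<omega>': "(\<lambda>i. \<omega> (Suc i)) \<in> space \<B>" using shift_space[OF Suc.prems, of 1] by simp
  note less = letter_less[OF Suc.prems, of 0]
  have "\<bar>log_ratio (Suc n) \<omega>\<bar> = \<bar>increment (\<omega> 0) + sign (\<omega> 0) * log_ratio n (\<lambda>i. \<omega> (Suc i))\<bar>"
    using log_ratio_Suc[OF less \<omega>', of n] by (simp add: case_nat_shift)
  also have "\<dots> \<le> \<bar>increment (\<omega> 0)\<bar> + \<bar>log_ratio n (\<lambda>i. \<omega> (Suc i))\<bar>"
    by (rule order_trans[OF abs_triangle_ineq]) (simp add: sign_def)
  also have "\<bar>increment (\<omega> 0)\<bar> \<le> (\<Sum>k<s. \<bar>increment k\<bar>)"
    using less by (intro member_le_sum) auto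
  finally show ?case using Suc.IH[OF \<omega>'] by (simp add: algebra_simps)
qed

lemma measurable_log_ratio: "log_ratio n \<in> borel_measurable \<B>"
  unfolding log_ratio_def row_sum_def
  using borel_P[of "\<lambda>M. ln (M$1$1 + M$1$2) - ln (M$2$1 + M$2$2)" n] by simp

lemma integrable_log_ratio:
  "integrable \<B> (log_ratio n)" "integrable \<B> (\<lambda>\<omega>. (log_ratio n \<omega>)\<^sup>2)"
proof -
  note [measurable] = measurable_log_ratio
  show "integrable \<B> (log_ratio n)"
    by (rule integrable_bounded[OF measurable_log_ratio log_ratio_bound])
  show "integrable \<B> (\<lambda>\<omega>. (log_ratio n \<omega>)\<^sup>2)"
  proof (rule integrable_bounded)
    show "\<bar>(log_ratio n \<omega>)\<^sup>2\<bar> \<le> (real n * (\<Sum>k<s. \<bar>increment k\<bar>))\<^sup>2" if "\<omega> \<in> space \<B>" for \<omega>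
      using power_mono[OF log_ratio_bound[OF that, of n], of 2] by simp
  qed measurable
qed

lemma mean_log_ratio_Suc:
  "(\<integral>\<omega>. log_ratio (Suc n) \<omega> \<partial>\<B>) = mean increment + mean sign * (\<integral>\<omega>. log_ratio n \<omega> \<partial>\<B>)"
proof -
  have "(\<integral>\<omega>. log_ratio (Suc n) \<omega> \<partial>\<B>) = mean (\<lambda>k. \<integral>\<omega>. log_ratio (Suc n) (case_nat k \<omega>) \<partial>\<B>)"
    by (rule integral_first_letter[OF measurable_log_ratio log_ratio_bound])
  also have "\<dots> = mean (\<lambda>k. \<integral>\<omega>. increment k + sign k * log_ratio n \<omega> \<partial>\<B>)"
    by (intro sum.cong arg_cong2[where f = "(*)"] Bochner_Integration.integral_cong) (auto simp: log_ratio_Suc)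
  also have "\<dots> = mean (\<lambda>k. increment k + sign k * (\<integral>\<omega>. log_ratio n \<omega> \<partial>\<B>))"
    using integrable_log_ratio by (simp add: prob_space)
  finally show ?thesis by (simp add: distrib_left sum.distrib sum_distrib_right mult.assoc)
qed

lemma mean_square_log_ratio_Suc:
  "(\<integral>\<omega>. (log_ratio (Suc n) \<omega>)\<^sup>2 \<partial>\<B>) = mean (\<lambda>k. (increment k)\<^sup>2) +
     2 * mean (\<lambda>k. increment k * sign k) * (\<integral>\<omega>. log_ratio n \<omega> \<partial>\<B>) + (\<integral>\<omega>. (log_ratio n \<omega>)\<^sup>2 \<partial>\<B>)"
proof -
  let ?e = "\<integral>\<omega>. log_ratio n \<omega> \<partial>\<B>" and ?v = "\<integral>\<omega>. (log_ratio n \<omega>)\<^sup>2 \<partial>\<B>"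
  note [measurable] = measurable_log_ratio
  have "(\<integral>\<omega>. (log_ratio (Suc n) \<omega>)\<^sup>2 \<partial>\<B>) = mean (\<lambda>k. \<integral>\<omega>. (log_ratio (Suc n) (case_nat k \<omega>))\<^sup>2 \<partial>\<B>)"
  proof (rule integral_first_letter)
    show "\<bar>(log_ratio (Suc n) \<omega>)\<^sup>2\<bar> \<le> (real (Suc n) * (\<Sum>k<s. \<bar>increment k\<bar>))\<^sup>2" if "\<omega> \<in> space \<B>" for \<omega>
      using power_mono[OF log_ratio_bound[OF that, of "Suc n"], of 2] by simp
  qed measurable
  also have "\<dots> = mean (\<lambda>k. \<integral>\<omega>. (increment k)\<^sup>2 + 2 * (increment k * sign k) * log_ratio n \<omega> + (log_ratio n \<omega>)\<^sup>2 \<partial>\<B>)"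
    by (intro sum.cong arg_cong2[where f = "(*)"] Bochner_Integration.integral_cong)
       (auto simp: log_ratio_Suc power2_sum power_mult_distrib sign_square)
  also have "\<dots> = mean (\<lambda>k. (increment k)\<^sup>2 + 2 * (increment k * sign k) * ?e + ?v)"
    using integrable_log_ratio by (simp add: prob_space)
  also have "\<dots> = (\<Sum>k<s. p k * (increment k)\<^sup>2 + p k * (increment k * sign k) * (2 * ?e) + p k * ?v)"
    by (intro sum.cong) (auto simp: algebra_simps)
  also have "\<dots> = mean (\<lambda>k. (increment k)\<^sup>2) + mean (\<lambda>k. increment k * sign k) * (2 * ?e) + (\<Sum>k<s. p k) * ?v"
    by (simp only: sum.distrib sum_distrib_right)
  finally show ?thesis by (simp add: p_sum)
qed

lemma mean_sign: "- 1 \<le> mean sign" "mean sign < 1"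
proof -
  have "mean sign \<le> (\<Sum>k<s. p k)" "- (\<Sum>k<s. p k) \<le> mean sign"
    unfolding sum_negf[symmetric] using p_pos by (auto intro!: sum_mono simp: sign_def less_imp_le)
  then show "- 1 \<le> mean sign" by (simp add: p_sum)
  obtain k where k: "k < s" "\<not> diagonal_mat (A k)" using antidiagonal by blast
  have "mean sign < (\<Sum>k<s. p k)"
  proof (rule sum_strict_mono_ex1)
    show "\<forall>k\<in>{..<s}. p k * sign k \<le> p k" using p_pos by (force simp: sign_def)
    show "\<exists>k\<in>{..<s}. p k * sign k < p k" using k p_pos[OF k(1)] by (intro bexI[of _ k]) (auto simp: sign_def)
  qed simp
  then show "mean sign < 1" by (simp add: p_sum)
qed

text \<open>
  Some letter is antidiagonal, so \<open>-1 \<le> mean sign < 1\<close>, and the affine recursion for the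
  expectation has bounded orbits. (At \<open>-1\<close> they are periodic.)
\<close>
lemma mean_log_ratio_bounded:
  "\<bar>\<integral>\<omega>. log_ratio n \<omega> \<partial>\<B>\<bar> \<le> 2 * \<bar>mean increment\<bar> / (1 - mean sign)"
proof -
  let ?q = "mean sign"
  have "(1 - ?q) * (\<integral>\<omega>. log_ratio n \<omega> \<partial>\<B>) = mean increment * (1 - ?q ^ n)"
  proof (induction n)
    case 0
    then show ?case by (simp add: log_ratio_def row_sum_0)
  next
    case (Suc n)
    have "(1 - ?q) * (\<integral>\<omega>. log_ratio (Suc n) \<omega> \<partial>\<B>)
        = (1 - ?q) * mean increment + ?q * ((1 - ?q) * (\<integral>\<omega>. log_ratio n \<omega> \<partial>\<B>))"
      unfolding mean_log_ratio_Suc by (simp only: algebra_simps)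
    also have "\<dots> = mean increment * (1 - ?q ^ Suc n)"
      unfolding Suc power_Suc by (simp only: algebra_simps)
    finally show ?case .
  qed
  then have "\<bar>1 - ?q\<bar> * \<bar>\<integral>\<omega>. log_ratio n \<omega> \<partial>\<B>\<bar> = \<bar>mean increment\<bar> * \<bar>1 - ?q ^ n\<bar>"
    by (simp only: flip: abs_mult)
  moreover have "\<bar>1 - ?q\<bar> = 1 - ?q" using mean_sign by linarith
  ultimately have "(1 - ?q) * \<bar>\<integral>\<omega>. log_ratio n \<omega> \<partial>\<B>\<bar> = \<bar>mean increment\<bar> * \<bar>1 - ?q ^ n\<bar>"
    by (simp only:)
  also have "\<dots> \<le> \<bar>mean increment\<bar> * 2"
  proof (rule mult_left_mono)
    have "\<bar>?q ^ n\<bar> \<le> 1" using mean_sign by (simp add: power_abs power_le_one)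
    then show "\<bar>1 - ?q ^ n\<bar> \<le> 2" by linarith
  qed simp
  finally show ?thesis using mean_sign by (simp add: pos_le_divide_eq mult.commute)
qed

text \<open>
  As \<open>(sign k)\<^sup>2 = 1\<close>, the second moment increases in one step by a constant plus a multiple of the
  expectation, which is bounded.
\<close>
lemma mean_square_log_ratio_linear:
  "\<exists>K\<ge>0. \<forall>n. (\<integral>\<omega>. (log_ratio n \<omega>)\<^sup>2 \<partial>\<B>) \<le> K * real n"
proof -
  define c where "c = 2 * mean (\<lambda>k. increment k * sign k)"
  define B where "B = 2 * \<bar>mean increment\<bar> / (1 - mean sign)"
  define K where "K = mean (\<lambda>k. (increment k)\<^sup>2) + \<bar>c\<bar> * B"
  have "0 \<le> K" unfolding K_def B_def using mean_sign p_pos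
    by (intro add_nonneg_nonneg sum_nonneg mult_nonneg_nonneg divide_nonneg_nonneg) (auto simp: less_imp_le)
  moreover have "(\<integral>\<omega>. (log_ratio n \<omega>)\<^sup>2 \<partial>\<B>) \<le> K * real n" for n
  proof (induction n)
    case 0
    then show ?case by (simp add: log_ratio_def row_sum_0)
  next
    case (Suc n)
    have "c * (\<integral>\<omega>. log_ratio n \<omega> \<partial>\<B>) \<le> \<bar>c\<bar> * \<bar>\<integral>\<omega>. log_ratio n \<omega> \<partial>\<B>\<bar>"
      by (metis abs_ge_self abs_mult)
    also have "\<dots> \<le> \<bar>c\<bar> * B"
      unfolding B_def by (intro mult_left_mono mean_log_ratio_bounded) simp
    finally show ?case using Suc unfolding mean_square_log_ratio_Suc c_def[symmetric]
      by (simp add: K_def algebra_simps)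
  qed
  ultimately show ?thesis by blast
qed

lemma ln_entry_sum_le:
  assumes "\<omega> \<in> space \<B>"
  shows "ln (entry_sum (P \<omega> n)) \<le> ln 2 + ln \<bar>det (P \<omega> n)\<bar> / 2 + \<bar>log_ratio n \<omega>\<bar> / 2"
proof -
  let ?x = "row_sum \<omega> n 1" and ?y = "row_sum \<omega> n 2"
  note xy = row_sum_pos_prod[OF assms, of n]
  have "entry_sum (P \<omega> n) = ?x + ?y"
    by (simp add: entry_sum_def col_sum_def sum_2 row_sum_def)
  also have "\<dots> \<le> 2 * max ?x ?y" by simp
  finally have "ln (entry_sum (P \<omega> n)) \<le> ln (2 * max ?x ?y)"
    using P_entry_sum_pos[OF assms] by (intro ln_mono) auto
  also have "\<dots> = ln 2 + ln (max ?x ?y)" using xy by (intro ln_mult_pos) auto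
  also have "ln (max ?x ?y) = max (ln ?x) (ln ?y)" using xy by (simp add: max_def)
  also have "\<dots> = (ln ?x + ln ?y) / 2 + \<bar>log_ratio n \<omega>\<bar> / 2"
    by (simp add: log_ratio_def max_def abs_if field_simps)
  also have "ln ?x + ln ?y = ln \<bar>det (P \<omega> n)\<bar>" using xy ln_mult_pos[of ?x ?y] by simp
  finally show ?thesis by simp
qed

text \<open>
  The sum of the entries is at most twice the larger row sum, and the product of the row sums is
  \<open>\<bar>det (P \<omega> n)\<bar>\<close>. So \<open>ln (entry_sum (P \<omega> n))\<close> exceeds half of \<open>ln \<bar>det (P \<omega> n)\<bar>\<close> by at most half of
  \<open>\<bar>log_ratio n \<omega>\<bar>\<close> and a constant. The expectation of \<open>\<bar>log_ratio n \<omega>\<bar>\<close> is of order \<open>sqrt n\<close>, by the second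
  moment bound.
\<close>
lemma top_exponent_le_half: "2 * top_exponent \<le> det_exponent"
proof -
  obtain C where C: "\<And>n. real n * top_exponent \<le> (\<integral>\<omega>. ln (entry_sum (P \<omega> n)) \<partial>\<B>) + C"
    using top_exponent_le_mean by blast
  obtain K where K: "0 \<le> K" "\<And>n. (\<integral>\<omega>. (log_ratio n \<omega>)\<^sup>2 \<partial>\<B>) \<le> K * real n"
    using mean_square_log_ratio_linear by blast
  obtain D where D: "cocycle D (\<lambda>n \<omega>. ln (entry_sum (P \<omega> n)))" using ln_entry_sum_cocycle by blast
  have int_det: "integrable \<B> (\<lambda>\<omega>. ln \<bar>det (P \<omega> n)\<bar>)" for n
  proof (rule integrable_bounded)
    show "(\<lambda>\<omega>. ln \<bar>det (P \<omega> n)\<bar>) \<in> borel_measurable \<B>" by (rule borel_P)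
    show "\<bar>ln \<bar>det (P \<omega> n)\<bar>\<bar> \<le> (\<Sum>i<n. \<Sum>k<s. \<bar>ln \<bar>det (A k)\<bar>\<bar>)" if "\<omega> \<in> space \<B>" for \<omega>
      unfolding ln_det_P[OF that]
      by (intro order_trans[OF sum_abs] sum_mono member_le_sum) (auto simp: letter_less[OF that])
  qed
  have step: "real m * (2 * top_exponent - det_exponent) \<le> real m * 0 + (2 * \<bar>ln 2 + C\<bar> + (K + 1) / 2 * 1)"
    if m: "m > 0" for m :: nat
  proof -
    \<comment> \<open>The length is a square, so that its root can be the weight \<open>m\<close> in \<open>\<bar>z\<bar> \<le> (z\<^sup>2 / m + m) / 2\<close>.\<close>
    define n where "n = m\<^sup>2"
    have n: "real n = real m * real m" by (simp add: n_def power2_eq_square)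
    have m1: "1 \<le> real m" using m by simp
    have "(\<integral>\<omega>. ln (entry_sum (P \<omega> n)) \<partial>\<B>)
        \<le> (\<integral>\<omega>. ln 2 + ln \<bar>det (P \<omega> n)\<bar> / 2 + ((log_ratio n \<omega>)\<^sup>2 / real m + real m) / 4 \<partial>\<B>)"
    proof (rule integral_mono[OF cocycleD(4)[OF D]])
      show "integrable \<B> (\<lambda>\<omega>. ln 2 + ln \<bar>det (P \<omega> n)\<bar> / 2 + ((log_ratio n \<omega>)\<^sup>2 / real m + real m) / 4)"
        using int_det integrable_log_ratio by auto
      fix \<omega> assume \<omega>: "\<omega> \<in> space \<B>"
      have "0 \<le> (\<bar>log_ratio n \<omega>\<bar> - real m)\<^sup>2" by simp
      then have "2 * real m * \<bar>log_ratio n \<omega>\<bar> \<le> (log_ratio n \<omega>)\<^sup>2 + real m * real m"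
        by (simp add: power2_diff power2_eq_square algebra_simps)
      then have "\<bar>log_ratio n \<omega>\<bar> \<le> ((log_ratio n \<omega>)\<^sup>2 / real m + real m) / 2"
        using m by (simp add: field_simps)
      then have "\<bar>log_ratio n \<omega>\<bar> / 2 \<le> ((log_ratio n \<omega>)\<^sup>2 / real m + real m) / 4" by simp
      with ln_entry_sum_le[OF \<omega>, of n]
      show "ln (entry_sum (P \<omega> n)) \<le> ln 2 + ln \<bar>det (P \<omega> n)\<bar> / 2 + ((log_ratio n \<omega>)\<^sup>2 / real m + real m) / 4"
        by (rule order_trans[OF _ add_left_mono])
    qed
    also have "\<dots> = ln 2 + real n * det_exponent / 2 + ((\<integral>\<omega>. (log_ratio n \<omega>)\<^sup>2 \<partial>\<B>) / real m + real m) / 4"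
      using int_det integrable_log_ratio by (simp add: prob_space expectation_ln_det)
    also have "(\<integral>\<omega>. (log_ratio n \<omega>)\<^sup>2 \<partial>\<B>) / real m \<le> K * real m"
      using K(2)[of n] m by (simp add: n field_simps)
    finally have "real n * top_exponent \<le> ln 2 + real n * det_exponent / 2 + (K * real m + real m) / 4 + C"
      using C[of n] by simp
    then have "real m * (real m * (2 * top_exponent - det_exponent)) \<le> 2 * (ln 2 + C) + real m * ((K + 1) / 2)"
      unfolding n by (simp add: algebra_simps)
    also have "2 * (ln 2 + C) \<le> real m * (2 * \<bar>ln 2 + C\<bar>)"
      using mult_right_mono[OF m1, of "2 * \<bar>ln 2 + C\<bar>"] by simp
    finally have "real m * (real m * (2 * top_exponent - det_exponent)) \<le> real m * (2 * \<bar>ln 2 + C\<bar> + (K + 1) / 2)"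
      by (simp add: distrib_left)
    then show ?thesis using m by simp
  qed
  have "2 * top_exponent - det_exponent \<le> 0" by (rule affine_le_imp_slope_le[OF step])
  then show ?thesis by simp
qed

lemma first_column_entry:
  assumes "\<omega> \<in> space \<B>"
  defines "\<phi> \<equiv> \<lambda>n. normalized_vec (column 1 (P \<omega> n)) $ 1"
  shows "diagonal_mat (P \<omega> n) \<and> \<phi> n = 1 \<or> (\<forall>i. P \<omega> n $ i $ i = 0) \<and> \<phi> n = 0"
    and "\<not> diagonal_mat (A (\<omega> n)) \<Longrightarrow> \<phi> (Suc n) = 1 - \<phi> n"
proof -
  have mono: "diagonal_mat (P \<omega> n) \<or> (\<forall>i. P \<omega> n $ i $ i = 0)" for n
  proof (induction n)
    case 0
    then show ?case by (simp add: diagonal_mat_def mat_def)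
  next
    case (Suc n)
    show ?case
      using letter_less[OF assms(1), of n]
      by (cases rule: letter_cases)
         (use Suc in \<open>auto simp: diagonal_mat_def forall_2 matrix_matrix_mult_def sum_2\<close>)
  qed
  have nn: "0 \<le> P \<omega> n $ i $ j" for n i j using P_nonneg[OF assms(1)] by (simp add: nonneg_mat_def)
  have \<phi>_diag: "\<phi> n = 1" if "diagonal_mat (P \<omega> n)" for n
  proof -
    have "P \<omega> n $ 1 $ 1 \<noteq> 0" "P \<omega> n $ 2 $ 1 = 0"
      using that P_det_nonzero[OF assms(1), of n] by (auto simp: diagonal_mat_def det_2)
    then show ?thesis using nn[of n 1 1]
      by (simp add: \<phi>_def normalized_vec_def norm1_def column_def sum_2)
  qed
  have \<phi>_anti: "\<phi> n = 0" if "\<forall>i. P \<omega> n $ i $ i = 0" for n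
    using that by (simp add: \<phi>_def normalized_vec_def column_def)
  show "diagonal_mat (P \<omega> n) \<and> \<phi> n = 1 \<or> (\<forall>i. P \<omega> n $ i $ i = 0) \<and> \<phi> n = 0"
    using mono[of n] \<phi>_diag \<phi>_anti by blast
  assume anti: "\<not> diagonal_mat (A (\<omega> n))"
  show "\<phi> (Suc n) = 1 - \<phi> n"
    using letter_less[OF assms(1), of n]
  proof (cases rule: letter_cases)
    case diag
    then show ?thesis using anti by simp
  next
    case z: anti
    show ?thesis
    proof (cases "diagonal_mat (P \<omega> n)")
      case True
      then have "\<forall>i. P \<omega> (Suc n) $ i $ i = 0"
        using z by (simp add: diagonal_mat_def forall_2 matrix_matrix_mult_def sum_2)
      then show ?thesis using \<phi>_diag[OF True] \<phi>_anti by simp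
    next
      case False
      then have n0: "\<forall>i. P \<omega> n $ i $ i = 0" using mono by blast
      then have "diagonal_mat (P \<omega> (Suc n))"
        using z by (simp add: diagonal_mat_def forall_2 matrix_matrix_mult_def sum_2)
      then show ?thesis using \<phi>_anti[OF n0] \<phi>_diag by simp
    qed
  qed
qed

text \<open>
  The first coordinate of the normalized first column is 0 or 1, and changes with every
  antidiagonal letter.
\<close>
lemma columns_diverge: "AE \<omega> in \<B>. \<not> normalized_columns_exp_convergent (P \<omega>)"
  using letters_infinitely_often AE_space
proof eventually_elim
  case (elim \<omega>)
  note \<omega> = elim(2)
  obtain k where k: "k < s" "\<not> diagonal_mat (A k)" using antidiagonal by blast
  define \<phi> where "\<phi> n = normalized_vec (column 1 (P \<omega> n)) $ 1" for n
  show ?case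
  proof
    assume conv: "normalized_columns_exp_convergent (P \<omega>)"
    have "column 1 (P \<omega> n) \<noteq> 0" for n
      using P_det_nonzero[OF \<omega>, of n] by (auto simp: column_def vec_eq_iff forall_2 det_2)
    from exp_convergent_columnD[OF conv this]
    have "exp_convergent_along UNIV (\<lambda>n. normalized_vec (column 1 (P \<omega> n)))" .
    then obtain L where "(\<lambda>n. normalized_vec (column 1 (P \<omega> n))) \<longlonglongrightarrow> L"
      by (auto simp: exp_convergent_along_def simp flip: top_eq_principal_UNIV)
    then have lim: "\<phi> \<longlonglongrightarrow> L $ 1" unfolding \<phi>_def by (rule tendsto_vec_nth)
    then have "(\<lambda>n. \<phi> (Suc n) - \<phi> n) \<longlonglongrightarrow> L $ 1 - L $ 1" by (intro tendsto_diff LIMSEQ_Suc)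
    then have "eventually (\<lambda>n. \<bar>\<phi> (Suc n) - \<phi> n\<bar> < 1) sequentially"
      using tendstoD[of "\<lambda>n. \<phi> (Suc n) - \<phi> n" 0 sequentially 1] by (simp add: dist_norm)
    then obtain N where N: "\<And>n. n \<ge> N \<Longrightarrow> \<bar>\<phi> (Suc n) - \<phi> n\<bar> < 1"
      by (auto simp: eventually_sequentially)
    obtain n where n: "\<omega> n = k" "\<bar>\<phi> (Suc n) - \<phi> n\<bar> < 1"
      using elim(1) k(1) N unfolding frequently_sequentially by blast
    have "\<phi> (Suc n) = 1 - \<phi> n" unfolding \<phi>_def using first_column_entry(2)[OF \<omega>, of n] n(1) k(2) by simp
    moreover have "\<phi> n = 0 \<or> \<phi> n = 1" unfolding \<phi>_def using first_column_entry(1)[OF \<omega>, of n] by blast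
    ultimately show False using n(2) by auto
  qed
qed

lemma monomial_weak:
  "AE \<omega> in \<B>. \<not> normalized_columns_exp_convergent (P \<omega>) \<and> \<not> distinct_singular_growth (P \<omega>)"
  using columns_diverge distinct_iff
  by eventually_elim (use top_exponent_le_half det_exponent_le in auto)

end

section \<open>Triangular matrices\<close>

lemma sum_over_2: "i \<noteq> j \<Longrightarrow> sum f (UNIV :: 2 set) = f i + f j"
  using exhaust_2[of i] exhaust_2[of j] by (auto simp: sum_2 add.commute)

lemma det_over_2: "i \<noteq> j \<Longrightarrow> det (M :: real^2^2) = M$i$i * M$j$j - M$i$j * M$j$i"
  using exhaust_2[of i] exhaust_2[of j] by (auto simp: det_2 algebra_simps)

text \<open>The finitely many \<open>n\<close> before the asymptotic regime are absorbed by \<open>K\<close>.\<close>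
lemma subexponential_bound:
  fixes u :: "nat \<Rightarrow> real"
  assumes pos: "\<And>n. 0 < u n" and "(\<lambda>n. ln (u n) / real n) \<longlonglongrightarrow> \<theta>" and "\<theta> < \<theta>'"
  shows "\<exists>K>0. \<forall>n. u n \<le> K * exp \<theta>' ^ n"
proof -
  have "eventually (\<lambda>n. ln (u n) / real n < \<theta>') sequentially"
    using assms(2,3) by (rule order_tendstoD)
  then obtain N where N: "\<And>n. n \<ge> N \<Longrightarrow> ln (u n) / real n < \<theta>'" by (auto simp: eventually_sequentially)
  define K where "K = 1 + (\<Sum>n<Suc N. u n / exp \<theta>' ^ n)"
  have S: "0 \<le> (\<Sum>n<Suc N. u n / exp \<theta>' ^ n)" using pos by (intro sum_nonneg) (simp add: less_imp_le)
  have "u n \<le> K * exp \<theta>' ^ n" for n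
  proof (cases "n \<le> N")
    case True
    have "u n / exp \<theta>' ^ n \<le> (\<Sum>n<Suc N. u n / exp \<theta>' ^ n)"
      using True pos by (intro member_le_sum) (auto simp: less_imp_le)
    also have "\<dots> \<le> K" by (simp add: K_def)
    finally show ?thesis by (simp add: divide_le_eq)
  next
    case False
    then have "ln (u n) < real n * \<theta>'" using N[of n] by (simp add: field_simps)
    then have "exp (ln (u n)) \<le> exp (real n * \<theta>')" by simp
    then have "u n \<le> exp \<theta>' ^ n" using pos[of n] by (simp add: exp_of_nat_mult)
    also have "\<dots> \<le> K * exp \<theta>' ^ n"
      using mult_right_mono[of 1 K "exp \<theta>' ^ n"] S by (simp add: K_def)
    finally show ?thesis .
  qed
  moreover have "0 < K" using S by (simp add: K_def)
  ultimately show ?thesis by blast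
qed

text \<open>The pair \<open>i, j\<close> is arbitrary so that upper and lower triangular letters are treated together.\<close>
locale triangular_matrix_product = invertible_matrix_product +
  fixes i j :: 2
  assumes ij: "i \<noteq> j"
    and triangular: "\<And>k. k < s \<Longrightarrow> A k $ j $ i = 0"
    and not_all_diagonal: "\<exists>k<s. A k $ i $ j \<noteq> 0"
begin

lemma diagonal_pos:
  assumes "k < s" shows "0 < A k $ i $ i" "0 < A k $ j $ j"
proof -
  have "A k $ i $ i \<noteq> 0" "A k $ j $ j \<noteq> 0"
    using det_nonzero[OF assms] triangular[OF assms] by (auto simp: det_over_2[OF ij])
  then show "0 < A k $ i $ i" "0 < A k $ j $ j" using nonneg[OF assms] by (simp_all add: less_le)
qed

definition drift :: real where
  "drift = mean (\<lambda>k. ln (A k $ i $ i)) - mean (\<lambda>k. ln (A k $ j $ j))"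

text \<open>
  For triangular \<open>P \<omega> n\<close> the direction of the column \<open>i\<close> is constant, and that of the column \<open>j\<close> is
  determined by \<open>slope\<close>, which grows by \<open>ratio \<omega> n * slope_step (\<omega> n)\<close> in one step.
\<close>
definition ratio :: "(nat \<Rightarrow> nat) \<Rightarrow> nat \<Rightarrow> real" where
  "ratio \<omega> n = P \<omega> n $ i $ i / P \<omega> n $ j $ j"

definition slope :: "(nat \<Rightarrow> nat) \<Rightarrow> nat \<Rightarrow> real" where
  "slope \<omega> n = P \<omega> n $ i $ j / P \<omega> n $ j $ j"

definition slope_step :: "nat \<Rightarrow> real" where
  "slope_step k = A k $ i $ j / A k $ j $ j"

lemma P_Suc_entry:
  "P \<omega> (Suc n) $ a $ b = P \<omega> n $ a $ i * A (\<omega> n) $ i $ b + P \<omega> n $ a $ j * A (\<omega> n) $ j $ b"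
  by (simp add: matrix_matrix_mult_def sum_over_2[OF ij])

lemma P_triangular:
  assumes "\<omega> \<in> space \<B>" shows "P \<omega> n $ j $ i = 0"
proof (induction n)
  case 0
  show ?case using ij by (simp add: mat_def)
qed (simp only: P_Suc_entry triangular[OF letter_less[OF assms]] mult_zero_left mult_zero_right add_0)

lemma P_diagonal_Suc:
  assumes "\<omega> \<in> space \<B>"
  shows "P \<omega> (Suc n) $ i $ i = P \<omega> n $ i $ i * A (\<omega> n) $ i $ i"
    and "P \<omega> (Suc n) $ j $ j = P \<omega> n $ j $ j * A (\<omega> n) $ j $ j"
  by (simp_all only: P_Suc_entry triangular[OF letter_less[OF assms]] P_triangular[OF assms]
        mult_zero_left mult_zero_right add_0 add_0_right)

lemma P_diagonal_pos:
  assumes "\<omega> \<in> space \<B>" shows "0 < P \<omega> n $ i $ i" "0 < P \<omega> n $ j $ j"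
proof -
  have "0 < P \<omega> n $ i $ i \<and> 0 < P \<omega> n $ j $ j"
  proof (induction n)
    case 0
    show ?case by (simp add: mat_def)
  next
    case (Suc n)
    then show ?case unfolding P_diagonal_Suc[OF assms]
      using diagonal_pos[OF letter_less[OF assms], of n] by simp
  qed
  then show "0 < P \<omega> n $ i $ i" "0 < P \<omega> n $ j $ j" by auto
qed

lemma ln_P_diagonal:
  assumes "\<omega> \<in> space \<B>"
  shows "ln (P \<omega> n $ i $ i) = (\<Sum>m<n. ln (A (\<omega> m) $ i $ i))"
    and "ln (P \<omega> n $ j $ j) = (\<Sum>m<n. ln (A (\<omega> m) $ j $ j))"
proof -
  have "ln (P \<omega> n $ i $ i) = (\<Sum>m<n. ln (A (\<omega> m) $ i $ i)) \<and>
        ln (P \<omega> n $ j $ j) = (\<Sum>m<n. ln (A (\<omega> m) $ j $ j))"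
  proof (induction n)
    case 0
    show ?case by (simp add: mat_def)
  next
    case (Suc n)
    then show ?case unfolding P_diagonal_Suc[OF assms]
      using diagonal_pos[OF letter_less[OF assms], of n] P_diagonal_pos[OF assms, of n]
      by (simp add: ln_mult)
  qed
  then show "ln (P \<omega> n $ i $ i) = (\<Sum>m<n. ln (A (\<omega> m) $ i $ i))"
    "ln (P \<omega> n $ j $ j) = (\<Sum>m<n. ln (A (\<omega> m) $ j $ j))" by auto
qed

lemma ratio_pos: "\<omega> \<in> space \<B> \<Longrightarrow> 0 < ratio \<omega> n"
  by (simp add: ratio_def P_diagonal_pos)

lemma ratio_rate: "AE \<omega> in \<B>. (\<lambda>n. ln (ratio \<omega> n) / real n) \<longlonglongrightarrow> drift"
  using law_of_large_numbers[of "\<lambda>k. ln (A k $ i $ i)"] law_of_large_numbers[of "\<lambda>k. ln (A k $ j $ j)"] AE_space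
proof eventually_elim
  case (elim \<omega>)
  have "ln (ratio \<omega> n) / real n = (\<Sum>m<n. ln (A (\<omega> m) $ i $ i)) / real n - (\<Sum>m<n. ln (A (\<omega> m) $ j $ j)) / real n" for n
    using P_diagonal_pos[OF elim(3), of n]
    by (simp add: ratio_def ln_div ln_P_diagonal[OF elim(3)] diff_divide_distrib)
  then show ?case unfolding drift_def using tendsto_diff[OF elim(1,2)] by simp
qed

lemma slope_0: "slope \<omega> 0 = 0"
  using ij by (simp add: slope_def mat_def)

lemma slope_Suc:
  assumes "\<omega> \<in> space \<B>"
  shows "slope \<omega> (Suc n) = slope \<omega> n + ratio \<omega> n * slope_step (\<omega> n)"
proof -
  have "slope \<omega> (Suc n) = (P \<omega> n $ i $ i * A (\<omega> n) $ i $ j + P \<omega> n $ i $ j * A (\<omega> n) $ j $ j)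
      / (P \<omega> n $ j $ j * A (\<omega> n) $ j $ j)"
    by (simp only: slope_def P_diagonal_Suc[OF assms]) (simp only: P_Suc_entry)
  then show ?thesis
    using diagonal_pos[OF letter_less[OF assms], of n] P_diagonal_pos[OF assms, of n]
    by (simp add: slope_def ratio_def slope_step_def field_simps)
qed

lemma slope_step_nonneg: "k < s \<Longrightarrow> 0 \<le> slope_step k"
  by (simp add: slope_step_def nonneg)

lemma slope_step_bounded: "\<exists>c>0. \<forall>k<s. slope_step k \<le> c"
proof (intro exI conjI allI impI)
  show "0 < 1 + (\<Sum>k<s. slope_step k)"
    by (intro add_pos_nonneg sum_nonneg) (auto simp: slope_step_nonneg)
  show "slope_step k \<le> 1 + (\<Sum>k<s. slope_step k)" if "k < s" for k
    using member_le_sum[of k "{..<s}" slope_step] that slope_step_nonneg by simp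
qed

lemma slope_mono:
  assumes "\<omega> \<in> space \<B>" "m \<le> n" shows "slope \<omega> m \<le> slope \<omega> n"
proof (rule lift_Suc_mono_le[OF _ assms(2)])
  show "slope \<omega> n \<le> slope \<omega> (Suc n)" for n
    unfolding slope_Suc[OF assms(1)]
    using ratio_pos[OF assms(1), of n] slope_step_nonneg[OF letter_less[OF assms(1)], of n] by simp
qed

lemma slope_nonneg: "\<omega> \<in> space \<B> \<Longrightarrow> 0 \<le> slope \<omega> n"
  using slope_mono[of \<omega> 0 n] by (simp add: slope_0)

lemma column_sums:
  assumes "\<omega> \<in> space \<B>"
  shows "col_sum (P \<omega> n) i = P \<omega> n $ i $ i" "col_sum (P \<omega> n) j = P \<omega> n $ j $ j * (1 + slope \<omega> n)"
  using P_diagonal_pos[OF assms, of n]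
  by (auto simp: col_sum_def sum_over_2[OF ij] P_triangular[OF assms] slope_def field_simps)

lemma col_sum_prod: "col_sum (M :: real^2^2) 1 * col_sum M 2 = col_sum M i * col_sum M j"
  using ij exhaust_2[of i] exhaust_2[of j] by (auto simp: mult.commute)

lemma det_P: "\<omega> \<in> space \<B> \<Longrightarrow> det (P \<omega> n) = P \<omega> n $ i $ i * P \<omega> n $ j $ j"
  by (simp add: det_over_2[OF ij] P_triangular)

lemma det_exponent_diagonal:
  "det_exponent = mean (\<lambda>k. ln (A k $ i $ i)) + mean (\<lambda>k. ln (A k $ j $ j))"
proof -
  have "det_exponent = mean (\<lambda>k. ln (A k $ i $ i) + ln (A k $ j $ j))"
    unfolding det_exponent_def
  proof (intro sum.cong refl arg_cong2[where f = "(*)"])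
    fix k assume "k \<in> {..<s}"
    then have k: "k < s" by simp
    show "ln \<bar>det (A k)\<bar> = ln (A k $ i $ i) + ln (A k $ j $ j)"
      using diagonal_pos[OF k] by (simp add: det_over_2[OF ij] triangular[OF k] abs_mult ln_mult)
  qed
  then show ?thesis by (simp add: distrib_left sum.distrib)
qed

lemma lower_diagonal_le_top: "mean (\<lambda>k. ln (A k $ j $ j)) \<le> top_exponent"
proof -
  have "AE \<omega> in \<B>. mean (\<lambda>k. ln (A k $ j $ j)) \<le> top_exponent"
    using law_of_large_numbers[of "\<lambda>k. ln (A k $ j $ j)"] top_exponent_limit AE_space
  proof eventually_elim
    case (elim \<omega>)
    have "(\<Sum>m<n. ln (A (\<omega> m) $ j $ j)) / real n \<le> ln (entry_sum (P \<omega> n)) / real n" for n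
      unfolding ln_P_diagonal(2)[OF elim(3), symmetric]
      by (intro divide_right_mono ln_mono P_diagonal_pos elim entry_le_entry_sum P_nonneg) simp
    then show ?case by (intro LIMSEQ_le[OF elim(1,2)]) auto
  qed
  then show ?thesis by simp
qed

text \<open>
  The gap between the columns is \<open>1 / (1 + slope \<omega> n)\<close>. A letter with \<open>slope_step k > 0\<close> occurs with
  frequency \<open>p k\<close>, hence at some time \<open>m\<close> with \<open>q * n \<le> m < n\<close>, where \<open>q = p k / 4\<close>; at that time the
  slope is increased by a multiple of \<open>ratio \<omega> m\<close>, which is exponentially large in \<open>m\<close> and so in \<open>n\<close>.
\<close>
lemma positive_drift:
  assumes "0 < drift"
  shows "AE \<omega> in \<B>. contracting (P \<omega>)"
proof -
  obtain k where k: "k < s" "A k $ i $ j \<noteq> 0" using not_all_diagonal by blast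
  then have step: "0 < slope_step k"
    using nonneg[OF k(1), of i j] diagonal_pos[OF k(1)] by (simp add: slope_step_def less_le)
  show ?thesis
    using letter_frequency[OF k(1)] ratio_rate AE_space
  proof eventually_elim
    case (elim \<omega>)
    note \<omega> = elim(3)
    have "ln (1 / ratio \<omega> n) = - ln (ratio \<omega> n)" for n
      using ratio_pos[OF \<omega>, of n] by (simp add: ln_div)
    then have "(\<lambda>n. ln (1 / ratio \<omega> n) / real n) \<longlonglongrightarrow> - drift"
      using tendsto_minus[OF elim(2)] by simp
    then obtain K where K: "0 < K" "\<And>n. 1 / ratio \<omega> n \<le> K * exp (- drift / 2) ^ n"
      using subexponential_bound[of "\<lambda>n. 1 / ratio \<omega> n" "- drift" "- drift / 2"] ratio_pos[OF \<omega>] assms by auto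
    define q where "q = p k / 4"
    have q: "0 < q" using p_pos[OF k(1)] by (simp add: q_def)
    define occ where "occ n = (\<Sum>m<n. of_bool (\<omega> m = k) :: real)" for n
    have "eventually (\<lambda>n. p k / 2 < occ n / real n) sequentially"
      using elim(1) unfolding occ_def by (rule order_tendstoD(1)) (use p_pos[OF k(1)] in simp)
    then obtain N where N: "\<And>n. n \<ge> N \<Longrightarrow> p k / 2 < occ n / real n" by (auto simp: eventually_sequentially)
    obtain N' :: nat where N': "1 / q \<le> real N'" using real_arch_simple by blast
    have recent: "\<exists>m<n. q * real n \<le> real m \<and> \<omega> m = k" if n: "n \<ge> max N (Suc N')" for n
    proof (rule ccontr)
      assume none: "\<not> ?thesis"
      have "occ n \<le> (\<Sum>m<n. of_bool (real m < q * real n))"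
        unfolding occ_def using none by (intro sum_mono) (auto simp: not_le)
      also have "\<dots> = real (card ({..<n} \<inter> {m. real m < q * real n}))" by simp
      also have "\<dots> \<le> real (card {..<nat \<lceil>q * real n\<rceil>})"
        by (intro of_nat_mono card_mono) (auto simp: less_ceiling_iff zless_nat_eq_int_zless)
      also have "\<dots> \<le> q * real n + 1" using q by (simp add: of_nat_nat ceiling_correct)
      finally have "occ n \<le> q * real n + 1" .
      moreover have "2 * q * real n < occ n" using N[of n] n by (simp add: q_def field_simps)
      ultimately have "q * real n < 1" by simp
      moreover have "1 \<le> q * real n"
      proof -
        have "1 / q \<le> real n" using N' n by simp
        then show ?thesis using q by (simp add: field_simps)
      qed
      ultimately show False by simp
    qed
    define C where "C = K / slope_step k"
    define r where "r = exp (- drift / 2 * q)"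
    have r: "0 < r" "r < 1" using assms q by (auto simp: r_def)
    have bound: "1 \<le> C * r ^ n * (1 + slope \<omega> n)" if n: "n \<ge> max N (Suc N')" for n
    proof -
      obtain m where m: "m < n" "q * real n \<le> real m" "\<omega> m = k" using recent[OF n] by blast
      have decay: "exp (- drift / 2) ^ m \<le> r ^ n"
        using m(2) assms unfolding r_def
        by (simp add: mult_le_cancel_left flip: exp_of_nat_mult) (simp add: mult.commute)
      have slope_ge: "ratio \<omega> m * slope_step k \<le> 1 + slope \<omega> n"
        using slope_Suc[OF \<omega>, of m] slope_nonneg[OF \<omega>, of m] slope_mono[OF \<omega>, of "Suc m" n] m by simp
      have "1 \<le> K * exp (- drift / 2) ^ m * ratio \<omega> m"
        using K(2)[of m] ratio_pos[OF \<omega>, of m] by (simp add: divide_le_eq)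
      also have "\<dots> \<le> K * r ^ n * ratio \<omega> m"
        using K(1) ratio_pos[OF \<omega>, of m] decay r by (intro mult_right_mono mult_left_mono) auto
      also have "\<dots> = C * r ^ n * (ratio \<omega> m * slope_step k)"
        using step by (simp add: C_def)
      also have "\<dots> \<le> C * r ^ n * (1 + slope \<omega> n)"
        using K(1) step r by (intro mult_left_mono slope_ge) (simp add: C_def)
      finally show ?thesis .
    qed
    show ?case
      unfolding contracting_def
    proof (intro exI conjI allI impI)
      fix n assume n: "max N (Suc N') \<le> n"
      have pos: "0 \<le> P \<omega> n $ i $ i * P \<omega> n $ j $ j" using P_diagonal_pos[OF \<omega>, of n] by simp
      have "\<bar>det (P \<omega> n)\<bar> = P \<omega> n $ i $ i * P \<omega> n $ j $ j * 1" using pos by (simp add: det_P[OF \<omega>])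
      also have "\<dots> \<le> P \<omega> n $ i $ i * P \<omega> n $ j $ j * (C * r ^ n * (1 + slope \<omega> n))"
        by (rule mult_left_mono[OF bound[OF n] pos])
      also have "\<dots> = C * r ^ n * (col_sum (P \<omega> n) 1 * col_sum (P \<omega> n) 2)"
        unfolding col_sum_prod column_sums[OF \<omega>] by (simp only: mult_ac)
      finally show "\<bar>det (P \<omega> n)\<bar> \<le> C * r ^ n * (col_sum (P \<omega> n) 1 * col_sum (P \<omega> n) 2)" .
    qed (use r in auto)
  qed
qed

text \<open>On the nonnegative quadrant \<open>t \<mapsto> t / (1 + t)\<close> contracts distances of slopes.\<close>
lemma direction_gap_slopes:
  fixes x y :: "real^2"
  assumes x: "nonneg_vec x" "0 < x $ j" and y: "nonneg_vec y" "0 < y $ j"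
  shows "\<bar>normalized_vec x $ l - normalized_vec y $ l\<bar> \<le> \<bar>x $ i / x $ j - y $ i / y $ j\<bar>"
proof -
  have nn: "0 \<le> x $ i" "0 \<le> y $ i" using x y by (auto simp: nonneg_vec_def)
  have nz: "x \<noteq> 0" "y \<noteq> 0" using x y by auto
  have norms: "norm1 x = x $ i + x $ j" "norm1 y = y $ i + y $ j"
    using x y nn by (auto simp: norm1_def sum_over_2[OF ij])
  have "\<bar>x$1 * y$2 - x$2 * y$1\<bar> = \<bar>x$i * y$j - x$j * y$i\<bar>"
    using ij exhaust_2[of i] exhaust_2[of j] by (auto simp: abs_minus_commute mult.commute)
  then have "\<bar>normalized_vec x $ l - normalized_vec y $ l\<bar> = \<bar>x$i * y$j - x$j * y$i\<bar> / (norm1 x * norm1 y)"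
    by (simp add: normalized_vec_diff[OF x(1) y(1) nz])
  also have "\<dots> \<le> \<bar>x$i * y$j - x$j * y$i\<bar> / (x$j * y$j)"
    using x y nn unfolding norms by (intro divide_left_mono mult_mono) (auto intro!: mult_pos_pos add_nonneg_pos)
  also have "\<dots> = \<bar>(x$i * y$j - x$j * y$i) / (x$j * y$j)\<bar>" using x y by (simp add: abs_mult)
  also have "(x$i * y$j - x$j * y$i) / (x$j * y$j) = x $ i / x $ j - y $ i / y $ j"
    using x y by (simp add: field_simps)
  finally show ?thesis .
qed

text \<open>
  Now \<open>ratio\<close> decays exponentially, so \<open>slope\<close> converges geometrically, and the slope of \<open>P \<omega> n *v V\<close>,
  which is \<open>ratio \<omega> n * (V $ i / V $ j) + slope \<omega> n\<close>, converges with it. If \<open>V $ j = 0\<close> the direction is constant.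
  The exponents differ because \<open>top_exponent\<close> is at least the rate of the larger diagonal entry.
\<close>
lemma negative_drift:
  assumes "drift < 0"
  shows "AE \<omega> in \<B>. directions_converge (P \<omega>) \<and> distinct_singular_growth (P \<omega>)"
proof -
  have "det_exponent \<noteq> 2 * top_exponent"
    using lower_diagonal_le_top assms unfolding det_exponent_diagonal drift_def by linarith
  with distinct_iff have distinct: "AE \<omega> in \<B>. distinct_singular_growth (P \<omega>)" by simp
  obtain c where c: "0 < c" "\<And>k. k < s \<Longrightarrow> slope_step k \<le> c" using slope_step_bounded by blast
  define r where "r = exp (drift / 2)"
  have r: "0 < r" "r < 1" using assms by (auto simp: r_def)
  have "AE \<omega> in \<B>. directions_converge (P \<omega>)"
    using ratio_rate AE_space
  proof eventually_elim
    case (elim \<omega>)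
    note \<omega> = elim(2)
    obtain K where K: "0 < K" "\<And>n. ratio \<omega> n \<le> K * r ^ n"
      using subexponential_bound[of "ratio \<omega>" drift "drift / 2"] ratio_pos[OF \<omega>] elim(1) assms
      by (auto simp: r_def)
    define D where "D = c * K / (1 - r)"
    have D: "0 < D" using c K r by (simp add: D_def)
    have "slope \<omega> (n + l) \<le> slope \<omega> n + D * r ^ n * (1 - r ^ l)" for n l
    proof (induction l)
      case (Suc l)
      have "ratio \<omega> (n + l) * slope_step (\<omega> (n + l)) \<le> (K * r ^ (n + l)) * c"
        using K c ratio_pos[OF \<omega>, of "n + l"] r slope_step_nonneg[OF letter_less[OF \<omega>]] letter_less[OF \<omega>]
        by (intro mult_mono) (auto simp: less_imp_le)
      also have "\<dots> = D * r ^ n * (r ^ l - r ^ Suc l)"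
        using r by (simp add: D_def power_add field_simps)
      finally show ?case using Suc slope_Suc[OF \<omega>, of "n + l"] by (simp add: algebra_simps)
    qed simp
    moreover have "D * r ^ n * (1 - r ^ l) \<le> D * r ^ n" for n l
      using D r by (intro mult_left_le) auto
    ultimately have tail: "slope \<omega> (n + l) \<le> slope \<omega> n + D * r ^ n" for n l
      by (meson add_left_mono order_trans)
    show ?case
      unfolding directions_converge_def
    proof (intro allI impI)
      fix V :: "real^2" assume V: "nonneg_vec V"
      then have Vnn: "0 \<le> V $ i" "0 \<le> V $ j" by (auto simp: nonneg_vec_def)
      have PV: "(P \<omega> n *v V) $ i = P \<omega> n $ i $ i * V $ i + P \<omega> n $ i $ j * V $ j"
        "(P \<omega> n *v V) $ j = P \<omega> n $ j $ j * V $ j" for n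
        by (simp_all add: matrix_vector_mult_def sum_over_2[OF ij] P_triangular[OF \<omega>])
      show "exp_convergent_along {n. P \<omega> n *v V \<noteq> 0} (\<lambda>n. normalized_vec (P \<omega> n *v V))"
      proof (cases "V $ j = 0")
        case True
        have const: "normalized_vec (P \<omega> n *v V) = axis i 1" if "P \<omega> n *v V \<noteq> 0" for n
        proof -
          have zero: "(P \<omega> n *v V) $ j = 0" using True PV by simp
          have "(P \<omega> n *v V) $ i \<noteq> 0"
          proof
            assume "(P \<omega> n *v V) $ i = 0"
            then have "\<forall>l. (P \<omega> n *v V) $ l = 0" using zero ij exhaust_2[of i] exhaust_2[of j] by (auto simp: forall_2)
            then show False using that by (simp add: vec_eq_iff)
          qed
          moreover have "0 \<le> (P \<omega> n *v V) $ i" using nonneg_mat_vec[OF P_nonneg[OF \<omega>] V] by (simp add: nonneg_vec_def)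
          ultimately have "normalized_vec (P \<omega> n *v V) $ l = axis i 1 $ l" for l
            using zero ij exhaust_2[of i] exhaust_2[of j] exhaust_2[of l]
            by (auto simp: normalized_vec_def norm1_def sum_over_2[OF ij] axis_def)
          then show ?thesis by (simp add: vec_eq_iff)
        qed
        show ?thesis
          by (rule exp_convergent_alongI[OF r, of _ 0 _ "axis i 1" 0]) (simp add: const)
      next
        case False
        then have Vj: "0 < V $ j" using Vnn by simp
        define v where "v = V $ i / V $ j"
        have v: "0 \<le> v" using Vnn by (simp add: v_def)
        have pos: "0 < (P \<omega> n *v V) $ j" for n using PV Vj P_diagonal_pos[OF \<omega>] by simp
        have quot: "(P \<omega> n *v V) $ i / (P \<omega> n *v V) $ j = ratio \<omega> n * v + slope \<omega> n" for n
          using P_diagonal_pos[OF \<omega>, of n] Vj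
          by (simp add: PV ratio_def slope_def v_def field_simps)
        show ?thesis
        proof (rule exp_cauchy_along_imp_convergent[OF r, of _ 0 _ "K * v + D"])
          fix m n :: nat and l :: 2 assume "n \<le> m"
          then obtain d where d: "m = n + d" using le_Suc_ex by blast
          have gap: "\<bar>normalized_vec (P \<omega> n *v V) $ l - normalized_vec (P \<omega> m *v V) $ l\<bar>
              \<le> \<bar>(ratio \<omega> n * v + slope \<omega> n) - (ratio \<omega> m * v + slope \<omega> m)\<bar>"
            unfolding quot[symmetric]
            by (intro direction_gap_slopes nonneg_mat_vec P_nonneg \<omega> V pos)
          have triangle: "\<bar>(ratio \<omega> n * v + slope \<omega> n) - (ratio \<omega> m * v + slope \<omega> m)\<bar>
              \<le> \<bar>ratio \<omega> n - ratio \<omega> m\<bar> * v + \<bar>slope \<omega> n - slope \<omega> m\<bar>"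
          proof -
            have "(ratio \<omega> n * v + slope \<omega> n) - (ratio \<omega> m * v + slope \<omega> m) = (ratio \<omega> n - ratio \<omega> m) * v + (slope \<omega> n - slope \<omega> m)"
              by (simp add: algebra_simps)
            moreover have "\<bar>(ratio \<omega> n - ratio \<omega> m) * v\<bar> = \<bar>ratio \<omega> n - ratio \<omega> m\<bar> * v" using v by (simp add: abs_mult)
            ultimately show ?thesis using abs_triangle_ineq[of "(ratio \<omega> n - ratio \<omega> m) * v" "slope \<omega> n - slope \<omega> m"] by (simp only:)
          qed
          have bound: "\<bar>ratio \<omega> n - ratio \<omega> m\<bar> * v + \<bar>slope \<omega> n - slope \<omega> m\<bar> \<le> (K * r ^ n) * v + D * r ^ n"
          proof (intro add_mono mult_right_mono v)
            have "K * r ^ m \<le> K * r ^ n" using K r \<open>n \<le> m\<close> by (intro mult_left_mono power_decreasing) auto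
            then show "\<bar>ratio \<omega> n - ratio \<omega> m\<bar> \<le> K * r ^ n"
              using K(2)[of n] K(2)[of m] ratio_pos[OF \<omega>, of n] ratio_pos[OF \<omega>, of m] by linarith
            show "\<bar>slope \<omega> n - slope \<omega> m\<bar> \<le> D * r ^ n"
              using tail[of n d] slope_mono[OF \<omega> \<open>n \<le> m\<close>] d by simp
          qed
          have "(K * v + D) * r ^ n = (K * r ^ n) * v + D * r ^ n" by (simp add: algebra_simps)
          then show "\<bar>normalized_vec (P \<omega> n *v V) $ l - normalized_vec (P \<omega> m *v V) $ l\<bar> \<le> (K * v + D) * r ^ n"
            using order_trans[OF gap order_trans[OF triangle bound]] by (simp only:)
        qed
      qed
    qed
  qed
  with distinct show ?thesis by eventually_elim simp
qed

lemma zero_drift_bounds: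
  assumes "drift = 0" "0 < \<epsilon>"
  shows "AE \<omega> in \<B>. \<exists>K>0. \<forall>n. ratio \<omega> n \<le> K * exp \<epsilon> ^ n \<and> 1 / ratio \<omega> n \<le> K * exp \<epsilon> ^ n
           \<and> 1 + slope \<omega> n \<le> K * exp \<epsilon> ^ n"
  using ratio_rate AE_space
proof eventually_elim
  case (elim \<omega>)
  note \<omega> = elim(2)
  define r where "r = exp \<epsilon>"
  have r: "1 < r" using assms(2) by (simp add: r_def)
  obtain K1 where K1: "0 < K1" "\<And>n. ratio \<omega> n \<le> K1 * r ^ n"
    using subexponential_bound[of "ratio \<omega>" drift \<epsilon>] ratio_pos[OF \<omega>] elim(1) assms by (auto simp: r_def)
  have "ln (1 / ratio \<omega> n) = - ln (ratio \<omega> n)" for n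
    using ratio_pos[OF \<omega>, of n] by (simp add: ln_div)
  then have "(\<lambda>n. ln (1 / ratio \<omega> n) / real n) \<longlonglongrightarrow> 0"
    using tendsto_minus[OF elim(1)] assms(1) by simp
  then obtain K2 where K2: "0 < K2" "\<And>n. 1 / ratio \<omega> n \<le> K2 * r ^ n"
    using subexponential_bound[of "\<lambda>n. 1 / ratio \<omega> n" 0 \<epsilon>] ratio_pos[OF \<omega>] assms by (auto simp: r_def)
  obtain c where c: "0 < c" "\<And>k. k < s \<Longrightarrow> slope_step k \<le> c" using slope_step_bounded by blast
  define K3 where "K3 = c * K1 / (r - 1)"
  have K3: "0 < K3" using c K1 r by (simp add: K3_def)
  have slope_le: "slope \<omega> n \<le> K3 * r ^ n" for n
  proof (induction n)
    case 0
    then show ?case using K3 by (simp add: slope_0)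
  next
    case (Suc n)
    have "ratio \<omega> n * slope_step (\<omega> n) \<le> (K1 * r ^ n) * c"
      using K1 c r ratio_pos[OF \<omega>, of n] slope_step_nonneg[OF letter_less[OF \<omega>]] letter_less[OF \<omega>]
      by (intro mult_mono) (auto simp: less_imp_le)
    also have "\<dots> = K3 * r ^ Suc n - K3 * r ^ n"
    proof -
      have "K3 * (r - 1) = c * K1" using r by (simp add: K3_def)
      then have "(K1 * r ^ n) * c = (K3 * (r - 1)) * r ^ n" by simp
      then show ?thesis by (simp add: algebra_simps)
    qed
    finally show ?case using Suc slope_Suc[OF \<omega>, of n] by simp
  qed
  define K where "K = K1 + K2 + K3 + 1"
  have pw: "1 \<le> r ^ n" for n using r by simp
  have le: "K' * r ^ n \<le> K * r ^ n" if "K' \<le> K" for K' n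
    using that pw[of n] by (intro mult_right_mono) auto
  have "1 + slope \<omega> n \<le> K * r ^ n" for n
  proof -
    have "1 + slope \<omega> n \<le> (K3 + 1) * r ^ n" using slope_le[of n] pw[of n] by (simp add: algebra_simps)
    also have "\<dots> \<le> K * r ^ n" by (rule le) (use K1 K2 in \<open>simp add: K_def\<close>)
    finally show ?thesis .
  qed
  moreover have "ratio \<omega> n \<le> K * r ^ n" "1 / ratio \<omega> n \<le> K * r ^ n" for n
    using K1(2)[of n] K2(2)[of n] le[of K1 n] le[of K2 n] K1(1) K2(1) K3 by (simp_all add: K_def)
  moreover have "0 < K" using K1 K2 K3 by (simp add: K_def)
  ultimately show ?case unfolding r_def by blast
qed

text \<open>The norm is the diagonal entry at \<open>j\<close> times the subexponential factor \<open>ratio \<omega> n + 1 + slope \<omega> n\<close>.\<close>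
lemma zero_drift_exponents:
  assumes "drift = 0" shows "2 * top_exponent \<le> det_exponent"
proof -
  let ?d = "mean (\<lambda>k. ln (A k $ j $ j))"
  have "top_exponent \<le> ?d + \<epsilon>" if \<epsilon>: "0 < \<epsilon>" for \<epsilon>
  proof -
    have "AE \<omega> in \<B>. top_exponent \<le> ?d + \<epsilon>"
      using zero_drift_bounds[OF assms \<epsilon>] top_exponent_limit law_of_large_numbers[of "\<lambda>k. ln (A k $ j $ j)"] AE_space
    proof eventually_elim
      case (elim \<omega>)
      note \<omega> = elim(4)
      obtain K where K: "0 < K" "\<And>n. ratio \<omega> n \<le> K * exp \<epsilon> ^ n" "\<And>n. 1 + slope \<omega> n \<le> K * exp \<epsilon> ^ n"
        using elim(1) by blast
      have bound: "ln (entry_sum (P \<omega> n)) / real n \<le> (\<Sum>m<n. ln (A (\<omega> m) $ j $ j)) / real n + ln (2 * K) / real n + \<epsilon>"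
        if n: "n \<ge> 1" for n
      proof -
        note d = P_diagonal_pos(2)[OF \<omega>, of n]
        have "entry_sum (P \<omega> n) = P \<omega> n $ j $ j * (ratio \<omega> n + (1 + slope \<omega> n))"
          using d by (simp add: entry_sum_def sum_over_2[OF ij] column_sums[OF \<omega>] ratio_def field_simps)
        also have "\<dots> \<le> P \<omega> n $ j $ j * (2 * K * exp \<epsilon> ^ n)"
          using d K(2)[of n] K(3)[of n] by (intro mult_left_mono) auto
        finally have "ln (entry_sum (P \<omega> n)) \<le> ln (P \<omega> n $ j $ j * (2 * K * exp \<epsilon> ^ n))"
          using P_entry_sum_pos[OF \<omega>, of n] by (intro ln_mono)
        also have "\<dots> = (\<Sum>m<n. ln (A (\<omega> m) $ j $ j)) + (ln (2 * K) + real n * \<epsilon>)"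
          using d K(1) by (simp add: ln_mult_pos ln_P_diagonal[OF \<omega>, symmetric] ln_realpow)
        finally have "ln (entry_sum (P \<omega> n)) / real n \<le> ((\<Sum>m<n. ln (A (\<omega> m) $ j $ j)) + (ln (2 * K) + real n * \<epsilon>)) / real n"
          by (rule divide_right_mono) simp
        then show ?thesis using n by (simp add: add_divide_distrib)
      qed
      have "(\<lambda>n. (\<Sum>m<n. ln (A (\<omega> m) $ j $ j)) / real n + ln (2 * K) / real n + \<epsilon>) \<longlonglongrightarrow> ?d + 0 + \<epsilon>"
        by (intro tendsto_intros elim lim_const_over_n)
      from LIMSEQ_le[OF elim(2) this] show ?case using bound by auto
    qed
    then show ?thesis by simp
  qed
  then have "top_exponent \<le> ?d" by (rule field_le_epsilon)
  then show ?thesis using assms unfolding det_exponent_diagonal drift_def by linarith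
qed

text \<open>
  Exponential convergence would bound the steps of \<open>q n = 1 / (1 + slope \<omega> n)\<close> by a multiple of \<open>r ^ n\<close>.
  But a step caused by a letter with \<open>slope_step k > 0\<close> is
  \<open>ratio \<omega> n * slope_step k / ((1 + slope \<omega> n) * (1 + slope \<omega> (Suc n)))\<close>, which is not exponentially small,
  and such letters occur infinitely often.
\<close>
lemma zero_drift_columns:
  assumes "drift = 0"
  shows "AE \<omega> in \<B>. \<not> normalized_columns_exp_convergent (P \<omega>)"
proof -
  obtain k where k: "k < s" "A k $ i $ j \<noteq> 0" using not_all_diagonal by blast
  then have step: "0 < slope_step k"
    using nonneg[OF k(1), of i j] diagonal_pos[OF k(1)] by (simp add: slope_step_def less_le)
  have "AE \<omega> in \<B>. \<forall>N::nat. \<exists>K>0. \<forall>n. ratio \<omega> n \<le> K * exp (1 / Suc N) ^ n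
      \<and> 1 / ratio \<omega> n \<le> K * exp (1 / Suc N) ^ n \<and> 1 + slope \<omega> n \<le> K * exp (1 / Suc N) ^ n"
    unfolding AE_all_countable by (intro allI zero_drift_bounds[OF assms]) simp
  then show ?thesis
    using letters_infinitely_often AE_space
  proof eventually_elim
    case (elim \<omega>)
    note \<omega> = elim(3)
    define q where "q n = 1 / (1 + slope \<omega> n)" for n
    have q: "normalized_vec (column j (P \<omega> n)) $ j = q n" for n
    proof -
      have "norm1 (column j (P \<omega> n)) = P \<omega> n $ j $ j * (1 + slope \<omega> n)"
        using column_sums(2)[OF \<omega>, of n] P_nonneg[OF \<omega>, of n] by (simp add: norm1_def column_def col_sum_def nonneg_mat_def)
      then show ?thesis using P_diagonal_pos[OF \<omega>, of n] by (simp add: normalized_vec_def column_def q_def divide_simps)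
    qed
    show ?case
    proof
      assume conv: "normalized_columns_exp_convergent (P \<omega>)"
      have "column j (P \<omega> n) \<noteq> 0" for n
      proof
        assume "column j (P \<omega> n) = 0"
        then have "column j (P \<omega> n) $ j = 0" by simp
        then show False using P_diagonal_pos[OF \<omega>, of n] by (simp add: column_def)
      qed
      from exp_convergent_columnD[OF conv this]
      obtain L C r where C: "0 < C" and r: "0 < r" "r < 1"
        and close: "\<And>n l. \<bar>normalized_vec (column j (P \<omega> n)) $ l - L $ l\<bar> < C * r ^ n"
        unfolding exp_convergent_along_def by auto
      have q_close: "q n - q (Suc n) \<le> 2 * C * r ^ n" for n
      proof -
        have "C * r ^ Suc n \<le> C * r ^ n" using C r by (intro mult_left_mono power_decreasing) auto
        then show ?thesis using close[of n j] close[of "Suc n" j] unfolding q by linarith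
      qed
      \<comment> \<open>Three subexponential factors enter a step; \<open>t\<close> is close enough to 1 that \<open>r * t ^ 3 < 1\<close>.\<close>
      obtain N :: nat where N: "1 / real (Suc N) < - ln r / 6"
        using nat_approx_posE[of "- ln r / 6"] r by auto
      define t where "t = exp (1 / real (Suc N))"
      have t: "1 < t" "0 < t" by (simp_all add: t_def)
      have rt: "r * t ^ 3 < 1"
      proof -
        have "r * t ^ 3 = exp (ln r + 3 * (1 / real (Suc N)))"
          using r by (simp add: t_def exp_add flip: exp_of_nat_mult)
        also have "\<dots> < 1"
        proof -
          have "ln r < 0" using r by simp
          then have "ln r + 3 * (1 / real (Suc N)) < 0" using N by linarith
          then show ?thesis by simp
        qed
        finally show ?thesis .
      qed
      obtain K where K: "0 < K" "\<And>n. 1 / ratio \<omega> n \<le> K * t ^ n" "\<And>n. 1 + slope \<omega> n \<le> K * t ^ n"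
        using elim(1)[rule_format, of N] unfolding t_def by blast
      have lower: "slope_step k \<le> 2 * C * K ^ 3 * t * (r * t ^ 3) ^ n" if n: "\<omega> n = k" for n
      proof -
        have s0: "0 < 1 + slope \<omega> n" "0 < 1 + slope \<omega> (Suc n)"
          using slope_nonneg[OF \<omega>, of n] slope_nonneg[OF \<omega>, of "Suc n"] by auto
        have "q n - q (Suc n) = (slope \<omega> (Suc n) - slope \<omega> n) / ((1 + slope \<omega> n) * (1 + slope \<omega> (Suc n)))"
          using s0 by (simp add: q_def field_simps)
        also have "slope \<omega> (Suc n) - slope \<omega> n = ratio \<omega> n * slope_step k" by (simp add: slope_Suc[OF \<omega>] n)
        finally have quotient: "q n - q (Suc n) = ratio \<omega> n * slope_step k / ((1 + slope \<omega> n) * (1 + slope \<omega> (Suc n)))" .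
        have "(1 + slope \<omega> n) * (1 + slope \<omega> (Suc n)) \<noteq> 0" using s0 by simp
        from nonzero_eq_divide_eq[OF this, THEN iffD1, OF quotient] have "slope_step k = (1 / ratio \<omega> n) * ((q n - q (Suc n)) * ((1 + slope \<omega> n) * (1 + slope \<omega> (Suc n))))"
          using ratio_pos[OF \<omega>, of n] by (simp add: field_simps)
        also have "\<dots> \<le> (K * t ^ n) * ((2 * C * r ^ n) * ((K * t ^ n) * (K * t ^ Suc n)))"
        proof (rule mult_mono[OF K(2) mult_mono[OF q_close mult_mono[OF K(3) K(3)]]])
          have "q (Suc n) \<le> q n"
            using slope_mono[OF \<omega>, of n "Suc n"] s0 unfolding q_def by (intro divide_left_mono) auto
          then show "0 \<le> (q n - q (Suc n)) * ((1 + slope \<omega> n) * (1 + slope \<omega> (Suc n)))" using s0 by simp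
        qed (use s0 K C r t in auto)
        also have "\<dots> = 2 * C * K ^ 3 * t * (r * t ^ 3) ^ n"
          by (simp add: power_mult_distrib power3_eq_cube power_mult flip: power_mult[of t 3 n])
        finally show ?thesis .
      qed
      have "(\<lambda>n. 2 * C * K ^ 3 * t * (r * t ^ 3) ^ n) \<longlonglongrightarrow> 2 * C * K ^ 3 * t * 0"
        using r t rt by (intro tendsto_intros LIMSEQ_realpow_zero) auto
      then have "eventually (\<lambda>n. 2 * C * K ^ 3 * t * (r * t ^ 3) ^ n < slope_step k) sequentially"
        using step by (intro order_tendstoD(2)) auto
      then obtain n0 where n0: "\<And>n. n \<ge> n0 \<Longrightarrow> 2 * C * K ^ 3 * t * (r * t ^ 3) ^ n < slope_step k"
        by (auto simp: eventually_sequentially)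
      obtain n where "n \<ge> n0" "\<omega> n = k"
        using elim(2) k(1) unfolding frequently_sequentially by blast
      then show False using n0[of n] lower[of n] by simp
    qed
  qed
qed

lemma zero_drift_weak:
  assumes "drift = 0"
  shows "AE \<omega> in \<B>. \<not> normalized_columns_exp_convergent (P \<omega>) \<and> \<not> distinct_singular_growth (P \<omega>)"
  using zero_drift_columns[OF assms] distinct_iff
  by eventually_elim (use zero_drift_exponents[OF assms] det_exponent_le in auto)

end

section \<open>The dichotomy and the theorem\<close>

text \<open>
  Let \<open>M = A k0\<close> be the letter that is neither diagonal nor antidiagonal. If a diagonal entry of \<open>M\<close>
  vanishes, \<open>M\<close> has three positive entries and \<open>M ** M\<close> is positive. Otherwise \<open>M\<close> has a positive entry at
  some \<open>(a, b)\<close> off the diagonal; as the letters are not all triangular, some letter \<open>N\<close> has a positive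
  entry at \<open>(b, a)\<close>, and \<open>M ** N ** M\<close> is positive.
\<close>
lemma exists_positive_word:
  fixes A :: "nat \<Rightarrow> real^2^2"
  assumes nonneg: "\<And>k i j. k < s \<Longrightarrow> 0 \<le> A k $ i $ j"
    and det: "\<And>k. k < s \<Longrightarrow> det (A k) \<noteq> 0"
    and not_monomial: "k0 < s" "\<not> diagonal_mat (A k0)" "A k0 $ i0 $ i0 \<noteq> 0"
    and not_triangular: "\<And>i j. i \<noteq> j \<Longrightarrow> \<exists>k<s. A k $ i $ j \<noteq> 0"
  shows "\<exists>w. set w \<subseteq> {..<s} \<and> (\<forall>i j. 0 < rand_prod A (\<lambda>i. w ! i) (length w) $ i $ j)"
proof -
  obtain i where i: "A k0 $ i $ i \<noteq> 0" using not_monomial by blast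
  define j :: 2 where "j = (if i = 1 then 2 else 1)"
  have ij: "i \<noteq> j" using exhaust_2[of i] by (auto simp: j_def)
  have two: "l = i \<or> l = j" for l using ij exhaust_2[of i] exhaust_2[of j] exhaust_2[of l] by auto
  note sum2 = sum_over_2[OF ij]
  let ?M = "A k0"
  have M: "0 \<le> ?M $ a $ b" for a b using nonneg[OF not_monomial(1)] .
  have Mi: "0 < ?M $ i $ i" using i M[of i i] by (simp add: less_le)
  have d: "?M $ i $ i * ?M $ j $ j - ?M $ i $ j * ?M $ j $ i \<noteq> 0"
    using det[OF not_monomial(1)] by (simp add: det_over_2[OF ij])
  show ?thesis
  proof (cases "?M $ j $ j = 0")
    case True
    then have off: "0 < ?M $ i $ j" "0 < ?M $ j $ i" using d M[of i j] M[of j i] by (auto simp: less_le)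
    have "0 < (?M ** ?M) $ a $ b" for a b
      using two[of a] two[of b] off Mi M[of j j]
      by (auto simp: matrix_matrix_mult_def sum2 add_pos_nonneg add_nonneg_pos)
    then have "\<forall>a b. 0 < rand_prod A (\<lambda>i. [k0, k0] ! i) (length [k0, k0]) $ a $ b" by simp
    then show ?thesis using not_monomial(1) by (intro exI[of _ "[k0, k0]"]) simp
  next
    case False
    then have Mj: "0 < ?M $ j $ j" using M[of j j] by (simp add: less_le)
    have "\<exists>a b. a \<noteq> b \<and> ?M $ a $ b \<noteq> 0" using not_monomial(2) by (auto simp: diagonal_mat_def)
    then obtain a b where ab: "a \<noteq> b" "0 < ?M $ a $ b" using M by (auto simp: less_le)
    obtain k where k: "k < s" "A k $ b $ a \<noteq> 0" using not_triangular[of b a] ab by auto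
    let ?N = "A k"
    have N: "0 \<le> ?N $ c $ d" for c d using nonneg[OF k(1)] .
    have Nba: "0 < ?N $ b $ a" using k(2) N[of b a] by (simp add: less_le)
    have diag: "0 < ?M $ c $ c" for c using two[of c] Mi Mj by auto
    note sum2' = sum_over_2[OF ab(1)]
    have two': "l = a \<or> l = b" for l using ab(1) two[of a] two[of b] two[of l] by auto
    have MN: "0 < (?M ** ?N) $ c $ a" "0 \<le> (?M ** ?N) $ c $ d" for c d
    proof -
      show "0 < (?M ** ?N) $ c $ a"
        using two'[of c] M N Nba ab diag by (auto simp: matrix_matrix_mult_def sum2' intro!: add_nonneg_pos)
      show "0 \<le> (?M ** ?N) $ c $ d"
        using M N by (auto simp: matrix_matrix_mult_def intro!: sum_nonneg)
    qed
    have "0 < (?M ** ?N ** ?M) $ c $ d" for c d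
    proof -
      have expand: "(?M ** ?N ** ?M) $ c $ d = (?M ** ?N) $ c $ a * ?M $ a $ d + (?M ** ?N) $ c $ b * ?M $ b $ d"
        by (simp add: matrix_matrix_mult_def[of "?M ** ?N"] sum2')
      have "0 < ?M $ a $ d" using two'[of d] ab(2) diag by auto
      then show ?thesis unfolding expand using MN M by (intro add_pos_nonneg) auto
    qed
    then have "\<forall>c d. 0 < rand_prod A (\<lambda>i. [k0, k, k0] ! i) (length [k0, k, k0]) $ c $ d"
      by (simp add: numeral_2_eq_2)
    then show ?thesis using not_monomial(1) k(1) by (intro exI[of _ "[k0, k, k0]"]) simp
  qed
qed

context random_matrix_product
begin

theorem dichotomy:
  assumes nondiag: "\<exists>k<s. \<not> diagonal_mat (A k)"
  shows "(AE \<omega> in \<B>. directions_converge (P \<omega>) \<and> distinct_singular_growth (P \<omega>)) \<or>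
         (AE \<omega> in \<B>. \<not> normalized_columns_exp_convergent (P \<omega>) \<and> \<not> distinct_singular_growth (P \<omega>))"
proof (cases "\<exists>k<s. det (A k) = 0")
  case True
  then show ?thesis using singular_letter by blast
next
  case False
  then interpret invertible_matrix_product s p A by unfold_locales auto
  show ?thesis
  proof (cases "\<exists>i j. i \<noteq> j \<and> (\<forall>k<s. A k $ j $ i = 0)")
    case True
    then obtain i j :: 2 where ij: "i \<noteq> j" and tri: "\<And>k. k < s \<Longrightarrow> A k $ j $ i = 0" by blast
    have "\<exists>k<s. A k $ i $ j \<noteq> 0"
    proof -
      obtain k a b where k: "k < s" "a \<noteq> b" "A k $ a $ b \<noteq> 0" using nondiag by (auto simp: diagonal_mat_def)
      have "a = i \<and> b = j \<or> a = j \<and> b = i"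
        using k(2) ij exhaust_2[of a] exhaust_2[of b] exhaust_2[of i] exhaust_2[of j] by auto
      then show ?thesis using k tri[OF k(1)] by auto
    qed
    then interpret triangular_matrix_product s p A i j using ij tri by unfold_locales auto
    consider "drift < 0" | "drift = 0" | "0 < drift" by linarith
    then show ?thesis
      by cases (use negative_drift zero_drift_weak contracting_strong positive_drift in blast)+
  next
    case not_tri: False
    show ?thesis
    proof (cases "\<forall>k<s. diagonal_mat (A k) \<or> (\<forall>i. A k $ i $ i = 0)")
      case True
      then interpret monomial_matrix_product s p A using nondiag by unfold_locales auto
      show ?thesis using monomial_weak by blast
    next
      case False
      then obtain k i where k: "k < s" "\<not> diagonal_mat (A k)" "A k $ i $ i \<noteq> 0" by blast
      have "\<exists>w. set w \<subseteq> {..<s} \<and> (\<forall>i j. 0 < rand_prod A (\<lambda>i. w ! i) (length w) $ i $ j)"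
      proof (rule exists_positive_word[where s = s and A = A, OF nonneg det_nonzero k])
        fix a b :: 2 assume "a \<noteq> b"
        then have "\<not> (\<forall>k<s. A k $ a $ b = 0)" using not_tri by metis
        then show "\<exists>k<s. A k $ a $ b \<noteq> 0" by blast
      qed
      then obtain w where w: "set w \<subseteq> {..<s}" "\<And>i j. 0 < P (\<lambda>i. w ! i) (length w) $ i $ j" by blast
      from contracting_strong[OF positive_word_contracting[OF w]] show ?thesis by (rule disjI1)
    qed
  qed
qed

end

theorem theorem1:
  fixes s :: nat and A :: "nat \<Rightarrow> real^2^2" and p :: "nat \<Rightarrow> real"
  assumes nonneg: "\<And>k i j. k < s \<Longrightarrow> 0 \<le> A k $ i $ j"
    and nondiag: "\<exists>k<s. \<not> diagonal_mat (A k)"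
    and p_pos: "\<And>k. k < s \<Longrightarrow> 0 < p k"
    and p_sum: "(\<Sum>k<s. p k) = 1"
    and nonzero: "AE \<omega> in bernoulli_measure s p. \<forall>n. rand_prod A \<omega> n \<noteq> 0"
  shows
    "((AE \<omega> in bernoulli_measure s p. normalized_columns_exp_convergent (rand_prod A \<omega>)) \<longleftrightarrow>
      (AE \<omega> in bernoulli_measure s p. distinct_singular_growth (rand_prod A \<omega>)))
     \<and>
     ((AE \<omega> in bernoulli_measure s p. distinct_singular_growth (rand_prod A \<omega>)) \<longrightarrow>
       (AE \<omega> in bernoulli_measure s p.
          \<forall>L. seq_limit_point (\<lambda>n. normalized_mat (rand_prod A \<omega> n)) L \<longrightarrow> rank L = 1)
       \<and>
       (\<forall>V. (\<forall>i. 0 \<le> V $ i) \<longrightarrow>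
          (AE \<omega> in bernoulli_measure s p.
             (\<forall>n. rand_prod A \<omega> n *v V \<noteq> 0) \<longrightarrow>
             exp_convergent_along UNIV (\<lambda>n. normalized_vec (rand_prod A \<omega> n *v V)))))
     \<and>
     (\<not> common_left_eigenvector s A \<longrightarrow>
       (AE \<omega> in bernoulli_measure s p. \<not> convergent (\<lambda>n. normalized_mat (rand_prod A \<omega> n))))"
proof -
  interpret random_matrix_product s p A
    by unfold_locales (use nonneg p_pos p_sum nonzero in auto)
  have iff: "(AE \<omega> in \<B>. normalized_columns_exp_convergent (P \<omega>)) \<longleftrightarrow> (AE \<omega> in \<B>. distinct_singular_growth (P \<omega>))"
    using dichotomy[OF nondiag]
  proof
    assume "AE \<omega> in \<B>. directions_converge (P \<omega>) \<and> distinct_singular_growth (P \<omega>)"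
    then have "AE \<omega> in \<B>. normalized_columns_exp_convergent (P \<omega>)" "AE \<omega> in \<B>. distinct_singular_growth (P \<omega>)"
      by (auto intro: directions_converge_imp_columns)
    then show ?thesis by simp
  next
    assume weak: "AE \<omega> in \<B>. \<not> normalized_columns_exp_convergent (P \<omega>) \<and> \<not> distinct_singular_growth (P \<omega>)"
    then have "AE \<omega> in \<B>. \<not> normalized_columns_exp_convergent (P \<omega>)" "AE \<omega> in \<B>. \<not> distinct_singular_growth (P \<omega>)"
      by auto
    then show ?thesis using AE_contr by blast
  qed
  have directions: "AE \<omega> in \<B>. directions_converge (P \<omega>)" if "AE \<omega> in \<B>. distinct_singular_growth (P \<omega>)"
    using dichotomy[OF nondiag]
  proof
    assume "AE \<omega> in \<B>. \<not> normalized_columns_exp_convergent (P \<omega>) \<and> \<not> distinct_singular_growth (P \<omega>)"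
    with that have "AE \<omega> in \<B>. False" by eventually_elim simp
    then show ?thesis by simp
  qed auto
  have rank: "AE \<omega> in \<B>. \<forall>L. seq_limit_point (\<lambda>n. normalized_mat (P \<omega> n)) L \<longrightarrow> rank L = 1"
    if "AE \<omega> in \<B>. distinct_singular_growth (P \<omega>)"
    using that AE_space
  proof eventually_elim
    case (elim \<omega>)
    show ?case using limit_points_rank_1[OF elim(1) P_nonzero[OF elim(2)] P_nonneg[OF elim(2)]] by blast
  qed
  have vectors: "AE \<omega> in \<B>. (\<forall>n. P \<omega> n *v V \<noteq> 0) \<longrightarrow> exp_convergent_along UNIV (\<lambda>n. normalized_vec (P \<omega> n *v V))"
    if "AE \<omega> in \<B>. distinct_singular_growth (P \<omega>)" and V: "\<forall>i. 0 \<le> V $ i" for V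
    using directions[OF that(1)]
  proof eventually_elim
    case (elim \<omega>)
    then have conv: "exp_convergent_along {n. P \<omega> n *v V \<noteq> 0} (\<lambda>n. normalized_vec (P \<omega> n *v V))"
      using V by (simp add: directions_converge_def nonneg_vec_def)
    show ?case
    proof
      assume "\<forall>n. P \<omega> n *v V \<noteq> 0"
      then have "{n. P \<omega> n *v V \<noteq> 0} = UNIV" by auto
      with conv show "exp_convergent_along UNIV (\<lambda>n. normalized_vec (P \<omega> n *v V))" by simp
    qed
  qed
  show ?thesis using iff rank vectors normalized_diverges by blast
qed

end
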